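(* Let $\Lambda$ be an umbilic-free $\Omega$-surface that is also a channel surface (a channel $\Omega$-surface). Then $\Lambda$ is either a Dupin cyclide, or it is a cone, a cylinder, or a surface of revolution in a suitably chosen Euclidean subgeometry of Lie sphere geometry.
   Context: Lie sphere geometry: $\mathbb{R}^{4,2}$ is a $6$-dimensional real vector space with inner product $(\cdot,\cdot)$ of signature $(-++++-)$, $L^5$ is its light cone (nonzero lightlike vectors), and the Lie quadric is $\mathcal{L}=\{\langle v\rangle : v\neq 0,\ (v,v)=0\}$; its points represent oriented $2$-spheres (points being spheres of radius $0$). A map $\langle \mathfrak{s}\rangle:\Sigma^2\to\mathcal{L}$ is called a sphere congruence; $\mathfrak{s}$ is a lift of it. Subgeometries: a unit timelike vector $\mathfrak{p}$ ($(\mathfrak{p},\mathfrak{p})=-1$, "point sphere complex") determines a Möbius geometry whose points are the elements of $\mathcal{L}$ perpendicular to $\mathfrak{p}$. For $\mathfrak{q}\neq0$ with $\mathfrak{q}\perp\mathfrak{p}$ ("space form vector") and $\kappa=-(\mathfrak{q},\mathfrak{q})$, the set $\mathfrak{R}_{\mathfrak{p},\mathfrak{q}}=\{x\in L^5 : (x,\mathfrak{p})=0,\ (x,\mathfrak{q})=-1\}$ has constant curvature $\kappa$ and models a space form. A Euclidean subgeometry is obtained when $(\mathfrak{q},\mathfrak{q})=0$. Legendre immersions: a rank-two null bundle $\Lambda=\langle \mathfrak{s}_1,\mathfrak{s}_2\rangle$ over a surface $\Sigma^2$ is a Legendre immersion if $(\mathfrak{a},\mathfrak{b})=0$ and $(d\mathfrak{a},\mathfrak{b})=0$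 for all sections $\mathfrak{a},\mathfrak{b}\in\Gamma\Lambda$, and if for each $p\in\Sigma^2$ the condition $d_p\mathfrak{s}(X)\in\Lambda(p)$ for all $\mathfrak{s}\in\Gamma\Lambda$ implies $X=0$. $\Lambda$ envelops a sphere congruence $\langle\mathfrak{s}\rangle$ if $\mathfrak{s}(p)\in\Lambda(p)$ for all $p$. Given $\mathfrak{p}$, $\Lambda$ envelops exactly one point sphere congruence (values perpendicular to $\mathfrak{p}$), which is the surface represented by $\Lambda$ in the corresponding Möbius geometry/space form. The Legendre lift of a surface $\mathfrak{f}:\Sigma^2\to\mathfrak{R}_{\mathfrak{p},\mathfrak{q}}$ is $\Lambda=\langle\mathfrak{f},\mathfrak{t}\rangle$ with $\mathfrak{t}$ its tangent plane congruence, $(\mathfrak{t},\mathfrak{p})=-1$, $(\mathfrak{t},\mathfrak{q})=0$. Curvature spheres: away from umbilics, with curvature line coordinates $(u,v)$, the curvature sphere congruences $s_1=\langle\mathfrak{s}_1\rangle$, $s_2=\langle\mathfrak{s}_2\rangle$ are the enveloped sphere congruences with $(\mathfrak{s}_1)_u,(\mathfrak{s}_2)_v\in\Gamma\Lambda$; $\Lambda=\langle\mathfrak{s}_1,\mathfrak{s}_2\rangle$. A (possibly complex) sphere congruence $s$ is isothermic if it has a Moutard lift $\mathfrak{s}$, i.e. $\mathfrak{s}_{uv}\parallel\mathfrak{s}$ for (curvature line) parameters $(u,v)$. A surface, or its Legendre lift $\Lambda$, is an $\Omega$-surface if $\Lambda$ envelops a (possibly complex conjugate) pair of isothermic sphere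 congruences $s^{\pm}$ that separate the two curvature spheres harmonically. A surface is a channel surface if its Legendre lift envelops a $1$-parameter family of spheres (a sphere congruence depending on one parameter only; it is then a curvature sphere congruence). A Dupin cyclide is a Legendre immersion for which there is an orthogonal splitting of $\mathbb{R}^{4,2}$ into two $3$-dimensional subspaces of signature $(2,1)$, one containing all curvature spheres of one family and the other all curvature spheres of the other family.
   Formalization: The classification is asserted on every rectangular curvature line coordinate domain carrying the Moutard lifts (these cover the surface), not on the whole surface at once; on non-rectangular (e.g. U-shaped) domains different pieces can have different axes, so the global claim fails. *)

theory Defs
  imports "HOL-Analysis.Analysis"
begin

section \<open>Smooth maps and smooth surfaces\<close>

fun Ck_on :: "nat \<Rightarrow> ('a::euclidean_space \<Rightarrow> 'b::real_normed_vector) \<Rightarrow> 'a set \<Rightarrow> bool" where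
  "Ck_on 0 f U \<longleftrightarrow> continuous_on U f"
| "Ck_on (Suc k) f U \<longleftrightarrow> (\<forall>x\<in>U. f differentiable (at x)) \<and>
     (\<forall>b\<in>Basis. Ck_on k (\<lambda>x. frechet_derivative f (at x) b) U)"

text \<open>Only used for open \<open>U\<close>.\<close>

definition smooth_on :: "('a::euclidean_space \<Rightarrow> 'b::real_normed_vector) \<Rightarrow> 'a set \<Rightarrow> bool" where
  "smooth_on f U \<longleftrightarrow> (\<forall>k. Ck_on k f U)"

text \<open>A chart is a pair \<open>(E, \<phi>)\<close> of its domain and a coordinate map; the values of \<open>\<phi>\<close> outside
  \<open>E\<close> are irrelevant.\<close>

type_synonym 'a chart = "'a set \<times> ('a \<Rightarrow> real \<times> real)"

definition is_chart :: "'a topology \<Rightarrow> 'a chart \<Rightarrow> bool" where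
  "is_chart \<Sigma> = (\<lambda>(E, \<phi>). openin \<Sigma> E \<and> open (\<phi> ` E) \<and>
     homeomorphic_map (subtopology \<Sigma> E) (top_of_set (\<phi> ` E)) \<phi>)"

definition smooth_transition :: "'a chart \<Rightarrow> 'a chart \<Rightarrow> bool" where
  "smooth_transition = (\<lambda>(E, \<phi>) (F, \<psi>). smooth_on (\<psi> \<circ> inv_into E \<phi>) (\<phi> ` (E \<inter> F)))"

text \<open>\<open>A\<close> is a maximal smooth atlas of the surface \<open>\<Sigma>\<close>, so a smooth coordinate system on an open
  subset of \<open>\<Sigma>\<close> is the same thing as an element of \<open>A\<close>.\<close>

definition smooth_surface :: "'a topology \<Rightarrow> 'a chart set \<Rightarrow> bool" where
  "smooth_surface \<Sigma> A \<longleftrightarrow>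
     Hausdorff_space \<Sigma> \<and> second_countable \<Sigma> \<and>
     (\<forall>C\<in>A. is_chart \<Sigma> C) \<and>
     (\<Union>C\<in>A. fst C) = topspace \<Sigma> \<and>
     (\<forall>C\<in>A. \<forall>C'\<in>A. smooth_transition C C') \<and>
     (\<forall>C. is_chart \<Sigma> C \<and> (\<forall>C'\<in>A. smooth_transition C C' \<and> smooth_transition C' C) \<longrightarrow> C \<in> A)"

definition smooth_map :: "'a chart set \<Rightarrow> 'a set \<Rightarrow> ('a \<Rightarrow> 'b::real_normed_vector) \<Rightarrow> bool" where
  "smooth_map A N f \<longleftrightarrow> (\<forall>(E, \<phi>)\<in>A. smooth_on (f \<circ> inv_into E \<phi>) (\<phi> ` (E \<inter> N)))"

text \<open>\<open>d\<^sub>pf(X)\<close>, where the tangent vector \<open>X\<close> at \<open>p\<close> is given by its components in the chart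
  \<open>(E, \<phi>)\<close>.\<close>

definition dmap :: "'a set \<Rightarrow> ('a \<Rightarrow> real \<times> real) \<Rightarrow> ('a \<Rightarrow> 'b::real_normed_vector) \<Rightarrow> 'a
    \<Rightarrow> real \<times> real \<Rightarrow> 'b" where
  "dmap E \<phi> f p X = frechet_derivative (f \<circ> inv_into E \<phi>) (at (\<phi> p)) X"

text \<open>Partial derivatives with respect to the coordinates \<open>\<phi> = (u, v)\<close>.\<close>

definition d_u :: "'a set \<Rightarrow> ('a \<Rightarrow> real \<times> real) \<Rightarrow> ('a \<Rightarrow> 'b::real_normed_vector) \<Rightarrow> 'a \<Rightarrow> 'b" where
  "d_u E \<phi> f p = dmap E \<phi> f p (1, 0)"

definition d_v :: "'a set \<Rightarrow> ('a \<Rightarrow> real \<times> real) \<Rightarrow> ('a \<Rightarrow> 'b::real_normed_vector) \<Rightarrow> 'a \<Rightarrow> 'b" where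
  "d_v E \<phi> f p = dmap E \<phi> f p (0, 1)"


section \<open>The Lie inner product and Euclidean subgeometries\<close>

text \<open>\<open>\<real>\<^bsup>4,2\<^esup>\<close> is \<open>real^6\<close> with the following form of signature \<open>(-++++-)\<close>.\<close>

definition lie :: "real^6 \<Rightarrow> real^6 \<Rightarrow> real" where
  "lie x y = - x$1 * y$1 + x$2 * y$2 + x$3 * y$3 + x$4 * y$4 + x$5 * y$5 - x$6 * y$6"

text \<open>\<open>\<pp>\<close> is a point sphere complex and \<open>\<qq>\<close> a space form vector of curvature
  \<open>\<kappa> = -(\<qq>, \<qq>) = 0\<close>.\<close>

definition euclidean_subgeometry :: "real^6 \<Rightarrow> real^6 \<Rightarrow> bool" where
  "euclidean_subgeometry \<pp> \<qq> \<longleftrightarrow>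
     lie \<pp> \<pp> = -1 \<and> \<qq> \<noteq> 0 \<and> lie \<pp> \<qq> = 0 \<and> lie \<qq> \<qq> = 0"

definition space_form :: "real^6 \<Rightarrow> real^6 \<Rightarrow> (real^6) set" where
  "space_form \<pp> \<qq> = {x. x \<noteq> 0 \<and> lie x x = 0 \<and> lie x \<pp> = 0 \<and> lie x \<qq> = -1}"

text \<open>Cartesian coordinates of \<open>\<RR>\<^bsub>\<pp>,\<qq>\<^esub>\<close> for a Euclidean subgeometry: an origin \<open>b0\<close> in
  \<open>\<RR>\<^bsub>\<pp>,\<qq>\<^esub>\<close> together with an orthonormal frame \<open>e\<close>. The induced map \<open>euclidean_point\<close> is the
  usual isometric parametrisation of \<open>\<RR>\<^bsub>\<pp>,\<qq>\<^esub>\<close> by \<open>\<real>\<^sup>3\<close> as a paraboloid: since \<open>(f, g) = -|x - y|\<^sup>2 / 2\<close>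
  for the points \<open>f\<close>, \<open>g\<close> with coordinates \<open>x\<close>, \<open>y\<close>, one has \<open>(f - g, f - g) = |x - y|\<^sup>2\<close>.\<close>

definition euclidean_frame :: "real^6 \<Rightarrow> real^6 \<Rightarrow> real^6 \<Rightarrow> (3 \<Rightarrow> real^6) \<Rightarrow> bool" where
  "euclidean_frame \<pp> \<qq> b0 e \<longleftrightarrow> b0 \<in> space_form \<pp> \<qq> \<and>
     (\<forall>i. lie (e i) \<pp> = 0 \<and> lie (e i) \<qq> = 0 \<and> lie (e i) b0 = 0) \<and>
     (\<forall>i j. lie (e i) (e j) = (if i = j then 1 else 0))"

definition euclidean_point :: "real^6 \<Rightarrow> real^6 \<Rightarrow> (3 \<Rightarrow> real^6) \<Rightarrow> real^3 \<Rightarrow> real^6" where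
  "euclidean_point \<qq> b0 e x = b0 + (\<Sum>i\<in>UNIV. x$i *\<^sub>R e i) + ((norm x)\<^sup>2 / 2) *\<^sub>R \<qq>"

lemma lie_add_left: "lie (x + y) z = lie x z + lie y z"
  by (simp add: lie_def algebra_simps)

lemma lie_scale_left: "lie (c *\<^sub>R x) z = c * lie x z"
  by (simp add: lie_def algebra_simps)

lemma lie_commute: "lie x y = lie y x"
  by (simp add: lie_def algebra_simps)

lemma lie_add_right: "lie z (x + y) = lie z x + lie z y"
  by (simp add: lie_def algebra_simps)

lemma lie_scale_right: "lie z (c *\<^sub>R x) = c * lie z x"
  by (simp add: lie_def algebra_simps)

lemma euclidean_point_prod:
  assumes "euclidean_subgeometry \<pp> \<qq>" "euclidean_frame \<pp> \<qq> b0 e"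
  shows "lie (euclidean_point \<qq> b0 e x) (euclidean_point \<qq> b0 e y) = - (dist x y)\<^sup>2 / 2"
proof -
  have d: "(dist x y)\<^sup>2 = (\<Sum>i\<in>UNIV. (x$i - y$i)\<^sup>2)" for x y :: "real^3"
    by (simp add: dist_norm norm_vec_def L2_set_def sum_nonneg)
  have n: "(norm x)\<^sup>2 = (\<Sum>i\<in>UNIV. (x$i)\<^sup>2)" for x :: "real^3"
    using d[of x 0] by simp
  have q: "lie \<qq> \<qq> = 0" "lie \<qq> b0 = -1" "lie b0 \<qq> = -1" "lie b0 b0 = 0"
    "\<And>i. lie (e i) \<qq> = 0" "\<And>i. lie \<qq> (e i) = 0" "\<And>i. lie (e i) b0 = 0" "\<And>i. lie b0 (e i) = 0"
    "\<And>i j. lie (e i) (e j) = (if i = j then 1 else 0)"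
    using assms unfolding euclidean_subgeometry_def euclidean_frame_def space_form_def
    by (auto simp: lie_commute)
  show ?thesis
    unfolding euclidean_point_def d n sum_3
    by (simp add: lie_add_left lie_add_right lie_scale_left lie_scale_right q)
      (simp add: field_simps power2_eq_square)
qed

lemma euclidean_point_in_space_form:
  assumes "euclidean_subgeometry \<pp> \<qq>" "euclidean_frame \<pp> \<qq> b0 e"
  shows "euclidean_point \<qq> b0 e x \<in> space_form \<pp> \<qq>"
proof -
  have q: "lie \<qq> \<qq> = 0" "lie b0 \<qq> = -1" "lie \<qq> \<pp> = 0" "lie b0 \<pp> = 0"
    "\<And>i. lie (e i) \<qq> = 0" "\<And>i. lie (e i) \<pp> = 0"
    using assms unfolding euclidean_subgeometry_def euclidean_frame_def space_form_def
    by (auto simp: lie_commute)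
  have "lie (euclidean_point \<qq> b0 e x) \<qq> = -1" "lie (euclidean_point \<qq> b0 e x) \<pp> = 0"
    unfolding euclidean_point_def sum_3
    by (simp_all add: lie_add_left lie_scale_left q)
  moreover have "lie (0::real^6) \<qq> = 0"
    by (simp add: lie_def)
  ultimately show ?thesis
    using euclidean_point_prod[OF assms, of x x] by (auto simp: space_form_def)
qed


section \<open>Legendre immersions\<close>

definition local_section :: "'a topology \<Rightarrow> 'a chart set \<Rightarrow> ('a \<Rightarrow> (real^6) set) \<Rightarrow> 'a set
    \<Rightarrow> ('a \<Rightarrow> real^6) \<Rightarrow> bool" where
  "local_section \<Sigma> A \<Lambda> N s \<longleftrightarrow> openin \<Sigma> N \<and> smooth_map A N s \<and> (\<forall>p\<in>N. s p \<in> \<Lambda> p)"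

definition frame_of :: "real^6 \<Rightarrow> real^6 \<Rightarrow> (real^6) set \<Rightarrow> bool" where
  "frame_of a b L \<longleftrightarrow> a \<noteq> b \<and> independent {a, b} \<and> L = span {a, b}"

definition legendre_immersion :: "'a topology \<Rightarrow> 'a chart set \<Rightarrow> ('a \<Rightarrow> (real^6) set) \<Rightarrow> bool" where
  "legendre_immersion \<Sigma> A \<Lambda> \<longleftrightarrow>
     (\<forall>p\<in>topspace \<Sigma>. \<exists>N a b. p \<in> N \<and> local_section \<Sigma> A \<Lambda> N a \<and> local_section \<Sigma> A \<Lambda> N b \<and>
        (\<forall>x\<in>N. frame_of (a x) (b x) (\<Lambda> x))) \<and>
     (\<forall>N a b. local_section \<Sigma> A \<Lambda> N a \<and> local_section \<Sigma> A \<Lambda> N b \<longrightarrow>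
        (\<forall>p\<in>N. lie (a p) (b p) = 0 \<and>
           (\<forall>(E, \<phi>)\<in>A. p \<in> E \<longrightarrow> (\<forall>X. lie (dmap E \<phi> a p X) (b p) = 0)))) \<and>
     (\<forall>p\<in>topspace \<Sigma>. \<forall>(E, \<phi>)\<in>A. p \<in> E \<longrightarrow>
        (\<forall>X. (\<forall>N s. local_section \<Sigma> A \<Lambda> N s \<and> p \<in> N \<longrightarrow> dmap E \<phi> s p X \<in> \<Lambda> p) \<longrightarrow> X = 0))"

text \<open>At an umbilic some enveloped sphere is a curvature sphere for every tangent direction.\<close>

definition umbilic :: "'a topology \<Rightarrow> 'a chart set \<Rightarrow> ('a \<Rightarrow> (real^6) set) \<Rightarrow> 'a \<Rightarrow> bool" where
  "umbilic \<Sigma> A \<Lambda> p \<longleftrightarrow>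
     (\<exists>N s. local_section \<Sigma> A \<Lambda> N s \<and> p \<in> N \<and> s p \<noteq> 0 \<and>
        (\<forall>(E, \<phi>)\<in>A. p \<in> E \<longrightarrow> (\<forall>X. dmap E \<phi> s p X \<in> \<Lambda> p)))"

definition umbilic_free :: "'a topology \<Rightarrow> 'a chart set \<Rightarrow> ('a \<Rightarrow> (real^6) set) \<Rightarrow> bool" where
  "umbilic_free \<Sigma> A \<Lambda> \<longleftrightarrow> (\<forall>p\<in>topspace \<Sigma>. \<not> umbilic \<Sigma> A \<Lambda> p)"

text \<open>\<open>\<phi> = (u, v)\<close> are curvature line coordinates on \<open>D\<close>, and \<open>s1\<close>, \<open>s2\<close> are lifts of the two
  curvature sphere congruences.\<close>

definition curvature_spheres :: "'a chart set \<Rightarrow> ('a \<Rightarrow> (real^6) set) \<Rightarrow> 'a set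
    \<Rightarrow> ('a \<Rightarrow> real \<times> real) \<Rightarrow> ('a \<Rightarrow> real^6) \<Rightarrow> ('a \<Rightarrow> real^6) \<Rightarrow> bool" where
  "curvature_spheres A \<Lambda> D \<phi> s1 s2 \<longleftrightarrow> (D, \<phi>) \<in> A \<and>
     smooth_map A D s1 \<and> smooth_map A D s2 \<and>
     (\<forall>p\<in>D. frame_of (s1 p) (s2 p) (\<Lambda> p) \<and> d_u D \<phi> s1 p \<in> \<Lambda> p \<and> d_v D \<phi> s2 p \<in> \<Lambda> p)"


section \<open>\<open>\<Omega>\<close>-surfaces\<close>

definition cplx :: "real^6 \<Rightarrow> complex^6" where
  "cplx x = (\<chi> i. complex_of_real (x$i))"

definition cnjv :: "complex^6 \<Rightarrow> complex^6" where
  "cnjv x = (\<chi> i. cnj (x$i))"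

text \<open>A sphere congruence is isothermic if it has a lift \<open>s\<close> with \<open>s\<^sub>u\<^sub>v \<parallel> s\<close>. Real lifts are regarded
  as complex ones with \<open>cnjv (s p) = s p\<close>.\<close>

definition moutard_lift :: "'a chart set \<Rightarrow> 'a set \<Rightarrow> ('a \<Rightarrow> real \<times> real) \<Rightarrow> ('a \<Rightarrow> complex^6)
    \<Rightarrow> bool" where
  "moutard_lift A D \<phi> s \<longleftrightarrow> smooth_map A D s \<and>
     (\<forall>p\<in>D. s p \<noteq> 0 \<and> (\<exists>k. d_v D \<phi> (d_u D \<phi> s) p = k *s s p))"

text \<open>The points \<open>\<langle>x\<rangle>\<close>, \<open>\<langle>y\<rangle>\<close> of the (complex) projective line through \<open>\<langle>a\<rangle>\<close>, \<open>\<langle>b\<rangle>\<close> separate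
  \<open>\<langle>a\<rangle>\<close>, \<open>\<langle>b\<rangle>\<close> harmonically, i.e. their cross ratio is \<open>-1\<close>.\<close>

definition harmonic_separation :: "complex^6 \<Rightarrow> complex^6 \<Rightarrow> complex^6 \<Rightarrow> complex^6 \<Rightarrow> bool" where
  "harmonic_separation a b x y \<longleftrightarrow>
     (\<exists>\<alpha> \<beta> \<gamma>. \<alpha> \<noteq> 0 \<and> \<beta> \<noteq> 0 \<and> \<gamma> \<noteq> 0 \<and> x = \<alpha> *s a + \<beta> *s b \<and> y = \<gamma> *s (\<alpha> *s a - \<beta> *s b))"

text \<open>Curvature line coordinates that identify \<open>D\<close> with a (possibly unbounded) open coordinate
  rectangle, on which \<open>\<Lambda>\<close> envelops a pair \<open>sp\<close>, \<open>sm\<close> of isothermic sphere congruences. The pair is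
  either real or complex conjugate; envelopment, \<open>sp p \<in> \<Lambda> p \<otimes> \<complex>\<close>, is part of harmonic
  separation.\<close>

definition omega_rectangle :: "'a chart set \<Rightarrow> ('a \<Rightarrow> (real^6) set) \<Rightarrow> 'a set
    \<Rightarrow> ('a \<Rightarrow> real \<times> real) \<Rightarrow> bool" where
  "omega_rectangle A \<Lambda> D \<phi> \<longleftrightarrow>
     (\<exists>I J. open I \<and> open J \<and> connected I \<and> connected J \<and> I \<noteq> {} \<and> J \<noteq> {} \<and> \<phi> ` D = I \<times> J) \<and>
     (\<exists>s1 s2 sp sm. curvature_spheres A \<Lambda> D \<phi> s1 s2 \<and>
        moutard_lift A D \<phi> sp \<and> moutard_lift A D \<phi> sm \<and>
        ((\<forall>p\<in>D. cnjv (sp p) = sp p \<and> cnjv (sm p) = sm p) \<or> (\<forall>p\<in>D. sm p = cnjv (sp p))) \<and>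
        (\<forall>p\<in>D. harmonic_separation (cplx (s1 p)) (cplx (s2 p)) (sp p) (sm p)))"

text \<open>Being an \<open>\<Omega>\<close>-surface is a local condition, as it is formulated in curvature line
  coordinates.\<close>

definition omega_surface :: "'a topology \<Rightarrow> 'a chart set \<Rightarrow> ('a \<Rightarrow> (real^6) set) \<Rightarrow> bool" where
  "omega_surface \<Sigma> A \<Lambda> \<longleftrightarrow> legendre_immersion \<Sigma> A \<Lambda> \<and>
     (\<forall>p\<in>topspace \<Sigma>. \<exists>D \<phi>. p \<in> D \<and> omega_rectangle A \<Lambda> D \<phi>)"


section \<open>Channel surfaces and Dupin cyclides\<close>

text \<open>The enveloped congruence \<open>\<langle>s\<rangle>\<close> depends on one parameter only: near every point it factors as
  a smooth curve \<open>c\<close> in the Lie quadric composed with a smooth real parameter \<open>t\<close>. The lift \<open>s\<close>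
  itself is an arbitrary choice of representatives and need not be smooth.\<close>

definition channel_surface :: "'a topology \<Rightarrow> 'a chart set \<Rightarrow> ('a \<Rightarrow> (real^6) set) \<Rightarrow> bool" where
  "channel_surface \<Sigma> A \<Lambda> \<longleftrightarrow>
     (\<exists>s. \<forall>p\<in>topspace \<Sigma>. s p \<noteq> 0 \<and> s p \<in> \<Lambda> p \<and>
        (\<exists>N T (t :: 'a \<Rightarrow> real) (c :: real \<Rightarrow> real^6).
           openin \<Sigma> N \<and> p \<in> N \<and> smooth_map A N t \<and> open T \<and> t ` N \<subseteq> T \<and> smooth_on c T \<and>
           (\<forall>x\<in>N. c (t x) \<noteq> 0 \<and> span {s x} = span {c (t x)})))"

definition signature_2_1 :: "(real^6) set \<Rightarrow> bool" where
  "signature_2_1 V \<longleftrightarrow> (\<exists>a b c. V = span {a, b, c} \<and>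
     lie a a = 1 \<and> lie b b = 1 \<and> lie c c = -1 \<and> lie a b = 0 \<and> lie a c = 0 \<and> lie b c = 0)"

definition dupin_cyclide :: "'a chart set \<Rightarrow> ('a \<Rightarrow> (real^6) set) \<Rightarrow> 'a set \<Rightarrow> bool" where
  "dupin_cyclide A \<Lambda> D \<longleftrightarrow>
     (\<exists>\<phi> s1 s2 V1 V2. curvature_spheres A \<Lambda> D \<phi> s1 s2 \<and>
        signature_2_1 V1 \<and> signature_2_1 V2 \<and> (\<forall>x\<in>V1. \<forall>y\<in>V2. lie x y = 0) \<and>
        (\<forall>z. \<exists>x\<in>V1. \<exists>y\<in>V2. z = x + y) \<and>
        (\<forall>p\<in>D. s1 p \<in> V1 \<and> s2 p \<in> V2))"


section \<open>Cones, cylinders and surfaces of revolution\<close>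

text \<open>Parametrised surfaces \<open>X :: U \<rightarrow> \<real>\<^sup>3\<close>. Surfaces represented by Legendre immersions may have
  singularities, so \<open>X\<close> is not required to be an immersion, but the rulings, respectively the
  circles of latitude, have to be traversed regularly. Without this condition every curve
  \<open>X(u, v) = c(v)\<close>, as the point sphere map of a tube of radius \<open>0\<close>, would count as a cone or a
  cylinder.\<close>

definition regular_at :: "(real \<Rightarrow> real) \<Rightarrow> real \<Rightarrow> bool" where
  "regular_at t u \<longleftrightarrow> (\<exists>t'. t' \<noteq> 0 \<and> (t has_real_derivative t') (at u))"

definition is_cone :: "(real \<times> real) set \<Rightarrow> (real \<times> real \<Rightarrow> real^3) \<Rightarrow> bool" where
  "is_cone U X \<longleftrightarrow> (\<exists>a t \<gamma>. \<forall>(u, v)\<in>U.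
     regular_at t u \<and> \<gamma> v \<noteq> 0 \<and> X (u, v) = a + t u *\<^sub>R \<gamma> v)"

definition is_cylinder :: "(real \<times> real) set \<Rightarrow> (real \<times> real \<Rightarrow> real^3) \<Rightarrow> bool" where
  "is_cylinder U X \<longleftrightarrow> (\<exists>d t \<gamma>. d \<noteq> 0 \<and> (\<forall>(u, v)\<in>U.
     regular_at t u \<and> X (u, v) = \<gamma> v + t u *\<^sub>R d))"

definition is_revolution :: "(real \<times> real) set \<Rightarrow> (real \<times> real \<Rightarrow> real^3) \<Rightarrow> bool" where
  "is_revolution U X \<longleftrightarrow> (\<exists>a e1 e2 e3 r h \<theta>.
     norm e1 = 1 \<and> norm e2 = 1 \<and> norm e3 = 1 \<and> e1 \<bullet> e2 = 0 \<and> e1 \<bullet> e3 = 0 \<and> e2 \<bullet> e3 = 0 \<and>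
     (\<forall>(u, v)\<in>U. regular_at \<theta> u \<and>
        X (u, v) = a + r v *\<^sub>R (cos (\<theta> u) *\<^sub>R e1 + sin (\<theta> u) *\<^sub>R e2) + h v *\<^sub>R e3))"

text \<open>In the Euclidean subgeometry given by \<open>\<pp>\<close>, \<open>\<qq>\<close>, the point sphere congruence enveloped by
  \<open>\<Lambda>\<close> on \<open>D\<close>, written in Cartesian coordinates of \<open>\<RR>\<^bsub>\<pp>,\<qq>\<^esub>\<close> and in some smooth coordinates of
  \<open>D\<close>, has the property \<open>P\<close>.\<close>

definition represents_in :: "((real \<times> real) set \<Rightarrow> (real \<times> real \<Rightarrow> real^3) \<Rightarrow> bool)
    \<Rightarrow> 'a chart set \<Rightarrow> ('a \<Rightarrow> (real^6) set) \<Rightarrow> 'a set \<Rightarrow> real^6 \<Rightarrow> real^6 \<Rightarrow> bool" where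
  "represents_in P A \<Lambda> D \<pp> \<qq> \<longleftrightarrow>
     (\<exists>\<psi> f x b0 e. (D, \<psi>) \<in> A \<and> euclidean_frame \<pp> \<qq> b0 e \<and>
        (\<forall>p\<in>D. f p \<in> \<Lambda> p \<and> f p \<in> space_form \<pp> \<qq> \<and> f p = euclidean_point \<qq> b0 e (x p)) \<and>
        P (\<psi> ` D) (x \<circ> inv_into D \<psi>))"

end

theory Submission
  imports Defs
begin

text \<open>Let \<open>s1\<close>, \<open>s2\<close> be the curvature sphere congruences over a coordinate rectangle \<open>I \<times> J\<close>. If
  \<open>c(t)\<close> is an enveloped one-parameter family, then its derivatives \<open>t\<^sub>u c'\<close> and \<open>t\<^sub>v c'\<close> are parallel,
  while those of a general combination of \<open>s1\<close> and \<open>s2\<close> are independent modulo \<open>\<Lambda>\<close>. Hence the family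
  consists of curvature spheres, of \<open>s1\<close> say after exchanging \<open>u\<close> and \<open>v\<close>, and \<open>s1\<close> has a lift
  \<open>\<sigma>(v)\<close> that does not depend on \<open>u\<close> (\<open>channel_dichotomy\<close>, \<open>channel_constant\<close>).

  Write the two Moutard lifts as \<open>\<alpha> \<sigma> + \<beta> s2\<close> and \<open>\<gamma> (\<alpha> \<sigma> - \<beta> s2)\<close>. Pairing the Moutard equations
  with \<open>\<sigma>\<close>, \<open>s2\<close> and their derivatives shows that \<open>\<alpha>\<close> does not depend on \<open>u\<close>, that \<open>\<gamma>\<close> is constant and
  that the mixed derivatives of the Moutard lifts vanish (\<open>Sp_uv_zero\<close>). So \<open>\<beta> s2\<close>, or a
  real lift obtained from it by taking real or imaginary parts, has the form \<open>a(v) + \<Phi>(u)\<close>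
  (\<open>translation_net_exists\<close>).

  All vectors \<open>\<Phi>(u)\<close> are orthogonal to all \<open>\<sigma>(v)\<close>, and therefore to \<open>\<sigma>\<close>, \<open>\<sigma>'\<close>, \<open>\<sigma>''\<close>, which span a
  space of signature \<open>(2,1)\<close>. Hence \<open>W = span \<Phi>(I)\<close> lies in a space of signature \<open>(2,1)\<close>. If \<open>W\<close> is the
  whole of it, then it contains the spheres of the second family and its complement those of the first:
  the surface is a Dupin cyclide (\<open>dupin_splitting\<close>). Otherwise \<open>W\<close> is a plane that contains the
  spacelike vectors \<open>\<Phi>'(u)\<close>, and its signature decides the shape of the surface. If \<open>W\<close> is Lorentzian, then
  its two null lines, taken as a point and the point at infinity, are incident with all spheres
  \<open>\<sigma>(v)\<close>, and the surface is a cone (\<open>cone\<close>). If \<open>W\<close> is degenerate, then these two points coincide, and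
  the surface is a cylinder (\<open>cylinder\<close>). If \<open>W\<close> is Euclidean, then the rotations of \<open>W\<close> preserve all
  \<open>\<sigma>(v)\<close> and act on the spheres \<open>a(v) + \<Phi>(u)\<close> by moving \<open>u\<close>, and the surface is one of revolution
  (\<open>revolution\<close>). In the last case the point at infinity must be a null direction in the complement of
  \<open>W\<close> that is none of the directions \<open>\<sigma>(v)\<close>; it exists because a curve does not cover a surface
  (\<open>null_direction_off_curve\<close>).\<close>


section \<open>The signature of the Lie form\<close>

interpretation lie: bounded_bilinear lie
proof -
  have "bilinear lie"
    unfolding bilinear_def
    by (auto intro!: linearI simp: lie_add_left lie_add_right lie_scale_left lie_scale_right)
  then show "bounded_bilinear lie" by (simp add: bilinear_conv_bounded_bilinear)
qed

lemma exhaust_6: "(x::6) = 1 \<or> x = 2 \<or> x = 3 \<or> x = 4 \<or> x = 5 \<or> x = 6"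
proof (induct x)
  case (of_int z)
  then have "0 \<le> z" and "z < 6" by simp_all
  then have "z = 0 \<or> z = 1 \<or> z = 2 \<or> z = 3 \<or> z = 4 \<or> z = 5" by arith
  then show ?case by auto
qed

lemma vec6_eq_0_iff:
  fixes x :: "'b::zero^6"
  shows "x = 0 \<longleftrightarrow> x$1 = 0 \<and> x$2 = 0 \<and> x$3 = 0 \<and> x$4 = 0 \<and> x$5 = 0 \<and> x$6 = 0"
proof
  assume *: "x$1 = 0 \<and> x$2 = 0 \<and> x$3 = 0 \<and> x$4 = 0 \<and> x$5 = 0 \<and> x$6 = 0"
  have "x$i = 0" for i using exhaust_6[of i] * by auto
  then show "x = 0" by (simp add: vec_eq_iff)
qed simp

lemma independent_card_le_DIM:
  fixes f :: "'a::euclidean_space \<Rightarrow> 'b::euclidean_space"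
  assumes B: "independent B" and f: "linear f" "\<And>x. x \<in> span B \<Longrightarrow> f x = 0 \<Longrightarrow> x = 0"
  shows "card B \<le> DIM('b)"
proof -
  have "inj_on f (span B)"
    using linear_inj_on_span_iff_independent_image linear_injective_on_subspace_0[OF f(1)] f(2) by auto
  then have "dim (f ` B) = dim B" using dim_image_eq[OF f(1)] by simp
  then show ?thesis
    using dim_subset_UNIV[of "f ` B"] dim_eq_card_independent[OF B] by simp
qed

text \<open>The projection to the two coordinates with negative sign is injective on a subspace on which
  the form is nonpositive. This and the analogous bound for the opposite sign are Sylvester's law of
  inertia for the form at hand.\<close>

lemma independent_card_le_2_if_nonpos:
  assumes B: "independent B" and le: "\<And>x. x \<in> span B \<Longrightarrow> lie x x \<le> 0"
  shows "card B \<le> 2"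
proof -
  have "linear (\<lambda>x :: real^6. (x$1, x$6))" by (rule linearI) auto
  moreover have "x = 0" if x: "x \<in> span B" "(x$1, x$6) = 0" for x
  proof -
    have "(x$2)\<^sup>2 + (x$3)\<^sup>2 + (x$4)\<^sup>2 + (x$5)\<^sup>2 \<le> 0"
      using le[OF x(1)] x(2) by (simp add: lie_def power2_eq_square zero_prod_def)
    then have "x$2 = 0" "x$3 = 0" "x$4 = 0" "x$5 = 0"
      by (smt (verit) zero_le_power2 power2_eq_iff_nonneg zero_power2 power2_less_eq_zero_iff)+
    with x(2) show ?thesis by (simp add: vec6_eq_0_iff zero_prod_def)
  qed
  ultimately show ?thesis using independent_card_le_DIM[OF B] by fastforce
qed

lemma independent_card_le_4_if_nonneg:
  assumes B: "independent B" and ge: "\<And>x. x \<in> span B \<Longrightarrow> 0 \<le> lie x x"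
  shows "card B \<le> 4"
proof -
  have "linear (\<lambda>x :: real^6. (x$2, x$3, x$4, x$5))" by (rule linearI) auto
  moreover have "x = 0" if x: "x \<in> span B" "(x$2, x$3, x$4, x$5) = 0" for x
  proof -
    have "(x$1)\<^sup>2 + (x$6)\<^sup>2 \<le> 0"
      using ge[OF x(1)] x(2) by (simp add: lie_def power2_eq_square zero_prod_def)
    then show ?thesis using x(2) by (simp add: vec6_eq_0_iff zero_prod_def sum_power2_le_zero_iff)
  qed
  ultimately show ?thesis using independent_card_le_DIM[OF B] by fastforce
qed

lemma orthogonal_span:
  assumes "\<And>x. x \<in> B \<Longrightarrow> lie x z = 0" and "y \<in> span B"
  shows "lie y z = 0"
proof -
  have "subspace {y. lie y z = 0}"
    by (simp add: subspace_def lie.add_left lie.scaleR_left lie.zero_left)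
  then have "span B \<subseteq> {y. lie y z = 0}"
    using assms(1) by (intro span_minimal) auto
  then show ?thesis using assms(2) by auto
qed

text \<open>A null plane and a vector orthogonal to it that is not spacelike would together span a
  three-dimensional space on which the form is nonpositive. Derivatives of sections of \<open>\<Lambda>\<close> are of this
  kind: they are orthogonal to \<open>\<Lambda>\<close> and thus spacelike as soon as they leave \<open>\<Lambda>\<close>.\<close>

lemma lie_gt_0_if_perp_null_plane:
  assumes "x \<noteq> y" "independent {x, y}"
    and xy: "lie x x = 0" "lie x y = 0" "lie y y = 0"
    and z: "lie z x = 0" "lie z y = 0" "z \<notin> span {x, y}"
  shows "lie z z > 0"
proof (rule ccontr)
  assume neg: "\<not> lie z z > 0"
  have ind: "independent {z, x, y}"
    using assms(2) z(3) by (simp add: independent_insertI)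
  have "lie w w \<le> 0" if w: "w \<in> span {z, x, y}" for w
  proof -
    obtain a b c where "w - a *\<^sub>R z - b *\<^sub>R x = c *\<^sub>R y"
      using w by (auto simp: span_insert span_empty diff_eq_eq)
    then have "w = a *\<^sub>R z + b *\<^sub>R x + c *\<^sub>R y" by (simp add: algebra_simps)
    then have "lie w w = a\<^sup>2 * lie z z"
      using xy z(1,2) by (simp add: lie.add_left lie.add_right lie.scaleR_left lie.scaleR_right
          lie_commute[of x z] lie_commute[of y z] lie_commute[of y x] power2_eq_square)
    then show ?thesis using neg by (simp add: mult_nonneg_nonpos)
  qed
  then have "card {z, x, y} \<le> 2"
    by (rule independent_card_le_2_if_nonpos[OF ind])
  moreover have "z \<noteq> x" "z \<noteq> y" using z(3) by (auto simp: span_base)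
  ultimately show False using assms(1) by simp
qed

definition lie_orthonormal :: "(real^6) set \<Rightarrow> bool" where
  "lie_orthonormal S \<longleftrightarrow>
     (\<forall>x\<in>S. lie x x = 1 \<or> lie x x = -1) \<and> (\<forall>x\<in>S. \<forall>y\<in>S. x \<noteq> y \<longrightarrow> lie x y = 0)"

lemma lie_orthonormal_subset: "lie_orthonormal S \<Longrightarrow> T \<subseteq> S \<Longrightarrow> lie_orthonormal T"
  unfolding lie_orthonormal_def by blast

lemma lie_orthonormal_independent:
  assumes S: "lie_orthonormal S"
  shows "independent S"
proof
  assume "dependent S"
  then obtain x where x: "x \<in> S" "x \<in> span (S - {x})" by (auto simp: dependent_def)
  have "lie x x = 0"
    using S x by (intro orthogonal_span[of "S - {x}" x x]) (auto simp: lie_orthonormal_def)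
  then show False using S x(1) by (auto simp: lie_orthonormal_def)
qed

lemma lie_sum_orthonormal:
  assumes S: "lie_orthonormal S" "finite S"
  shows "lie (\<Sum>x\<in>S. c x *\<^sub>R x) (\<Sum>x\<in>S. c x *\<^sub>R x) = (\<Sum>x\<in>S. (c x)\<^sup>2 * lie x x)"
    and "s \<in> S \<Longrightarrow> lie (\<Sum>x\<in>S. c x *\<^sub>R x) s = c s * lie s s"
proof -
  have *: "lie (\<Sum>x\<in>S. c x *\<^sub>R x) s = c s * lie s s" if "s \<in> S" for s
  proof -
    have "lie (\<Sum>x\<in>S. c x *\<^sub>R x) s = (\<Sum>x\<in>S. c x * lie x s)"
      by (simp add: lie.sum_left lie.scaleR_left)
    also have "\<dots> = (\<Sum>x\<in>S. if x = s then c s * lie s s else 0)"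
      using S that by (intro sum.cong) (auto simp: lie_orthonormal_def)
    finally show ?thesis using that S(2) by simp
  qed
  then show "s \<in> S \<Longrightarrow> lie (\<Sum>x\<in>S. c x *\<^sub>R x) s = c s * lie s s" .
  show "lie (\<Sum>x\<in>S. c x *\<^sub>R x) (\<Sum>x\<in>S. c x *\<^sub>R x) = (\<Sum>x\<in>S. (c x)\<^sup>2 * lie x x)"
    unfolding lie.sum_right[of _ "\<lambda>x. c x *\<^sub>R x"]
    by (intro sum.cong) (auto simp: lie.scaleR_right * power2_eq_square)
qed

lemma lie_orthonormal_signs:
  assumes S: "lie_orthonormal S"
  shows "finite S" "card {x \<in> S. lie x x = -1} \<le> 2" "card {x \<in> S. lie x x = 1} \<le> 4"
proof -
  show fin: "finite S" using lie_orthonormal_independent[OF S] by (rule independent_imp_finite)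
  have sub: "lie_orthonormal {x \<in> S. lie x x = c}" "finite {x \<in> S. lie x x = c}" for c
    using lie_orthonormal_subset[OF S] fin by auto
  show "card {x \<in> S. lie x x = -1} \<le> 2"
  proof (rule independent_card_le_2_if_nonpos[OF lie_orthonormal_independent[OF sub(1)]])
    fix w assume "w \<in> span {x \<in> S. lie x x = -1}"
    then obtain c where "w = (\<Sum>x | x \<in> S \<and> lie x x = -1. c x *\<^sub>R x)"
      using span_finite[OF sub(2)] by auto
    then show "lie w w \<le> 0"
      by (simp add: lie_sum_orthonormal(1)[OF sub] sum_nonpos)
  qed
  show "card {x \<in> S. lie x x = 1} \<le> 4"
  proof (rule independent_card_le_4_if_nonneg[OF lie_orthonormal_independent[OF sub(1)]])
    fix w assume "w \<in> span {x \<in> S. lie x x = 1}"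
    then obtain c where "w = (\<Sum>x | x \<in> S \<and> lie x x = 1. c x *\<^sub>R x)"
      using span_finite[OF sub(2)] by auto
    then show "0 \<le> lie w w"
      by (simp add: lie_sum_orthonormal(1)[OF sub] sum_nonneg)
  qed
qed

lemma lie_dual:
  "\<exists>x'. \<forall>y. lie x' y = x \<bullet> y"
proof (intro exI allI)
  fix y
  have "i \<in> {1, 2, 3, 4, 5, 6}" for i :: 6 using exhaust_6[of i] by simp
  then have u: "UNIV = {1, 2, 3, 4, 5, 6::6}" by (intro equalityI subsetI) auto
  have "x \<bullet> y = x$1 * y$1 + x$2 * y$2 + x$3 * y$3 + x$4 * y$4 + x$5 * y$5 + x$6 * y$6"
    unfolding inner_vec_def u by simp
  then show "lie (\<chi> i. if i = 1 \<or> i = 6 then - x$i else x$i) y = x \<bullet> y"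
    by (simp add: lie_def)
qed

lemma lie_nondegenerate:
  assumes "\<And>y. lie x y = 0" shows "x = 0"
proof -
  obtain x' where "\<And>y. lie x' y = x \<bullet> y" using lie_dual by blast
  then have "x \<bullet> x = 0" using assms by (metis lie_commute)
  then show ?thesis by simp
qed

text \<open>The form is nondegenerate on the orthogonal complement of an orthonormal set, so by
  polarization some vector of the complement has nonzero square.\<close>

lemma lie_orthonormal_extend:
  assumes S: "lie_orthonormal S" and card: "card S < 6"
  obtains y where "y \<notin> S" "lie_orthonormal (insert y S)"
proof -
  note fin = lie_orthonormal_signs(1)[OF S]
  have "dim S < DIM(real^6)" using dim_le_card'[OF fin] card by simp
  then obtain x where x: "x \<noteq> 0" "\<And>y. y \<in> span S \<Longrightarrow> orthogonal x y"
    using orthogonal_to_subspace_exists by blast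
  obtain z where z: "\<And>y. lie z y = x \<bullet> y" using lie_dual by blast
  have zS: "lie z s = 0" if "s \<in> S" for s
    using x(2)[of s] that by (simp add: z orthogonal_def span_base)
  define y where "y = x - (\<Sum>s\<in>S. (lie s s * lie x s) *\<^sub>R s)"
  have yS: "lie y s = 0" if "s \<in> S" for s
    using that S by (simp add: y_def lie.diff_left lie_sum_orthonormal(2)[OF S fin])
      (auto simp: lie_orthonormal_def)
  have "lie z y = x \<bullet> x"
    by (simp add: y_def lie.diff_right lie.sum_right lie.scaleR_right zS) (simp add: z)
  then have zy: "lie z y \<noteq> 0" using x(1) by simp
  \<comment> \<open>polarization: the square of \<open>z + y\<close> contains \<open>2 (z, y)\<close>\<close>
  have "\<exists>w\<in>{z, y, z + y}. lie w w \<noteq> 0"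
  proof (rule ccontr)
    assume "\<not> ?thesis"
    then have "lie z z = 0" "lie y y = 0" "lie (z + y) (z + y) = 0" by auto
    then show False using zy by (simp add: lie.add_left lie.add_right lie_commute)
  qed
  then obtain w where w: "w \<in> {z, y, z + y}" "lie w w \<noteq> 0" by blast
  then have wS: "lie w s = 0" if "s \<in> S" for s
    using zS yS that by (auto simp: lie.add_left)
  define w' where "w' = (1 / sqrt \<bar>lie w w\<bar>) *\<^sub>R w"
  have "lie w' w' = lie w w / (sqrt \<bar>lie w w\<bar> * sqrt \<bar>lie w w\<bar>)"
    by (simp add: w'_def lie.scaleR_left lie.scaleR_right)
  also have "\<dots> = lie w w / \<bar>lie w w\<bar>" by simp
  finally have w': "lie w' w' = 1 \<or> lie w' w' = -1" using w(2) by (auto simp: abs_if)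
  have w'S: "lie w' s = 0" "lie s w' = 0" if "s \<in> S" for s
    using wS[OF that] by (simp_all add: w'_def lie.scaleR_left lie_commute[of s])
  show ?thesis
  proof
    show "w' \<notin> S" using w' w'S by fastforce
    show "lie_orthonormal (insert w' S)"
      using S w' w'S by (auto simp: lie_orthonormal_def)
  qed
qed

text \<open>The signs of a maximal orthonormal set are forced by the two dimension bounds.\<close>

lemma lie_orthonormal_complete:
  assumes "lie_orthonormal S"
  obtains T where "S \<subseteq> T" "lie_orthonormal T" "finite T"
    "card {x \<in> T. lie x x = -1} = 2" "card {x \<in> T. lie x x = 1} = 4" "card T = 6"
proof -
  have split: "card T = card {x \<in> T. lie x x = -1} + card {x \<in> T. lie x x = 1}"
    if "lie_orthonormal T" for T
  proof -
    have "T = {x \<in> T. lie x x = -1} \<union> {x \<in> T. lie x x = 1}"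
      using that by (auto simp: lie_orthonormal_def)
    then have "card T = card ({x \<in> T. lie x x = -1} \<union> {x \<in> T. lie x x = 1})" by simp
    also have "\<dots> = card {x \<in> T. lie x x = -1} + card {x \<in> T. lie x x = 1}"
      using lie_orthonormal_signs(1)[OF that] by (intro card_Un_disjoint) auto
    finally show ?thesis .
  qed
  have "\<exists>T. S \<subseteq> T \<and> lie_orthonormal T \<and> card T = 6"
    using assms
  proof (induction "6 - card S" arbitrary: S)
    case 0
    then show ?case using split[of S] lie_orthonormal_signs[of S] by (intro exI[of _ S]) auto
  next
    case (Suc n)
    have "card S < 6" using Suc(2) by simp
    then obtain y where y: "y \<notin> S" "lie_orthonormal (insert y S)"
      by (rule lie_orthonormal_extend[OF Suc.prems])
    have "card (insert y S) = Suc (card S)"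
      using y lie_orthonormal_signs(1)[OF Suc.prems] by simp
    then have "n = 6 - card (insert y S)" using Suc(2) by simp
    from Suc(1)[OF this y(2)] show ?case by auto
  qed
  then obtain T where T: "S \<subseteq> T" "lie_orthonormal T" "card T = 6" by blast
  then show ?thesis using that[of T] split[of T] lie_orthonormal_signs[of T] by auto
qed

lemma lie_orthonormal_expand:
  assumes T: "lie_orthonormal T" "card T = 6"
  shows "x = (\<Sum>s\<in>T. (lie s s * lie x s) *\<^sub>R s)"
proof -
  note fin = lie_orthonormal_signs(1)[OF T(1)]
  define d where "d = x - (\<Sum>s\<in>T. (lie s s * lie x s) *\<^sub>R s)"
  have dT: "lie s d = 0" if "s \<in> T" for s
    unfolding lie_commute[of s] using that T
    by (simp add: d_def lie.diff_left lie_sum_orthonormal(2)[OF T(1) fin])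
      (auto simp: lie_orthonormal_def)
  have "dim T = DIM(real^6)"
    using T lie_orthonormal_independent[OF T(1)] by (simp add: dim_eq_card_independent)
  then have "span T = UNIV" using dim_eq_full by blast
  then have "lie d y = 0" for y
    using orthogonal_span[of T d y] dT by (simp add: lie_commute)
  then have "d = 0" by (rule lie_nondegenerate)
  then show ?thesis by (simp add: d_def)
qed

section \<open>Frames of Euclidean subgeometries\<close>

lemmas lie_simps = lie.add_left lie.add_right lie.diff_left lie.diff_right lie.minus_left
  lie.minus_right lie.scaleR_left lie.scaleR_right lie.zero_left lie.zero_right

text \<open>The null vectors \<open>q\<close>, \<open>b\<close> span a plane of signature \<open>(1,1)\<close> with orthonormal basis
  \<open>q/2 - b\<close>, \<open>q/2 + b\<close>, so its complement has signature \<open>(3,1)\<close>. An orthonormal basis of that complement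
  supplies the point sphere complex \<open>p\<close> and the coordinate directions of a Euclidean subgeometry with
  point at infinity \<open>q\<close> and origin \<open>b\<close>; some of the directions can be prescribed through \<open>E\<close>.\<close>

lemma hyperbolic_pair_extend:
  assumes q: "lie q q = 0" "lie b q = -1" "lie b b = 0"
    and E: "lie_orthonormal E" "\<And>x. x \<in> E \<Longrightarrow> lie x x = 1 \<and> lie x q = 0 \<and> lie x b = 0"
  obtains p F where "lie p p = -1" "lie p q = 0" "lie p b = 0"
    "E \<subseteq> F" "card F = 3" "lie_orthonormal F"
    "\<And>x. x \<in> F \<Longrightarrow> lie x x = 1 \<and> lie x q = 0 \<and> lie x b = 0 \<and> lie x p = 0"
proof -
  define f g where "f = (1/2) *\<^sub>R q - b" and "g = (1/2) *\<^sub>R q + b"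
  have qb: "lie q b = -1" using q(2) by (simp add: lie_commute)
  have fg: "lie f f = 1" "lie g g = -1" "lie f g = 0" "lie g f = 0"
    by (simp_all add: f_def g_def lie_simps q qb)
  have qb_fg: "q = f + g" "b = (1/2) *\<^sub>R (g - f)"
    by (simp_all add: f_def g_def vec_eq_iff)
  have Efg: "lie x f = 0" "lie x g = 0" "lie f x = 0" "lie g x = 0" if "x \<in> E" for x
    using E(2)[OF that] by (simp_all add: f_def g_def lie_simps lie_commute[of q x] lie_commute[of b x])
  have "lie_orthonormal (insert f (insert g E))"
    using E(1) fg Efg by (auto simp: lie_orthonormal_def)
  then obtain T where T: "insert f (insert g E) \<subseteq> T" "lie_orthonormal T" "finite T"
    "card {x \<in> T. lie x x = -1} = 2" "card {x \<in> T. lie x x = 1} = 4" "card T = 6"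
    by (rule lie_orthonormal_complete)
  have T0: "lie x y = 0" if "x \<in> T" "y \<in> T" "x \<noteq> y" for x y
    using T(2) that by (auto simp: lie_orthonormal_def)
  have "card ({x \<in> T. lie x x = -1} - {g}) = 1"
    using T fg by (subst card_Diff_singleton) auto
  then obtain p where "{x \<in> T. lie x x = -1} - {g} = {p}" by (auto simp: card_1_singleton_iff)
  then have p: "p \<in> T" "lie p p = -1" "p \<noteq> g" by auto
  define F where "F = {x \<in> T. lie x x = 1} - {f}"
  have cF: "card F = 3" unfolding F_def using T fg by (subst card_Diff_singleton) auto
  have pf: "lie p f = 0" "lie p g = 0" using p T(1) fg by (auto intro!: T0)
  show ?thesis
  proof
    show "lie p p = -1" by (rule p)
    show "lie p q = 0" "lie p b = 0" using pf by (simp_all add: qb_fg(1)) (simp_all add: qb_fg(2) lie_simps pf)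
    show "E \<subseteq> F" using T(1) E(2) Efg fg by (fastforce simp: F_def)
    show "card F = 3" by (rule cF)
    show "lie_orthonormal F" using T(2) by (rule lie_orthonormal_subset) (auto simp: F_def)
    fix x assume x: "x \<in> F"
    then have xx: "lie x x = 1" "lie x f = 0" "lie x g = 0" "lie x p = 0"
      using p T(1) fg by (auto simp: F_def intro!: T0)
    then show "lie x x = 1 \<and> lie x q = 0 \<and> lie x b = 0 \<and> lie x p = 0"
      by (subst qb_fg(1), subst qb_fg(2)) (simp add: lie_simps)
  qed
qed

text \<open>Any vector that is not orthogonal to \<open>q\<close> becomes a partner after it is projected away from
  \<open>E\<close>, normalised, and made null by adding a multiple of \<open>q\<close>.\<close>

lemma null_partner:
  assumes q: "q \<noteq> 0" "lie q q = 0"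
    and E: "lie_orthonormal E" "\<And>x. x \<in> E \<Longrightarrow> lie x x = 1 \<and> lie x q = 0"
  obtains b where "lie b q = -1" "lie b b = 0" "\<And>x. x \<in> E \<Longrightarrow> lie x b = 0"
proof -
  note fin = lie_orthonormal_signs(1)[OF E(1)]
  obtain y where y: "lie q y \<noteq> 0" using lie_nondegenerate[of q] q(1) by blast
  define w where "w = y - (\<Sum>s\<in>E. lie y s *\<^sub>R s)"
  have wE: "lie w s = 0" if "s \<in> E" for s
    using that E by (simp add: w_def lie.diff_left lie_sum_orthonormal(2)[OF E(1) fin])
  have wq: "lie w q = lie q y"
    using E by (simp add: w_def lie.diff_left lie.sum_left lie.scaleR_left lie_commute[of q y])
  define z where "z = (- 1 / lie q y) *\<^sub>R w"
  have z: "lie z q = -1" "\<And>s. s \<in> E \<Longrightarrow> lie z s = 0"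
    using y by (simp_all add: z_def lie_simps wq wE)
  show ?thesis
  proof
    let ?b = "z + (lie z z / 2) *\<^sub>R q"
    have qz: "lie q z = -1" using z(1) by (simp add: lie_commute)
    show "lie ?b q = -1" by (simp add: lie_simps z q)
    show "lie ?b ?b = 0" by (simp add: lie_simps z q qz)
    show "lie x ?b = 0" if "x \<in> E" for x
      using z(2)[OF that] E(2)[OF that] by (simp add: lie_simps lie_commute[of x z])
  qed
qed

definition three_frame :: "real^6 \<Rightarrow> real^6 \<Rightarrow> real^6 \<Rightarrow> 3 \<Rightarrow> real^6" where
  "three_frame x y z i = (if i = 1 then x else if i = 2 then y else z)"

lemma three_frame_simps [simp]:
  "three_frame x y z 1 = x" "three_frame x y z 2 = y" "three_frame x y z 3 = z"
  by (simp_all add: three_frame_def)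

lemma euclidean_frame_three_frame:
  assumes q: "lie q q = 0" "lie b q = -1" "lie b b = 0" "lie p q = 0" "lie p b = 0"
    and F: "lie_orthonormal {x, y, z}" "x \<noteq> y" "x \<noteq> z" "y \<noteq> z"
    "\<And>w. w \<in> {x, y, z} \<Longrightarrow> lie w w = 1 \<and> lie w q = 0 \<and> lie w b = 0 \<and> lie w p = 0"
  shows "euclidean_frame p q b (three_frame x y z)"
proof -
  have "b \<noteq> 0" using q(2) by (auto simp: lie_simps)
  then have "b \<in> space_form p q"
    using q by (simp add: space_form_def lie_commute)
  moreover have "lie x y = 0" "lie x z = 0" "lie y x = 0" "lie y z = 0" "lie z x = 0" "lie z y = 0"
    using F by (auto simp: lie_orthonormal_def)
  ultimately show ?thesis
    unfolding euclidean_frame_def forall_3 using F(5) by simp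
qed

lemma euclidean_frame_expand:
  assumes "euclidean_subgeometry p q" "euclidean_frame p q b e"
  shows "x = - lie x q *\<^sub>R b - lie x b *\<^sub>R q + (\<Sum>i\<in>UNIV. lie x (e i) *\<^sub>R e i) - lie x p *\<^sub>R p"
proof -
  have q: "lie q q = 0" "lie q b = -1" "lie b q = -1" "lie b b = 0" "lie p q = 0" "lie q p = 0"
    "lie p b = 0" "lie b p = 0" "lie p p = -1"
    "\<And>i. lie (e i) q = 0" "\<And>i. lie q (e i) = 0" "\<And>i. lie (e i) b = 0" "\<And>i. lie b (e i) = 0"
    "\<And>i. lie (e i) p = 0" "\<And>i. lie p (e i) = 0"
    "\<And>i j. lie (e i) (e j) = (if i = j then 1 else 0)"
    using assms unfolding euclidean_subgeometry_def euclidean_frame_def space_form_def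
    by (auto simp: lie_commute)
  define f g where "f = (1/2) *\<^sub>R q - b" and "g = (1/2) *\<^sub>R q + b"
  have fg: "lie f f = 1" "lie g g = -1" "lie f g = 0" "lie g f = 0" "lie f p = 0" "lie p f = 0"
    "lie g p = 0" "lie p g = 0" "lie (e i) f = 0" "lie f (e i) = 0" "lie (e i) g = 0" "lie g (e i) = 0" for i
    by (simp_all add: f_def g_def lie_simps q)
  have inj: "inj e" by (rule injI) (metis q(16) zero_neq_one)
  have ne: "f \<noteq> g" "f \<noteq> p" "g \<noteq> p" "f \<notin> range e" "g \<notin> range e" "p \<notin> range e"
    using fg q by (auto, (metis fg q zero_neq_one zero_neq_neg_one)+)
  let ?T = "{f, g, p} \<union> range e"
  have on: "lie_orthonormal ?T"
    using fg q by (auto simp: lie_orthonormal_def)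
  have "card ?T = 6"
    using ne card_image[OF inj] by (subst card_Un_disjoint) auto
  from lie_orthonormal_expand[OF on this, of x]
  have "x = (\<Sum>s\<in>{f, g, p}. (lie s s * lie x s) *\<^sub>R s) + (\<Sum>s\<in>range e. (lie s s * lie x s) *\<^sub>R s)"
    using ne by (subst (asm) sum.union_disjoint) auto
  also have "(\<Sum>s\<in>range e. (lie s s * lie x s) *\<^sub>R s) = (\<Sum>i\<in>UNIV. lie x (e i) *\<^sub>R e i)"
    by (subst sum.reindex[OF inj]) (simp add: q)
  also have "(\<Sum>s\<in>{f, g, p}. (lie s s * lie x s) *\<^sub>R s)
      = lie x f *\<^sub>R f - lie x g *\<^sub>R g - lie x p *\<^sub>R p"
    using ne fg q by simp
  also have "lie x f *\<^sub>R f - lie x g *\<^sub>R g = - lie x q *\<^sub>R b - lie x b *\<^sub>R q"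
  proof -
    have *: "lie x f = lie x q / 2 - lie x b" "lie x g = lie x q / 2 + lie x b"
      by (simp_all add: f_def g_def lie_simps)
    show ?thesis unfolding * unfolding f_def g_def
      by (simp add: vec_eq_iff algebra_simps)
  qed
  finally show ?thesis by (simp add: algebra_simps)
qed

lemma euclidean_frame_norm:
  assumes "euclidean_subgeometry p q" "euclidean_frame p q b e"
  shows "lie x x = - 2 * lie x q * lie x b + (\<Sum>i\<in>UNIV. (lie x (e i))\<^sup>2) - (lie x p)\<^sup>2"
proof -
  have "lie x x = lie x (- lie x q *\<^sub>R b - lie x b *\<^sub>R q + (\<Sum>i\<in>UNIV. lie x (e i) *\<^sub>R e i) - lie x p *\<^sub>R p)"
    using euclidean_frame_expand[OF assms, of x] by simp
  then show ?thesis by (simp add: lie_simps lie.sum_right power2_eq_square)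
qed

text \<open>Cartesian coordinates are inner products with the frame vectors, so it is enough to
  find the enveloped point spheres inside the model.\<close>

lemma euclidean_point_coordinates:
  assumes "euclidean_subgeometry p q" "euclidean_frame p q b e" "f \<in> space_form p q"
  shows "f = euclidean_point q b e (\<chi> i. lie f (e i))"
proof -
  let ?x = "\<chi> i. lie f (e i)"
  have f: "lie f f = 0" "lie f p = 0" "lie f q = -1" using assms(3) by (auto simp: space_form_def)
  have "(norm ?x)\<^sup>2 = (\<Sum>i\<in>UNIV. (lie f (e i))\<^sup>2)"
    by (simp add: norm_vec_def L2_set_def sum_nonneg)
  then have *: "(norm ?x)\<^sup>2 / 2 = - lie f b"
    using euclidean_frame_norm[OF assms(1,2), of f] f by simp
  have "f = b + (\<Sum>i\<in>UNIV. lie f (e i) *\<^sub>R e i) + (- lie f b) *\<^sub>R q"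
    using euclidean_frame_expand[OF assms(1,2), of f] f by (simp add: algebra_simps)
  then show ?thesis
    unfolding euclidean_point_def * by simp
qed

section \<open>Curves on circles and curves of null directions\<close>

text \<open>Applied to inner products that vanish identically, this is how orthogonality relations are
  differentiated throughout.\<close>

lemma has_vector_derivative_const_on_open:
  assumes F: "(F has_vector_derivative D) (at u)" and "open I" "u \<in> I" "\<And>x. x \<in> I \<Longrightarrow> F x = C"
  shows "D = 0"
proof -
  have "((\<lambda>_. C) has_vector_derivative D) (at u)"
    using F assms(2,3) by (rule has_vector_derivative_transform_within_open) (simp add: assms(4))
  then show ?thesis
    using vector_derivative_unique_at has_vector_derivative_const by blast
qed

lemma constant_on_if_zero_derivative:
  fixes F :: "real \<Rightarrow> 'b::real_normed_vector"
  assumes "connected I" "\<And>x. x \<in> I \<Longrightarrow> (F has_vector_derivative 0) (at x)" "x \<in> I" "y \<in> I"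
  shows "F x = F y"
proof -
  have "convex I" using assms(1) by (simp add: is_interval_convex_1[symmetric] is_interval_connected_1)
  then obtain c where "\<And>x. x \<in> I \<Longrightarrow> F x = c"
    using has_vector_derivative_zero_constant[of I F]
      has_vector_derivative_at_within[OF assms(2)] by blast
  then show ?thesis using assms(3,4) by simp
qed

lemma antiderivative_on_open_interval:
  fixes f :: "real \<Rightarrow> real"
  assumes "open I" "connected I" "continuous_on I f"
  obtains F where "\<And>x. x \<in> I \<Longrightarrow> (F has_vector_derivative f x) (at x)"
proof (cases "I = {}")
  case False
  define a b where "a = (INF x\<in>I. ereal x)" and "b = (SUP x\<in>I. ereal x)"
  have iff: "x \<in> I \<longleftrightarrow> a < ereal x \<and> ereal x < b" for x
  proof
    assume x: "x \<in> I"
    then obtain e where e: "e > 0" "ball x e \<subseteq> I" using assms(1) by (meson open_contains_ball)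
    then have "x - e/2 \<in> I" "x + e/2 \<in> I" by (auto simp: dist_real_def subset_iff)
    then have "a \<le> ereal (x - e/2)" "ereal (x + e/2) \<le> b"
      by (auto simp: a_def b_def intro: INF_lower SUP_upper)
    moreover have "ereal (x - e/2) < ereal x" "ereal x < ereal (x + e/2)" using e(1) by simp_all
    ultimately show "a < ereal x \<and> ereal x < b"
      using le_less_trans less_le_trans by blast
  next
    assume "a < ereal x \<and> ereal x < b"
    then obtain y z where "y \<in> I" "z \<in> I" "y < x" "x < z"
      by (auto simp: a_def b_def INF_less_iff less_SUP_iff)
    then show "x \<in> I" using assms(2) by (meson connected_contains_Icc atLeastAtMost_iff in_mono less_imp_le)
  qed
  obtain x where "x \<in> I" using False by auto
  then have "a < b" using iff order.strict_trans by blast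
  moreover have "isCont f x" if "a < ereal x" "ereal x < b" for x
    using assms(1,3) that iff by (simp add: continuous_on_eq_continuous_at)
  ultimately obtain F where "\<forall>x. a < ereal x \<longrightarrow> ereal x < b \<longrightarrow> (F has_vector_derivative f x) (at x)"
    using einterval_antiderivative[of a b f] by auto
  then show ?thesis using that iff by blast
qed (use that in auto)

text \<open>The antiderivative of the angular velocity is an angle, since rotating the curve back by it
  makes the curve stationary.\<close>

lemma angle_function:
  fixes x y x' y' :: "real \<Rightarrow> real"
  assumes I: "open I" "connected I" and \<rho>: "\<rho> > 0"
    and x: "\<And>u. u \<in> I \<Longrightarrow> (x has_real_derivative x' u) (at u)" "continuous_on I x'"
    and y: "\<And>u. u \<in> I \<Longrightarrow> (y has_real_derivative y' u) (at u)" "continuous_on I y'"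
    and circle: "\<And>u. u \<in> I \<Longrightarrow> (x u)\<^sup>2 + (y u)\<^sup>2 = \<rho>\<^sup>2"
    and reg: "\<And>u. u \<in> I \<Longrightarrow> x' u \<noteq> 0 \<or> y' u \<noteq> 0"
  obtains \<theta> where "\<And>u. u \<in> I \<Longrightarrow> regular_at \<theta> u"
    "\<And>u. u \<in> I \<Longrightarrow> x u = \<rho> * cos (\<theta> u)" "\<And>u. u \<in> I \<Longrightarrow> y u = \<rho> * sin (\<theta> u)"
proof (cases "I = {}")
  case False
  then obtain u0 where u0: "u0 \<in> I" by auto
  \<comment> \<open>the angular velocity of the curve\<close>
  define \<omega> where "\<omega> u = (x u * y' u - y u * x' u) / \<rho>\<^sup>2" for u
  have cont: "continuous_on I x" "continuous_on I y"
    using x(1) y(1) by (meson DERIV_isCont continuous_at_imp_continuous_on)+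
  have "continuous_on I \<omega>"
    unfolding \<omega>_def using \<rho> cont x(2) y(2) by (intro continuous_intros) auto
  then obtain F where F: "\<And>u. u \<in> I \<Longrightarrow> (F has_vector_derivative \<omega> u) (at u)"
    using antiderivative_on_open_interval[OF I] by blast
  have tangent: "x' u = - \<omega> u * y u" "y' u = \<omega> u * x u" if u: "u \<in> I" for u
  proof -
    have "((\<lambda>u. (x u)\<^sup>2 + (y u)\<^sup>2) has_real_derivative 2 * x u * x' u + 2 * y u * y' u) (at u)"
      by (rule derivative_eq_intros x(1)[OF u] y(1)[OF u] refl | simp)+
    then have "2 * x u * x' u + 2 * y u * y' u = 0"
      unfolding has_real_derivative_iff_has_vector_derivative
      by (rule has_vector_derivative_const_on_open[OF _ I(1) u]) (rule circle)
    then have t: "x u * x' u = - (y u * y' u)" by simp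
    have w: "\<rho>\<^sup>2 * \<omega> u = x u * y' u - y u * x' u" using \<rho> by (simp add: \<omega>_def)
    have "\<rho>\<^sup>2 * (- \<omega> u * y u) = - (\<rho>\<^sup>2 * \<omega> u) * y u" by simp
    also have "\<dots> = y u * y u * x' u - x u * (y u * y' u)"
      unfolding w by (simp add: algebra_simps)
    also have "x u * (y u * y' u) = - (x u * (x u * x' u))" using t by simp
    also have "y u * y u * x' u - - (x u * (x u * x' u)) = ((x u)\<^sup>2 + (y u)\<^sup>2) * x' u"
      by (simp add: algebra_simps power2_eq_square)
    finally have "\<rho>\<^sup>2 * (- \<omega> u * y u) = \<rho>\<^sup>2 * x' u" unfolding circle[OF u] .
    then show "x' u = - \<omega> u * y u" by (subst (asm) mult_left_cancel) (use \<rho> in auto)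
    have "\<rho>\<^sup>2 * (\<omega> u * x u) = (\<rho>\<^sup>2 * \<omega> u) * x u" by simp
    also have "\<dots> = x u * x u * y' u - y u * (x u * x' u)"
      unfolding w by (simp add: algebra_simps)
    also have "y u * (x u * x' u) = - (y u * (y u * y' u))" using t by simp
    also have "x u * x u * y' u - - (y u * (y u * y' u)) = ((x u)\<^sup>2 + (y u)\<^sup>2) * y' u"
      by (simp add: algebra_simps power2_eq_square)
    finally show "y' u = \<omega> u * x u" using \<rho> circle[OF u] by simp
  qed
  have "(x u0 / \<rho>)\<^sup>2 + (y u0 / \<rho>)\<^sup>2 = 1"
    using circle[OF u0] \<rho> by (simp add: power_divide flip: add_divide_distrib)
  then obtain \<alpha> where \<alpha>: "x u0 / \<rho> = cos \<alpha>" "y u0 / \<rho> = sin \<alpha>"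
    using sincos_total_2pi by metis
  define \<theta> where "\<theta> u = \<alpha> + F u - F u0" for u
  have d\<theta>: "(\<theta> has_real_derivative \<omega> u) (at u)" if "u \<in> I" for u
    unfolding \<theta>_def using F[OF that, folded has_real_derivative_iff_has_vector_derivative]
    by (auto intro!: derivative_eq_intros)
  define c s where "c u = x u * cos (\<theta> u) + y u * sin (\<theta> u)"
    and "s u = y u * cos (\<theta> u) - x u * sin (\<theta> u)" for u
  have "(c has_vector_derivative 0) (at u)" "(s has_vector_derivative 0) (at u)" if u: "u \<in> I" for u
    unfolding has_real_derivative_iff_has_vector_derivative[symmetric] c_def s_def
    by (rule derivative_eq_intros x(1)[OF u] y(1)[OF u] d\<theta>[OF u] refl
        | simp add: tangent[OF u] algebra_simps)+
  then have const: "c u = c u0" "s u = s u0" if "u \<in> I" for u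
    using constant_on_if_zero_derivative[OF I(2) _ that u0] by blast+
  have x0: "x u0 = \<rho> * cos \<alpha>" "y u0 = \<rho> * sin \<alpha>" using \<alpha> \<rho> by (auto simp: field_simps)
  have cos_sin: "cos t * (cos t * z) + sin t * (sin t * z) = z" for t z :: real
    by (metis (no_types) sin_cos_squared_add2 power2_eq_square mult.assoc distrib_right mult_1)
  have "c u0 = \<rho>" "s u0 = 0"
    using cos_sin[of \<alpha> \<rho>] by (simp_all add: c_def s_def \<theta>_def x0 mult_ac)
  then have cs: "c u = \<rho>" "s u = 0" if "u \<in> I" for u using const[OF that] by simp_all
  have xy: "x u = \<rho> * cos (\<theta> u)" "y u = \<rho> * sin (\<theta> u)" if "u \<in> I" for u
  proof -
    have "x u = c u * cos (\<theta> u) - s u * sin (\<theta> u)" "y u = c u * sin (\<theta> u) + s u * cos (\<theta> u)"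
      using cos_sin[of "\<theta> u" "x u"] cos_sin[of "\<theta> u" "y u"]
      by (simp_all add: c_def s_def algebra_simps)
    then show "x u = \<rho> * cos (\<theta> u)" "y u = \<rho> * sin (\<theta> u)" using cs[OF that] by simp_all
  qed
  have "regular_at \<theta> u" if "u \<in> I" for u
    using d\<theta>[OF that] tangent[OF that] reg[OF that] by (auto simp: regular_at_def)
  then show ?thesis using that xy by blast
qed (use that in auto)

text \<open>Up to scale, the null vectors of a space of signature \<open>(2,2)\<close> with a nonzero component along
  the null vector \<open>m\<close> are \<open>q = m + x n + y n' - x y m'\<close>, where \<open>m, m'\<close> and \<open>n, n'\<close> are pairs of
  complementary null vectors. The directions on the curve \<open>\<sigma>\<close> correspond to a differentiable image of
  a subset of the line in the \<open>(x, y)\<close>-plane, which is negligible.\<close>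

lemma null_direction_off_curve:
  assumes S: "lie_orthonormal {p1, p2, n1, n2}"
    and sgn: "lie p1 p1 = 1" "lie p2 p2 = 1" "lie n1 n1 = -1" "lie n2 n2 = -1" "p1 \<noteq> p2" "n1 \<noteq> n2"
    and \<sigma>: "\<And>v. v \<in> J \<Longrightarrow> (\<sigma> has_vector_derivative \<sigma>' v) (at v)" "\<And>v. v \<in> J \<Longrightarrow> \<sigma> v \<noteq> 0"
  obtains q where "q \<noteq> 0" "lie q q = 0" "q \<in> span {p1, p2, n1, n2}"
    "\<And>v c. v \<in> J \<Longrightarrow> \<sigma> v \<noteq> c *\<^sub>R q"
proof -
  have "p1 \<noteq> n1" "p1 \<noteq> n2" "p2 \<noteq> n1" "p2 \<noteq> n2" using sgn by auto
  then have o: "lie p1 p2 = 0" "lie p1 n1 = 0" "lie p1 n2 = 0" "lie p2 p1 = 0" "lie p2 n1 = 0"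
    "lie p2 n2 = 0" "lie n1 p1 = 0" "lie n1 p2 = 0" "lie n1 n2 = 0" "lie n2 p1 = 0" "lie n2 p2 = 0"
    "lie n2 n1 = 0"
    using S sgn(5,6) by (auto simp: lie_orthonormal_def)
  \<comment> \<open>two hyperbolic pairs spanning the space, with products \<open>2\<close>\<close>
  define m m' n n' where "m = p1 + n1" and "m' = p1 - n1" and "n = p2 + n2" and "n' = p2 - n2"
  have g: "lie m m = 0" "lie m' m' = 0" "lie n n = 0" "lie n' n' = 0" "lie m m' = 2" "lie m' m = 2"
    "lie n n' = 2" "lie n' n = 2" "lie m n = 0" "lie n m = 0" "lie m n' = 0" "lie n' m = 0"
    "lie m' n = 0" "lie n m' = 0" "lie m' n' = 0" "lie n' m' = 0"
    by (simp_all add: m_def m'_def n_def n'_def lie_simps o sgn)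
  define J' where "J' = {v \<in> J. lie (\<sigma> v) m' \<noteq> 0}"
  define F where "F v = (lie (\<sigma> v) n' / lie (\<sigma> v) m', lie (\<sigma> v) n / lie (\<sigma> v) m')" for v
  have dl: "((\<lambda>v. lie (\<sigma> v) w) has_real_derivative lie (\<sigma>' v) w) (at v)" if "v \<in> J" for v w
    unfolding has_real_derivative_iff_has_vector_derivative
    using bounded_linear.has_vector_derivative[OF lie.bounded_linear_left \<sigma>(1)[OF that]] .
  have "F differentiable_on J'"
  proof (rule differentiable_at_imp_differentiable_on)
    fix v assume v: "v \<in> J'"
    have "(\<lambda>v. lie (\<sigma> v) w) differentiable (at v)" for w
      using dl[of v] v by (auto simp: J'_def real_differentiable_def)
    moreover have "lie (\<sigma> v) m' \<noteq> 0" using v by (simp add: J'_def)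
    ultimately have "(\<lambda>v. lie (\<sigma> v) w / lie (\<sigma> v) m') differentiable (at v)" for w
      by (intro differentiable_divide) auto
    then show "F differentiable (at v)" unfolding F_def
      by (metis (no_types) differentiable_def has_derivative_Pair)
  qed
  then have "negligible (F ` J')"
    by (rule negligible_differentiable_image_lowdim[rotated]) simp
  then have "F ` J' \<noteq> UNIV" using non_negligible_UNIV by metis
  then obtain x y where xy: "(x, y) \<notin> F ` J'" by auto
  define q where "q = m + x *\<^sub>R n + y *\<^sub>R n' - (x * y) *\<^sub>R m'"
  have qm: "lie q m' = 2" "lie q n' = 2 * x" "lie q n = 2 * y" "lie q q = 0"
    by (simp_all add: q_def lie_simps g)
  show ?thesis
  proof
    show "q \<noteq> 0" using qm(1) by (auto simp: lie_simps)
    show "lie q q = 0" by (rule qm)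
    show "q \<in> span {p1, p2, n1, n2}"
      unfolding q_def m_def n_def m'_def n'_def
      by (intro span_add span_diff span_scale span_base) auto
    fix v c assume v: "v \<in> J"
    show "\<sigma> v \<noteq> c *\<^sub>R q"
    proof
      assume eq: "\<sigma> v = c *\<^sub>R q"
      then have c: "c \<noteq> 0" using \<sigma>(2)[OF v] by auto
      have "v \<in> J'" using v c by (simp add: J'_def eq lie_simps qm)
      moreover have "F v = (x, y)" using c by (simp add: F_def eq lie_simps qm)
      ultimately show False using xy by (metis image_eqI)
    qed
  qed
qed

section \<open>Nets of translation in the Lie quadric\<close>

text \<open>The conclusions of the classification for a net of sphere congruences over a coordinate
  domain, before it is composed with a chart.\<close>

definition net_dupin :: "(real \<times> real) set \<Rightarrow> (real \<times> real \<Rightarrow> real^6) \<Rightarrow> (real \<times> real \<Rightarrow> real^6) \<Rightarrow> bool" where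
  "net_dupin U S1 S2 \<longleftrightarrow> (\<exists>V1 V2. signature_2_1 V1 \<and> signature_2_1 V2 \<and>
     (\<forall>x\<in>V1. \<forall>y\<in>V2. lie x y = 0) \<and> (\<forall>z. \<exists>x\<in>V1. \<exists>y\<in>V2. z = x + y) \<and>
     (\<forall>z\<in>U. S1 z \<in> V1 \<and> S2 z \<in> V2))"

definition net_represents :: "((real \<times> real) set \<Rightarrow> (real \<times> real \<Rightarrow> real^3) \<Rightarrow> bool) \<Rightarrow> (real \<times> real) set
    \<Rightarrow> (real \<times> real \<Rightarrow> real^6) \<Rightarrow> (real \<times> real \<Rightarrow> real^6) \<Rightarrow> bool" where
  "net_represents P U S1 S2 \<longleftrightarrow> (\<exists>p q b E f. euclidean_subgeometry p q \<and> euclidean_frame p q b E \<and>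
     (\<forall>z\<in>U. f z \<in> span {S1 z, S2 z} \<and> f z \<in> space_form p q) \<and> P U (\<lambda>z. \<chi> i. lie (f z) (E i)))"

text \<open>Here \<open>x\<close>, \<open>y\<close>, \<open>z\<close> stand for \<open>\<sigma>\<close>, \<open>\<sigma>'\<close>, \<open>\<sigma>''\<close> along a null curve with spacelike velocity. A
  combination \<open>b\<close> of them is null and orthogonal to \<open>y\<close> with \<open>(b, x) = -1\<close>, so they span a space \<open>V1\<close>
  of signature \<open>(2,1)\<close>, and its complement \<open>V2\<close> has the same signature.\<close>

lemma lightlike_osculating_splitting:
  assumes x: "lie x x = 0" "lie x y = 0" "lie y y > 0" "lie x z = - lie y y"
  obtains V1 V2 where "signature_2_1 V1" "signature_2_1 V2" "\<forall>x\<in>V1. \<forall>y\<in>V2. lie x y = 0"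
    "\<forall>z. \<exists>x\<in>V1. \<exists>y\<in>V2. z = x + y" "dim V2 \<le> 3"
    "\<And>w. lie w x = 0 \<Longrightarrow> lie w y = 0 \<Longrightarrow> lie w z = 0 \<Longrightarrow> w \<in> V2"
    "\<And>w. (\<forall>y\<in>V2. lie w y = 0) \<Longrightarrow> w \<in> V1"
proof -
  define k where "k = lie y y"
  have k: "k > 0" "lie y y = k" "lie x z = -k" "lie z x = -k" "lie y x = 0"
    using x by (simp_all add: k_def lie_commute)
  \<comment> \<open>remove the component along \<open>y\<close> from \<open>z\<close>, then make it null by adding a multiple of \<open>x\<close>\<close>
  define z' where "z' = (1 / k) *\<^sub>R z - (lie z y / k\<^sup>2) *\<^sub>R y"
  have z': "lie z' x = -1" "lie x z' = -1" "lie z' y = 0"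
    using k x by (simp_all add: z'_def lie_simps power2_eq_square)
  define b where "b = z' + (lie z' z' / 2) *\<^sub>R x"
  have b: "lie b x = -1" "lie b b = 0" "lie b y = 0"
    by (simp_all add: b_def lie_simps z' x)
  define e where "e = (1 / sqrt k) *\<^sub>R y"
  have "sqrt k * sqrt k = k" using k by simp
  then have e: "lie e e = 1" "lie e x = 0" "lie e b = 0"
    using k b(3) by (simp_all add: e_def lie_simps field_simps lie_commute[of y b])
  obtain p F where p: "lie p p = -1" "lie p x = 0" "lie p b = 0" and
    F: "{e} \<subseteq> F" "card F = 3" "lie_orthonormal F"
    "\<And>w. w \<in> F \<Longrightarrow> lie w w = 1 \<and> lie w x = 0 \<and> lie w b = 0 \<and> lie w p = 0"
    by (rule hyperbolic_pair_extend[OF x(1) b(1,2), of "{e}"]) (use e in \<open>auto simp: lie_orthonormal_def\<close>)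
  have "card (F - {e}) = 2" using F by simp
  then obtain e2 e3 where e23: "F - {e} = {e2, e3}" "e2 \<noteq> e3" by (auto simp: card_2_iff)
  then have F_eq: "F = {e, e2, e3}" "e \<noteq> e2" "e \<noteq> e3" using F(1) by auto
  have frame: "euclidean_frame p x b (three_frame e e2 e3)"
    by (rule euclidean_frame_three_frame) (use x b p F F_eq e23 in auto)
  have "x \<noteq> 0" using k by (auto simp: lie_simps)
  then have sub: "euclidean_subgeometry p x" using x p by (simp add: euclidean_subgeometry_def)
  note expand = euclidean_frame_expand[OF sub frame, unfolded sum_3 three_frame_simps]
  have o1: "lie e e2 = 0" "lie e e3 = 0" "lie e2 e3 = 0" "lie e2 e = 0" "lie e3 e = 0" "lie e3 e2 = 0"
    "lie e2 e2 = 1" "lie e3 e3 = 1" "lie e2 x = 0" "lie e3 x = 0" "lie e2 b = 0" "lie e3 b = 0"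
    "lie e p = 0" "lie e2 p = 0" "lie e3 p = 0"
    using F(3,4) F_eq e23 by (auto simp: lie_orthonormal_def)
  have o2: "lie x e2 = 0" "lie x e3 = 0" "lie b e2 = 0" "lie b e3 = 0" "lie x p = 0" "lie b p = 0"
    "lie x b = -1"
    using o1 p b by (simp_all add: lie_commute[of x e2] lie_commute[of x e3]
        lie_commute[of x p] lie_commute[of x b] lie_commute[of b e2] lie_commute[of b e3]
        lie_commute[of b p])
  note o = o1 o2
  \<comment> \<open>the orthonormal basis of the hyperbolic plane spanned by \<open>x\<close> and \<open>b\<close>\<close>
  define f g where "f = (1/2) *\<^sub>R x - b" and "g = (1/2) *\<^sub>R x + b"
  define V1 V2 where "V1 = span {e, f, g}" and "V2 = span {e2, e3, p}"
  have "x = f + g" "b = (1/2) *\<^sub>R (g - f)"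
    by (simp_all add: f_def g_def vec_eq_iff)
  then have xbV1: "x \<in> V1" "b \<in> V1" "e \<in> V1"
    unfolding V1_def by (metis span_add span_diff span_scale span_base insertCI)+
  have V12: "lie v w = 0" if "v \<in> V1" "w \<in> V2" for v w
  proof -
    have "lie s t = 0" if "s \<in> {e, f, g}" "t \<in> {e2, e3, p}" for s t
      using that o p e by (auto simp: f_def g_def lie_simps)
    then have "lie v t = 0" if "t \<in> {e2, e3, p}" for t
      using orthogonal_span[of "{e, f, g}" t v] that \<open>v \<in> V1\<close> by (auto simp: V1_def)
    then show ?thesis
      using orthogonal_span[of "{e2, e3, p}" v w] \<open>w \<in> V2\<close> by (auto simp: V2_def lie_commute)
  qed
  define P1 P2 where "P1 w = - lie w x *\<^sub>R b - lie w b *\<^sub>R x + lie w e *\<^sub>R e"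
    and "P2 w = lie w e2 *\<^sub>R e2 + lie w e3 *\<^sub>R e3 - lie w p *\<^sub>R p" for w
  have split: "w = P1 w + P2 w" for w
    using expand[of w] by (simp add: P1_def P2_def algebra_simps)
  have P1V: "P1 w \<in> V1" for w
    using xbV1 unfolding P1_def V1_def by (intro span_add span_diff span_scale) auto
  have P2V: "P2 w \<in> V2" for w
    unfolding P2_def V2_def by (intro span_add span_diff span_scale span_base) auto
  show ?thesis
  proof
    have "lie f f = 1" "lie g g = -1" "lie f g = 0" "lie e f = 0" "lie e g = 0"
      by (simp_all add: f_def g_def lie_simps x b o e)
    then show "signature_2_1 V1" unfolding signature_2_1_def V1_def
      using e(1) by blast
    show "signature_2_1 V2" unfolding signature_2_1_def V2_def
      using o p(1) by blast
    show "\<forall>x\<in>V1. \<forall>y\<in>V2. lie x y = 0" using V12 by blast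
    show "\<forall>z. \<exists>x\<in>V1. \<exists>y\<in>V2. z = x + y" using split P1V P2V by blast
    have "dim V2 \<le> card {e2, e3, p}" unfolding V2_def by (simp add: dim_le_card')
    also have "\<dots> \<le> 3" by (simp add: card_insert_if)
    finally show "dim V2 \<le> 3" .
  next
    fix w assume w: "lie w x = 0" "lie w y = 0" "lie w z = 0"
    then have "lie w e = 0" "lie w b = 0" by (simp_all add: e_def b_def z'_def lie_simps)
    then show "w \<in> V2" using split[of w] P2V[of w] w by (simp add: P1_def)
  next
    fix w assume "\<forall>y\<in>V2. lie w y = 0"
    then have "P2 w = 0" by (simp add: P2_def V2_def span_base)
    then show "w \<in> V1" using split[of w] P1V[of w] by simp
  qed
qed

text \<open>The two curvature spheres are \<open>\<langle>\<sigma>(v)\<rangle>\<close> and \<open>\<langle>a(v) + \<Phi>(u)\<rangle>\<close>, and \<open>\<sigma>1\<close>, \<open>\<sigma>2\<close> are the first two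
  derivatives of \<open>\<sigma>\<close>. The normalisation \<open>\<Phi>(u0) = 0\<close> makes \<open>a\<close> and \<open>\<Phi>\<close> separately orthogonal to \<open>\<sigma>\<close>.\<close>

locale translation_net =
  fixes I J :: "real set" and \<sigma> \<sigma>1 \<sigma>2 a \<Phi> \<Phi>1 :: "real \<Rightarrow> real^6"
  assumes I: "open I" "connected I" "I \<noteq> {}"
    and J: "J \<noteq> {}"
    and d\<sigma>: "v \<in> J \<Longrightarrow> (\<sigma> has_vector_derivative \<sigma>1 v) (at v)"
    and \<sigma>: "v \<in> J \<Longrightarrow> lie (\<sigma> v) (\<sigma> v) = 0" "v \<in> J \<Longrightarrow> lie (\<sigma> v) (\<sigma>1 v) = 0"
      "v \<in> J \<Longrightarrow> lie (\<sigma>1 v) (\<sigma>1 v) > 0" "v \<in> J \<Longrightarrow> lie (\<sigma> v) (\<sigma>2 v) = - lie (\<sigma>1 v) (\<sigma>1 v)"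
    and d\<Phi>: "u \<in> I \<Longrightarrow> (\<Phi> has_vector_derivative \<Phi>1 u) (at u)" "continuous_on I \<Phi>1"
    and \<Phi>1: "u \<in> I \<Longrightarrow> lie (\<Phi>1 u) (\<Phi>1 u) > 0"
    and \<Phi>0: "\<exists>u0\<in>I. \<Phi> u0 = 0"
    and null: "u \<in> I \<Longrightarrow> v \<in> J \<Longrightarrow> lie (a v + \<Phi> u) (a v + \<Phi> u) = 0"
    and perp: "u \<in> I \<Longrightarrow> v \<in> J \<Longrightarrow> lie (a v + \<Phi> u) (\<sigma> v) = 0"
      "u \<in> I \<Longrightarrow> v \<in> J \<Longrightarrow> lie (a v + \<Phi> u) (\<sigma>1 v) = 0"
      "u \<in> I \<Longrightarrow> v \<in> J \<Longrightarrow> lie (a v + \<Phi> u) (\<sigma>2 v) = 0"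
begin

abbreviation R :: "real \<Rightarrow> real \<Rightarrow> real^6" where
  "R u v \<equiv> a v + \<Phi> u"

lemma \<sigma>_nonzero: "v \<in> J \<Longrightarrow> \<sigma> v \<noteq> 0"
  using \<sigma>(3,4) by (metis lie.zero_left neg_equal_0_iff_equal order_less_irrefl)

lemma a_perp:
  assumes "v \<in> J"
  shows "lie (a v) (\<sigma> v) = 0" "lie (a v) (\<sigma>1 v) = 0" "lie (a v) (\<sigma>2 v) = 0" "lie (a v) (a v) = 0"
proof -
  obtain u0 where "u0 \<in> I" "\<Phi> u0 = 0" using \<Phi>0 by blast
  then show "lie (a v) (\<sigma> v) = 0" "lie (a v) (\<sigma>1 v) = 0" "lie (a v) (\<sigma>2 v) = 0" "lie (a v) (a v) = 0"
    using perp[of u0 v] null[of u0 v] assms by simp_all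
qed

lemma \<Phi>_perp:
  assumes "u \<in> I" "v \<in> J"
  shows "lie (\<Phi> u) (\<sigma> v) = 0" "lie (\<Phi> u) (\<sigma>1 v) = 0" "lie (\<Phi> u) (\<sigma>2 v) = 0"
  using perp[OF assms] a_perp[OF assms(2)] by (simp_all add: lie.add_left)

lemma \<Phi>_norm:
  assumes "u \<in> I" "v \<in> J"
  shows "2 * lie (a v) (\<Phi> u) + lie (\<Phi> u) (\<Phi> u) = 0"
  using null[OF assms] a_perp(4)[OF assms(2)]
  by (simp add: lie.add_left lie.add_right lie_commute[of "\<Phi> u" "a v"])

definition W :: "(real^6) set" where "W = span (\<Phi> ` I)"

lemma W_perp_\<sigma>:
  assumes "v \<in> J" "w \<in> W"
  shows "lie w (\<sigma> v) = 0"
  by (rule orthogonal_span[of "\<Phi> ` I"]) (use assms \<Phi>_perp(1) in \<open>auto simp: W_def\<close>)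

text \<open>Since \<open>a + \<Phi>\<close> and \<open>a\<close> are null, \<open>2 (a(v), \<Phi>(u)) = - (\<Phi>(u), \<Phi>(u))\<close>, where the right-hand side does
  not involve \<open>v\<close>.\<close>

lemma lie_a_W_constant:
  assumes "v \<in> J" "v' \<in> J" "w \<in> W"
  shows "lie (a v) w = lie (a v') w"
proof -
  have "lie w (a v - a v') = 0"
  proof (rule orthogonal_span[of "\<Phi> ` I"])
    fix x assume "x \<in> \<Phi> ` I"
    then obtain u where u: "u \<in> I" "x = \<Phi> u" by auto
    show "lie x (a v - a v') = 0"
      using \<Phi>_norm[OF u(1) assms(1)] \<Phi>_norm[OF u(1) assms(2)]
      by (simp add: u(2) lie.diff_right lie_commute[of "\<Phi> u" "a v"] lie_commute[of "\<Phi> u" "a v'"])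
  qed (use assms in \<open>simp add: W_def\<close>)
  then show ?thesis by (simp add: lie.diff_right lie_commute)
qed

lemma \<Phi>1_in_W:
  assumes u: "u \<in> I"
  shows "\<Phi>1 u \<in> W"
proof -
  obtain y z where yz: "y \<in> W" "\<And>w. w \<in> W \<Longrightarrow> orthogonal z w" "\<Phi>1 u = y + z"
    unfolding W_def using orthogonal_subspace_decomp_exists[of "\<Phi> ` I" "\<Phi>1 u"] by blast
  have "((\<lambda>u. z \<bullet> \<Phi> u) has_vector_derivative z \<bullet> \<Phi>1 u) (at u)"
    using bounded_linear.has_vector_derivative[OF bounded_linear_inner_right d\<Phi>(1)[OF u]] .
  then have "z \<bullet> \<Phi>1 u = 0"
    by (rule has_vector_derivative_const_on_open[OF _ I(1) u])
      (use yz(2) in \<open>auto simp: orthogonal_def W_def span_base\<close>)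
  then have "z = 0" using yz by (simp add: inner_add_right orthogonal_def)
  then show ?thesis using yz by simp
qed

lemma has_real_derivative_lie_\<Phi>:
  assumes "u \<in> I"
  shows "((\<lambda>u. lie (\<Phi> u) y) has_real_derivative lie (\<Phi>1 u) y) (at u)"
  unfolding has_real_derivative_iff_has_vector_derivative
  using bounded_linear.has_vector_derivative[OF lie.bounded_linear_left d\<Phi>(1)[OF assms]] .

text \<open>For every \<open>v\<close> the space \<open>W\<close> is contained in the complement of \<open>\<sigma>\<close>, \<open>\<sigma>'\<close>, \<open>\<sigma>''\<close> at \<open>v\<close>, which has
  dimension three. So this complement is \<open>W\<close> and does not depend on \<open>v\<close>.\<close>

lemma dupin_splitting:
  assumes "dim W \<ge> 3"
  obtains V1 V2 where "signature_2_1 V1" "signature_2_1 V2" "\<forall>x\<in>V1. \<forall>y\<in>V2. lie x y = 0"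
    "\<forall>z. \<exists>x\<in>V1. \<exists>y\<in>V2. z = x + y"
    "\<And>v. v \<in> J \<Longrightarrow> \<sigma> v \<in> V1" "\<And>u v. u \<in> I \<Longrightarrow> v \<in> J \<Longrightarrow> R u v \<in> V2"
proof -
  have main: "\<exists>V1. signature_2_1 V1 \<and> signature_2_1 W \<and> (\<forall>x\<in>V1. \<forall>y\<in>W. lie x y = 0) \<and>
      (\<forall>z. \<exists>x\<in>V1. \<exists>y\<in>W. z = x + y) \<and> (\<forall>u\<in>I. R u v \<in> W) \<and>
      (\<forall>w. (\<forall>y\<in>W. lie w y = 0) \<longrightarrow> w \<in> V1)" if v: "v \<in> J" for v
  proof -
    obtain V1 V2 where V: "signature_2_1 V1" "signature_2_1 V2" "\<forall>x\<in>V1. \<forall>y\<in>V2. lie x y = 0"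
      "\<forall>z. \<exists>x\<in>V1. \<exists>y\<in>V2. z = x + y" "dim V2 \<le> 3"
      and in_V2: "\<And>w. lie w (\<sigma> v) = 0 \<Longrightarrow> lie w (\<sigma>1 v) = 0 \<Longrightarrow> lie w (\<sigma>2 v) = 0 \<Longrightarrow> w \<in> V2"
      and in_V1: "\<And>w. (\<forall>y\<in>V2. lie w y = 0) \<Longrightarrow> w \<in> V1"
      using lightlike_osculating_splitting[OF \<sigma>[OF v]] by blast
    have sub: "subspace V2" using V(2) by (auto simp: signature_2_1_def)
    have "\<Phi> ` I \<subseteq> V2" using in_V2 \<Phi>_perp[OF _ v] by blast
    then have "W \<subseteq> V2" unfolding W_def using sub by (rule span_minimal)
    then have "W = V2" using sub V(5) assms
      by (intro subspace_dim_equal) (auto simp: W_def)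
    moreover have "R u v \<in> V2" if "u \<in> I" for u
      using in_V2 perp[OF that v] by blast
    ultimately show ?thesis using V in_V1 by blast
  qed
  obtain v0 where "v0 \<in> J" using J by auto
  from main[OF this] obtain V1 where V1: "signature_2_1 V1" "signature_2_1 W"
    "\<forall>x\<in>V1. \<forall>y\<in>W. lie x y = 0" "\<forall>z. \<exists>x\<in>V1. \<exists>y\<in>W. z = x + y"
    "\<And>w. (\<forall>y\<in>W. lie w y = 0) \<Longrightarrow> w \<in> V1" by blast
  show ?thesis
  proof (rule that[OF V1(1-4)])
    show "\<sigma> v \<in> V1" if "v \<in> J" for v
      using W_perp_\<sigma>[OF that] by (intro V1(5)) (simp add: lie_commute)
    show "R u v \<in> W" if "u \<in> I" "v \<in> J" for u v
      using main[OF that(2)] that(1) by blast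
  qed
qed

text \<open>Differentiating the relation gives \<open>x = - A\<close>, so \<open>x\<close> would be constant.\<close>

lemma quadratic_relation_impossible:
  assumes dx: "\<And>u. u \<in> I \<Longrightarrow> (x has_real_derivative x' u) (at u)" "\<And>u. u \<in> I \<Longrightarrow> x' u \<noteq> 0"
    and eq: "\<And>u. u \<in> I \<Longrightarrow> 2 * A * x u + (x u)\<^sup>2 = 0"
  shows False
proof -
  have "x u = - A" if u: "u \<in> I" for u
  proof -
    have "((\<lambda>u. 2 * A * x u + (x u)\<^sup>2) has_real_derivative 2 * A * x' u + 2 * x u * x' u) (at u)"
      by (rule derivative_eq_intros dx(1)[OF u] refl | simp)+
    then have "2 * A * x' u + 2 * x u * x' u = 0"
      unfolding has_real_derivative_iff_has_vector_derivative
      by (rule has_vector_derivative_const_on_open[OF _ I(1) u]) (rule eq)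
    then have "2 * x' u * (A + x u) = 0" by (simp add: algebra_simps)
    then show ?thesis using dx(2)[OF u] by simp
  qed
  moreover obtain u1 where u1: "u1 \<in> I" using I(3) by auto
  ultimately have "x' u1 = 0"
    using has_vector_derivative_const_on_open[OF dx(1)[OF u1, unfolded
        has_real_derivative_iff_has_vector_derivative] I(1) u1] by blast
  then show False using dx(2)[OF u1] by simp
qed

text \<open>If \<open>W\<close> were a line, then \<open>\<Phi> = x e\<close> with \<open>x\<close> subject to a quadratic relation with constant
  coefficients, which contradicts regularity of \<open>\<Phi>\<close>.\<close>

lemma plane_basis:
  assumes "dim W < 3"
  obtains e w where "lie e e = 1" "lie e w = 0" "w \<noteq> 0" "lie w w = 0 \<or> lie w w = 1 \<or> lie w w = -1"
    "W = span {e, w}"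
proof -
  obtain u1 where u1: "u1 \<in> I" using I(3) by auto
  obtain v0 where v0: "v0 \<in> J" using J by auto
  have subW: "subspace W" by (simp add: W_def)
  define k where "k = lie (\<Phi>1 u1) (\<Phi>1 u1)"
  have k: "k > 0" "sqrt k * sqrt k = k" using \<Phi>1[OF u1] by (auto simp: k_def)
  define e where "e = (1 / sqrt k) *\<^sub>R \<Phi>1 u1"
  have e: "lie e e = 1" using k by (simp add: e_def lie_simps field_simps flip: k_def)
  have eW: "e \<in> W" unfolding e_def using \<Phi>1_in_W[OF u1] subW by (simp add: subspace_scale)
  have "\<not> W \<subseteq> span {e}"
  proof
    assume sub: "W \<subseteq> span {e}"
    define x x' where "x u = lie (\<Phi> u) e" and "x' u = lie (\<Phi>1 u) e" for u
    have span_e: "y = lie y e *\<^sub>R e" if "y \<in> W" for y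
    proof -
      obtain c where "y = c *\<^sub>R e" using sub \<open>y \<in> W\<close> by (auto simp: span_singleton)
      then show ?thesis by (simp add: lie_simps e)
    qed
    have dx: "(x has_real_derivative x' u) (at u)" if "u \<in> I" for u
      unfolding x_def x'_def using has_real_derivative_lie_\<Phi>[OF that] .
    have x'0: "x' u \<noteq> 0" if "u \<in> I" for u
      using span_e[OF \<Phi>1_in_W[OF that]] \<Phi>1[OF that] by (auto simp: x'_def lie_simps)
    define A where "A = lie (a v0) e"
    have "2 * A * x u + (x u)\<^sup>2 = 0" if "u \<in> I" for u
    proof -
      have "\<Phi> u = x u *\<^sub>R e" unfolding x_def using that by (intro span_e) (auto simp: W_def span_base)
      then show ?thesis using \<Phi>_norm[OF that v0] by (simp add: lie_simps e A_def power2_eq_square algebra_simps)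
    qed
    then show False
      using quadratic_relation_impossible[of x x' A] dx x'0 by blast
  qed
  then obtain y where y: "y \<in> W" "y \<notin> span {e}" by auto
  define z where "z = y - lie y e *\<^sub>R e"
  have z0: "z \<noteq> 0" using y(2) by (auto simp: z_def span_singleton)
  have ez: "lie e z = 0" by (simp add: z_def lie_simps e lie_commute)
  have zW: "z \<in> W" unfolding z_def using y(1) eW subW by (simp add: subspace_diff subspace_scale)
  \<comment> \<open>a null vector \<open>z\<close> cannot be normalised and is kept\<close>
  define c where "c = (if lie z z = 0 then 1 else 1 / sqrt \<bar>lie z z\<bar>)"
  define w where "w = c *\<^sub>R z"
  have c: "c \<noteq> 0" by (simp add: c_def)
  have ww: "lie w w = 0 \<or> lie w w = 1 \<or> lie w w = -1"
  proof (cases "lie z z = 0")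
    case False
    have "lie w w = lie z z / (sqrt \<bar>lie z z\<bar> * sqrt \<bar>lie z z\<bar>)"
      using False by (simp add: w_def c_def lie_simps)
    also have "\<dots> = lie z z / \<bar>lie z z\<bar>" by simp
    finally show ?thesis using False by (auto simp: abs_if)
  qed (simp add: w_def lie_simps)
  have w: "w \<noteq> 0" "lie e w = 0" "w \<in> W"
    using c z0 ez zW subW by (simp_all add: w_def lie_simps subspace_scale)
  have "w \<notin> span {e}"
  proof
    assume "w \<in> span {e}"
    then obtain d where "w = d *\<^sub>R e" by (auto simp: span_singleton)
    then show False using w(1,2) e by (simp add: lie_simps)
  qed
  moreover have "e \<noteq> 0" using e by (auto simp: lie_simps)
  ultimately have ind: "independent {w, e}" by (simp add: independent_insertI)
  have "w \<noteq> e" using w(2) e by auto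
  then have "card {w, e} = 2" by simp
  then have "W \<subseteq> span {w, e}"
    using assms ind w(3) eW by (intro card_ge_dim_independent) auto
  moreover have "span {w, e} \<subseteq> W" using w(3) eW subW by (intro span_minimal) auto
  ultimately have "W = span {e, w}" by (auto simp: insert_commute)
  then show ?thesis using that e w ww by blast
qed

end

section \<open>Cones, cylinders and surfaces of revolution\<close>

text \<open>The form is positive semidefinite on the complement of \<open>p\<close> and \<open>q\<close>, with radical \<open>\<langle>q\<rangle>\<close>: the point at
  infinity is the only plane that is also a point.\<close>

lemma null_perp_eq_scale_q:
  assumes sub: "euclidean_subgeometry p q" "euclidean_frame p q b e"
    and x: "lie x x = 0" "lie x p = 0" "lie x q = 0"
  shows "x = - lie x b *\<^sub>R q"
proof -
  have "(\<Sum>i\<in>UNIV. (lie x (e i))\<^sup>2) = 0"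
    using euclidean_frame_norm[OF sub, of x] x by simp
  then have "\<forall>i. lie x (e i) = 0" by (simp add: sum_nonneg_eq_0_iff)
  then show ?thesis using euclidean_frame_expand[OF sub, of x] x by simp
qed

context translation_net
begin

lemma \<Phi>_in_W: "u \<in> I \<Longrightarrow> \<Phi> u \<in> W"
  by (simp add: W_def span_base)

lemma W_perp:
  assumes "W = span {e, w}" "lie e y = 0" "lie w y = 0" "x \<in> W"
  shows "lie x y = 0"
  by (rule orthogonal_span[of "{e, w}"]) (use assms in auto)

lemma combination_in_space_form:
  assumes "u \<in> I" "v \<in> J" and f: "f = x *\<^sub>R (R u v) + y *\<^sub>R \<sigma> v" "lie f p = 0" "lie f q = -1"
  shows "f \<in> span {\<sigma> v, R u v}" "f \<in> space_form p q"
proof -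
  show "f \<in> span {\<sigma> v, R u v}"
    unfolding f(1) by (intro span_add span_scale span_base) auto
  have "lie f f = 0"
    unfolding f(1) lie.add_left[of "x *\<^sub>R (R u v)"] lie.add_right[of _ "x *\<^sub>R (R u v)"]
    using null[OF assms(1,2)] perp(1)[OF assms(1,2)] \<sigma>(1)[OF assms(2)]
    by (simp only: lie.scaleR_left lie.scaleR_right lie_commute[of "\<sigma> v" "R u v"]) simp
  moreover have "f \<noteq> 0" using f(3) by (auto simp: lie_simps)
  ultimately show "f \<in> space_form p q" using f by (simp add: space_form_def)
qed

lemma net_represents_R:
  assumes pq: "euclidean_subgeometry p q" "euclidean_frame p q b E"
    and f: "\<And>u v. u \<in> I \<Longrightarrow> v \<in> J \<Longrightarrow> f u v \<in> span {\<sigma> v, R u v}"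
      "\<And>u v. u \<in> I \<Longrightarrow> v \<in> J \<Longrightarrow> f u v \<in> space_form p q"
    and P: "P (I \<times> J) (\<lambda>(u, v). \<chi> i. lie (f u v) (E i))"
  shows "net_represents P (I \<times> J) (\<lambda>(u, v). \<sigma> v) (\<lambda>(u, v). R u v)"
proof -
  define F where "F = (\<lambda>(u, v). f u v)"
  have "\<forall>z\<in>I \<times> J. F z \<in> span {case z of (u, v) \<Rightarrow> \<sigma> v, case z of (u, v) \<Rightarrow> R u v} \<and> F z \<in> space_form p q"
    using f by (auto simp: F_def)
  moreover have "P (I \<times> J) (\<lambda>z. \<chi> i. lie (F z) (E i))"
    using P by (simp add: F_def case_prod_unfold)
  ultimately show ?thesis unfolding net_represents_def using pq by blast
qed

text \<open>The null lines \<open>\<langle>q\<rangle>\<close> and \<open>\<langle>b\<rangle>\<close> of \<open>W\<close> become the point at infinity and the vertex. The components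
  \<open>Q(u)\<close>, \<open>B(u)\<close> of \<open>a + \<Phi>\<close> in \<open>W\<close> have constant product, since \<open>a + \<Phi>\<close> is null and its component in
  the complement of \<open>W\<close> depends on \<open>v\<close> only. The constant is nonzero because \<open>Q\<close> and \<open>B\<close> have
  nonvanishing derivatives. Therefore the point sphere can be scaled to \<open>(f, q) = - 1\<close>, and its Cartesian
  coordinates are those of \<open>g(v)\<close> multiplied by \<open>t(u) = - 1 / Q(u)\<close>.\<close>

lemma cone:
  assumes W: "W = span {e, w}" and ew: "lie e e = 1" "lie e w = 0" "lie w w = -1"
  shows "net_represents is_cone (I \<times> J) (\<lambda>(u, v). \<sigma> v) (\<lambda>(u, v). R u v)"
proof -
  obtain u1 where u1: "u1 \<in> I" using I(3) by auto
  obtain v0 where v0: "v0 \<in> J" using J by auto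
  define q b where "q = w + e" and "b = (1/2) *\<^sub>R (w - e)"
  have we: "lie w e = 0" using ew(2) by (simp add: lie_commute)
  have qb: "lie q q = 0" "lie b q = -1" "lie b b = 0"
    by (simp_all add: q_def b_def lie_simps ew we)
  obtain p F where p: "lie p p = -1" "lie p q = 0" "lie p b = 0" and
    F: "card F = 3" "lie_orthonormal F"
    "\<And>w. w \<in> F \<Longrightarrow> lie w w = 1 \<and> lie w q = 0 \<and> lie w b = 0 \<and> lie w p = 0"
    by (rule hyperbolic_pair_extend[OF qb, of "{}"]) (auto simp: lie_orthonormal_def)
  obtain x y z where xyz: "F = {x, y, z}" "x \<noteq> y" "x \<noteq> z" "y \<noteq> z"
    using F(1) by (auto simp: card_3_iff)
  define E where "E = three_frame x y z"
  have frame: "euclidean_frame p q b E"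
    unfolding E_def by (rule euclidean_frame_three_frame) (use qb p F xyz in auto)
  have "q \<noteq> 0" using qb(2) by (auto simp: lie_simps)
  then have sub: "euclidean_subgeometry p q" using qb p by (simp add: euclidean_subgeometry_def)
  have EF: "E i \<in> F" for i using xyz(1) by (simp add: E_def three_frame_def)
  have e_w: "e = (1/2) *\<^sub>R q - b" "w = (1/2) *\<^sub>R q + b"
    by (simp_all add: q_def b_def vec_eq_iff field_simps)
  have ew_perp: "lie e y = 0" "lie w y = 0" if "lie y q = 0" "lie y b = 0" for y
    using that unfolding e_w by (simp_all add: lie_simps lie_commute[of q y] lie_commute[of b y])
  have perp_W: "lie x y = 0" if "lie y q = 0" "lie y b = 0" "x \<in> W" for x y
    by (rule W_perp[OF W]) (use ew_perp that in auto)
  have pW: "lie x p = 0" "lie x (E i) = 0" if "x \<in> W" for x i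
    using perp_W[OF _ _ that] p F(3)[OF EF] by blast+
  have qW: "q \<in> W" "b \<in> W"
    unfolding W q_def b_def by (intro span_add span_diff span_scale span_base; simp)+
  have \<sigma>q: "lie (\<sigma> v) q = 0" "lie (\<sigma> v) b = 0" if "v \<in> J" for v
    using W_perp_\<sigma>[OF that] qW by (simp_all add: lie_commute)
  have \<sigma>p: "lie (\<sigma> v) p \<noteq> 0" if "v \<in> J" for v
    using null_perp_eq_scale_q[OF sub frame \<sigma>(1)[OF that]] \<sigma>q[OF that] \<sigma>_nonzero[OF that] by auto
  define Q B where "Q u = lie (a v0) q + lie (\<Phi> u) q" and "B u = lie (a v0) b + lie (\<Phi> u) b" for u
  have RQ: "lie (R u v) q = Q u" "lie (R u v) b = B u" if "v \<in> J" for u v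
    using lie_a_W_constant[OF that v0] qW by (simp_all add: Q_def B_def lie.add_left)
  have dQ: "(Q has_real_derivative lie (\<Phi>1 u) q) (at u)" "(B has_real_derivative lie (\<Phi>1 u) b) (at u)"
    if "u \<in> I" for u
    unfolding Q_def B_def using has_real_derivative_lie_\<Phi>[OF that]
    by (auto intro!: derivative_eq_intros)
  have dQ0: "lie (\<Phi>1 u) q \<noteq> 0" "lie (\<Phi>1 u) b \<noteq> 0" if "u \<in> I" for u
    using euclidean_frame_norm[OF sub frame, of "\<Phi>1 u"] \<Phi>1[OF that] pW[OF \<Phi>1_in_W[OF that]] by auto
  \<comment> \<open>the square of the component of \<open>a(v0) + \<Phi>(u)\<close> in the complement of \<open>W\<close>, to which \<open>\<Phi>(u)\<close> does not contribute\<close>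
  define K where "K = (\<Sum>i\<in>UNIV. (lie (a v0) (E i))\<^sup>2) - (lie (a v0) p)\<^sup>2"
  have QB: "2 * Q u * B u = K" if "u \<in> I" for u
    using euclidean_frame_norm[OF sub frame, of "R u v0"] null[OF that v0] pW[OF \<Phi>_in_W[OF that]]
    by (simp add: RQ[OF v0]) (simp add: lie.add_left K_def)
  have K0: "K \<noteq> 0"
  proof
    assume "K = 0"
    then have prod0: "Q u = 0 \<or> B u = 0" if "u \<in> I" for u using QB[OF that] by simp
    have Q0: "Q u = 0" if u: "u \<in> I" for u
    proof -
      have "((\<lambda>u. 2 * Q u * B u) has_real_derivative 2 * lie (\<Phi>1 u) q * B u + 2 * Q u * lie (\<Phi>1 u) b) (at u)"
        by (rule derivative_eq_intros dQ[OF u] refl | simp)+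
      then have "2 * lie (\<Phi>1 u) q * B u + 2 * Q u * lie (\<Phi>1 u) b = 0"
        unfolding has_real_derivative_iff_has_vector_derivative
        by (rule has_vector_derivative_const_on_open[OF _ I(1) u]) (rule QB)
      then show ?thesis using prod0[OF u] dQ0[OF u] by auto
    qed
    then show False
      using has_vector_derivative_const_on_open[OF dQ(1)[OF u1, unfolded
          has_real_derivative_iff_has_vector_derivative] I(1) u1] dQ0(1)[OF u1] by blast
  qed
  then have QB0: "Q u \<noteq> 0" "B u \<noteq> 0" if "u \<in> I" for u using QB[OF that] by auto
  define t where "t u = - 1 / Q u" for u
  define g where "g v = a v - (lie (a v) p / lie (\<sigma> v) p) *\<^sub>R \<sigma> v" for v
  define f where "f u v = t u *\<^sub>R (g v + \<Phi> u)" for u v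
  define \<gamma> where "\<gamma> v = (\<chi> i. lie (g v) (E i))" for v
  have f: "f u v \<in> span {\<sigma> v, R u v}" "f u v \<in> space_form p q" if uv: "u \<in> I" "v \<in> J" for u v
  proof -
    have "lie (f u v) p = 0"
      using \<sigma>p[OF uv(2)] pW(1)[OF \<Phi>_in_W[OF uv(1)]] by (simp add: f_def g_def lie_simps)
    moreover have "lie (f u v) q = -1"
      using QB0[OF uv(1)] RQ(1)[OF uv(2), of u] \<sigma>q(1)[OF uv(2)]
      by (simp add: f_def g_def lie_simps t_def)
    moreover have "f u v = t u *\<^sub>R (R u v) + (- t u * (lie (a v) p / lie (\<sigma> v) p)) *\<^sub>R \<sigma> v"
      by (simp add: f_def g_def algebra_simps)
    ultimately show "f u v \<in> span {\<sigma> v, R u v}" "f u v \<in> space_form p q"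
      using combination_in_space_form[OF uv] by blast+
  qed
  have coord: "lie (f u v) (E i) = t u * lie (g v) (E i)" if "u \<in> I" for u v i
    using pW(2)[OF \<Phi>_in_W[OF that]] by (simp add: f_def lie_simps)
  have "\<gamma> v \<noteq> 0" if v: "v \<in> J" for v
  proof
    assume "\<gamma> v = 0"
    then have "lie (g v) (E i) = 0" for i by (simp add: \<gamma>_def vec_eq_iff)
    moreover have "lie (f u1 v) (f u1 v) = 0" "lie (f u1 v) p = 0" "lie (f u1 v) q = -1"
      using f(2)[OF u1 v] by (simp_all add: space_form_def)
    ultimately have "lie (f u1 v) b = 0"
      using euclidean_frame_norm[OF sub frame, of "f u1 v"] by (simp add: coord[OF u1])
    moreover have "lie (f u1 v) b = t u1 * B u1"
      using RQ(2)[OF v, of u1] \<sigma>q(2)[OF v] by (simp add: f_def g_def lie_simps)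
    ultimately show False using QB0[OF u1] by (simp add: t_def)
  qed
  moreover have "regular_at t u" if u: "u \<in> I" for u
    unfolding regular_at_def t_def
  proof (intro exI conjI)
    show "((\<lambda>u. - 1 / Q u) has_real_derivative lie (\<Phi>1 u) q / (Q u)\<^sup>2) (at u)"
      using QB0(1)[OF u] by (auto intro!: derivative_eq_intros dQ(1)[OF u] simp: power2_eq_square)
    show "lie (\<Phi>1 u) q / (Q u)\<^sup>2 \<noteq> 0" using QB0(1)[OF u] dQ0(1)[OF u] by simp
  qed
  ultimately have "is_cone (I \<times> J) (\<lambda>(u, v). \<chi> i. lie (f u v) (E i))"
    unfolding is_cone_def
    by (intro exI[of _ 0] exI[of _ t] exI[of _ \<gamma>]) (auto simp: vec_eq_iff coord \<gamma>_def)
  then show ?thesis using net_represents_R[OF sub frame f] by blast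
qed

text \<open>The null line \<open>\<langle>w\<rangle>\<close> of \<open>W\<close> becomes the point at infinity. The product \<open>\<kappa> = (a + \<Phi>, w)\<close> is constant, and
  nonzero by \<open>quadratic_relation_impossible\<close>; so \<open>q\<close> can be scaled to \<open>(a + \<Phi>, q) = - 1\<close>, and the
  point sphere is \<open>a + \<Phi>\<close> plus a multiple of \<open>\<sigma>\<close> that depends on \<open>v\<close> only. Modulo \<open>q\<close>, it moves with \<open>u\<close>
  in the direction \<open>e\<close>.\<close>

lemma cylinder:
  assumes W: "W = span {e, w}" and ew: "lie e e = 1" "lie e w = 0" "lie w w = 0" "w \<noteq> 0"
  shows "net_represents is_cylinder (I \<times> J) (\<lambda>(u, v). \<sigma> v) (\<lambda>(u, v). R u v)"
proof -
  obtain v0 where v0: "v0 \<in> J" using J by auto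
  have we: "lie w e = 0" using ew(2) by (simp add: lie_commute)
  have comb: "\<exists>c. y = lie y e *\<^sub>R e + c *\<^sub>R w" if y: "y \<in> W" for y
  proof -
    obtain k c where "y - k *\<^sub>R e = c *\<^sub>R w"
      using y unfolding W by (auto simp: span_insert span_singleton)
    then have "y = k *\<^sub>R e + c *\<^sub>R w" by (simp add: algebra_simps)
    then show ?thesis using ew we by (intro exI[of _ c]) (simp add: lie_simps)
  qed
  have W_w: "lie y w = 0" if "y \<in> W" for y
    using W_perp[OF W _ _ that] ew by blast
  have eW: "e \<in> W" "w \<in> W" unfolding W by (auto intro: span_base)
  define \<kappa> where "\<kappa> = lie (a v0) w"
  have Rw: "lie (R u v) w = \<kappa>" if "u \<in> I" "v \<in> J" for u v
    using lie_a_W_constant[OF that(2) v0 eW(2)] W_w[OF \<Phi>_in_W[OF that(1)]]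
    by (simp add: lie.add_left \<kappa>_def)
  define x x' where "x u = lie (\<Phi> u) e" and "x' u = lie (\<Phi>1 u) e" for u
  have dx: "(x has_real_derivative x' u) (at u)" if "u \<in> I" for u
    unfolding x_def x'_def using has_real_derivative_lie_\<Phi>[OF that] .
  have x'0: "x' u \<noteq> 0" if u: "u \<in> I" for u
  proof
    assume "x' u = 0"
    then obtain c where "\<Phi>1 u = c *\<^sub>R w" using comb[OF \<Phi>1_in_W[OF u]] by (auto simp: x'_def)
    then show False using \<Phi>1[OF u] by (simp add: lie_simps ew)
  qed
  have \<kappa>0: "\<kappa> \<noteq> 0"
  proof
    assume \<kappa>: "\<kappa> = 0"
    have "2 * lie (a v0) e * x u + (x u)\<^sup>2 = 0" if u: "u \<in> I" for u
    proof -
      obtain c where c: "\<Phi> u = x u *\<^sub>R e + c *\<^sub>R w" using comb[OF \<Phi>_in_W[OF u]] by (auto simp: x_def)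
      have "lie (a v0) w = 0" using \<kappa> by (simp add: \<kappa>_def)
      then show ?thesis
        using \<Phi>_norm[OF u v0] by (simp add: c lie_simps ew we power2_eq_square algebra_simps)
    qed
    then show False using quadratic_relation_impossible[OF dx x'0] by blast
  qed
  define q where "q = (- 1 / \<kappa>) *\<^sub>R w"
  have q: "q \<noteq> 0" "lie q q = 0" "lie e q = 0"
    using ew \<kappa>0 by (simp_all add: q_def lie_simps)
  have qW: "q \<in> W" using eW(2) unfolding q_def W_def by (rule span_scale)
  have on_e: "lie_orthonormal {e}" "\<And>x. x \<in> {e} \<Longrightarrow> lie x x = 1 \<and> lie x q = 0"
    using ew q by (auto simp: lie_orthonormal_def)
  obtain b where b: "lie b q = -1" "lie b b = 0" "\<And>x. x \<in> {e} \<Longrightarrow> lie x b = 0"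
    using null_partner[OF q(1,2) on_e] by metis
  obtain p F where p: "lie p p = -1" "lie p q = 0" "lie p b = 0" and
    F: "{e} \<subseteq> F" "card F = 3" "lie_orthonormal F"
    "\<And>w. w \<in> F \<Longrightarrow> lie w w = 1 \<and> lie w q = 0 \<and> lie w b = 0 \<and> lie w p = 0"
    by (rule hyperbolic_pair_extend[OF q(2) b(1,2) on_e(1)]) (use on_e(2) b(3) in blast)+
  have "card (F - {e}) = 2" using F by simp
  then obtain y z where yz: "F - {e} = {y, z}" "y \<noteq> z" by (auto simp: card_2_iff)
  then have F_eq: "F = {e, y, z}" "e \<noteq> y" "e \<noteq> z" using F(1) by auto
  define E where "E = three_frame e y z"
  have frame: "euclidean_frame p q b E"
    unfolding E_def by (rule euclidean_frame_three_frame) (use q b p F F_eq yz in auto)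
  have sub: "euclidean_subgeometry p q" using q p by (simp add: euclidean_subgeometry_def)
  have "w = - \<kappa> *\<^sub>R q" using \<kappa>0 by (simp add: q_def)
  then have w_perp: "lie w s = 0" if "lie s q = 0" for s
    using that by (simp add: lie_simps lie_commute[of q s])
  have pW: "lie s p = 0" if "s \<in> W" for s
    by (rule W_perp[OF W]) (use that p F w_perp in auto)
  have EW: "lie s (E i) = (if i = 1 then lie s e else 0)" if s: "s \<in> W" for s i
  proof (cases "i = 1")
    case False
    then have "E i \<in> F - {e}" using yz by (simp add: E_def three_frame_def)
    then have "lie e (E i) = 0" "lie (E i) q = 0"
      using F(1,3) F(4)[of "E i"] by (auto simp: lie_orthonormal_def)
    then have "lie s (E i) = 0" by (intro W_perp[OF W _ _ s]) (auto simp: w_perp)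
    then show ?thesis using False by simp
  qed (simp add: E_def)
  have \<sigma>q: "lie (\<sigma> v) q = 0" if "v \<in> J" for v
    using W_perp_\<sigma>[OF that qW] by (simp add: lie_commute)
  have Rq: "lie (R u v) q = -1" if "u \<in> I" "v \<in> J" for u v
    using Rw[OF that] \<kappa>0 by (simp add: q_def lie_simps)
  obtain u1 where u1: "u1 \<in> I" using I(3) by auto
  have \<sigma>p: "lie (\<sigma> v) p \<noteq> 0" if v: "v \<in> J" for v
  proof
    assume "lie (\<sigma> v) p = 0"
    then have eq: "\<sigma> v = - lie (\<sigma> v) b *\<^sub>R q"
      using null_perp_eq_scale_q[OF sub frame \<sigma>(1)[OF v]] \<sigma>q[OF v] by blast
    have "lie (R u1 v) (\<sigma> v) = lie (\<sigma> v) b"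
      by (subst eq) (simp add: lie.scaleR_right lie.minus_right Rq[OF u1 v])
    then have "lie (\<sigma> v) b = 0" using perp(1)[OF u1 v] by simp
    then show False using eq \<sigma>_nonzero[OF v] by simp
  qed
  define g where "g v = a v - (lie (a v) p / lie (\<sigma> v) p) *\<^sub>R \<sigma> v" for v
  define f where "f u v = g v + \<Phi> u" for u v
  define \<gamma> where "\<gamma> v = (\<chi> i. lie (g v) (E i))" for v
  have f: "f u v \<in> span {\<sigma> v, R u v}" "f u v \<in> space_form p q" if uv: "u \<in> I" "v \<in> J" for u v
  proof -
    have "lie (f u v) p = 0"
      using \<sigma>p[OF uv(2)] pW[OF \<Phi>_in_W[OF uv(1)]] by (simp add: f_def g_def lie_simps)
    moreover have "lie (f u v) q = -1"
      using Rq[OF uv] \<sigma>q[OF uv(2)] by (simp add: f_def g_def lie_simps)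
    moreover have "f u v = 1 *\<^sub>R (R u v) + (- (lie (a v) p / lie (\<sigma> v) p)) *\<^sub>R \<sigma> v"
      by (simp add: f_def g_def)
    ultimately show "f u v \<in> span {\<sigma> v, R u v}" "f u v \<in> space_form p q"
      using combination_in_space_form[OF uv] by blast+
  qed
  have "regular_at x u" if "u \<in> I" for u
    unfolding regular_at_def using dx[OF that] x'0[OF that] by blast
  moreover have "(\<chi> i. lie (f u v) (E i)) = \<gamma> v + x u *\<^sub>R axis 1 1" if "u \<in> I" for u v
    by (simp add: vec_eq_iff f_def \<gamma>_def lie.add_left EW[OF \<Phi>_in_W[OF that]] x_def axis_def)
  ultimately have "is_cylinder (I \<times> J) (\<lambda>(u, v). \<chi> i. lie (f u v) (E i))"
    unfolding is_cylinder_def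
    by (intro exI[of _ "axis 1 1"] exI[of _ x] exI[of _ \<gamma>]) (auto simp: axis_eq_0_iff)
  then show ?thesis using net_represents_R[OF sub frame f] by blast
qed


text \<open>The component of \<open>a + \<Phi>\<close> in \<open>W\<close> runs on a circle of radius \<open>\<rho>\<close>. With \<open>p\<close> and \<open>q\<close> in the complement of
  \<open>W\<close>, the point sphere is \<open>x(v) (a + \<Phi>) + y(v) \<sigma>\<close>, so moving \<open>u\<close> rotates it in the plane \<open>W\<close>. The
  coefficients exist where the determinant \<open>\<Delta>(v)\<close> does not vanish; it vanishes only if the point sphere
  is at infinity, and then \<open>\<sigma>(v)\<close> is a multiple of \<open>q\<close>, which the choice of \<open>q\<close> excludes.\<close>

lemma revolution:
  assumes W: "W = span {e, w}" and ew: "lie e e = 1" "lie e w = 0" "lie w w = 1"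
  shows "net_represents is_revolution (I \<times> J) (\<lambda>(u, v). \<sigma> v) (\<lambda>(u, v). R u v)"
proof -
  obtain u1 where u1: "u1 \<in> I" using I(3) by auto
  obtain v0 where v0: "v0 \<in> J" using J by auto
  have we: "lie w e = 0" using ew(2) by (simp add: lie_commute)
  have "e \<noteq> w" using ew by auto
  have on_ew: "lie_orthonormal {e, w}" using ew we by (auto simp: lie_orthonormal_def)
  have comb: "y = lie y e *\<^sub>R e + lie y w *\<^sub>R w" if y: "y \<in> W" for y
  proof -
    obtain k c where "y - k *\<^sub>R e = c *\<^sub>R w"
      using y unfolding W by (auto simp: span_insert span_singleton)
    then have "y = k *\<^sub>R e + c *\<^sub>R w" by (simp add: algebra_simps)
    then show ?thesis using ew we by (simp add: lie_simps)
  qed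
  have eW: "e \<in> W" "w \<in> W" unfolding W by (auto intro: span_base)
  obtain T where T: "{e, w} \<subseteq> T" "lie_orthonormal T" "finite T"
    "card {x \<in> T. lie x x = -1} = 2" "card {x \<in> T. lie x x = 1} = 4" "card T = 6"
    by (rule lie_orthonormal_complete[OF on_ew])
  obtain n1 n2 where n: "{x \<in> T. lie x x = -1} = {n1, n2}" "n1 \<noteq> n2"
    using T(4) by (auto simp: card_2_iff)
  have "card ({x \<in> T. lie x x = 1} - {e, w}) = 2"
    using T ew \<open>e \<noteq> w\<close> by (subst card_Diff_subset) auto
  then obtain p1 p2 where p12: "{x \<in> T. lie x x = 1} - {e, w} = {p1, p2}" "p1 \<noteq> p2"
    by (auto simp: card_2_iff)
  have T': "n1 \<in> T" "n2 \<in> T" "p1 \<in> T" "p2 \<in> T" "lie n1 n1 = -1" "lie n2 n2 = -1"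
    "lie p1 p1 = 1" "lie p2 p2 = 1" "p1 \<notin> {e, w}" "p2 \<notin> {e, w}"
    using n(1) p12(1) by blast+
  then have notin: "n1 \<notin> {e, w}" "n2 \<notin> {e, w}" using ew by auto
  have on: "lie_orthonormal {p1, p2, n1, n2}"
    using T(2) by (rule lie_orthonormal_subset) (use T' in auto)
  obtain q where q: "q \<noteq> 0" "lie q q = 0" "q \<in> span {p1, p2, n1, n2}"
    and off: "\<And>v c. v \<in> J \<Longrightarrow> \<sigma> v \<noteq> c *\<^sub>R q"
    using null_direction_off_curve[OF on T'(7,8,5,6) p12(2) n(2) d\<sigma> \<sigma>_nonzero] by metis
  have qew: "lie q s = 0" if "s \<in> {e, w}" for s
  proof (rule orthogonal_span[OF _ q(3)])
    fix x assume "x \<in> {p1, p2, n1, n2}"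
    then have "x \<in> T" "x \<noteq> s" using T' notin that by auto
    then show "lie x s = 0" using T(1,2) that by (auto simp: lie_orthonormal_def)
  qed
  have E0: "lie x x = 1 \<and> lie x q = 0" if "x \<in> {e, w}" for x
    using that ew qew[OF that] by (auto simp: lie_commute)
  obtain b where b: "lie b q = -1" "lie b b = 0" "\<And>x. x \<in> {e, w} \<Longrightarrow> lie x b = 0"
    using null_partner[OF q(1,2) on_ew E0] by metis
  obtain p F where p: "lie p p = -1" "lie p q = 0" "lie p b = 0" and
    F: "{e, w} \<subseteq> F" "card F = 3" "lie_orthonormal F"
    "\<And>w. w \<in> F \<Longrightarrow> lie w w = 1 \<and> lie w q = 0 \<and> lie w b = 0 \<and> lie w p = 0"
    by (rule hyperbolic_pair_extend[OF q(2) b(1,2) on_ew]) (use E0 b(3) in blast)+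
  have "card (F - {e, w}) = 1" using F \<open>e \<noteq> w\<close> by (subst card_Diff_subset) auto
  then obtain z where z: "F - {e, w} = {z}" by (auto simp: card_1_singleton_iff)
  then have F_eq: "F = {e, w, z}" "e \<noteq> z" "w \<noteq> z" using F(1) by auto
  define E where "E = three_frame e w z"
  have frame: "euclidean_frame p q b E"
    unfolding E_def by (rule euclidean_frame_three_frame) (use q b p F F_eq \<open>e \<noteq> w\<close> in auto)
  have sub: "euclidean_subgeometry p q" using q p by (simp add: euclidean_subgeometry_def)
  have z_ew: "lie e z = 0" "lie w z = 0" using F(3) F_eq by (auto simp: lie_orthonormal_def)
  have W_perp': "lie s p = 0" "lie s q = 0" "lie s z = 0" if "s \<in> W" for s
    by (rule W_perp[OF W _ _ that]; use F(4) F_eq z_ew in auto)+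
  define X1 X2 where "X1 u = lie (a v0) e + lie (\<Phi> u) e" and "X2 u = lie (a v0) w + lie (\<Phi> u) w" for u
  have RX: "lie (R u v) e = X1 u" "lie (R u v) w = X2 u" if "v \<in> J" for u v
    using lie_a_W_constant[OF that v0] eW by (simp_all add: X1_def X2_def lie.add_left)
  have dX: "(X1 has_real_derivative lie (\<Phi>1 u) e) (at u)" "(X2 has_real_derivative lie (\<Phi>1 u) w) (at u)"
    if "u \<in> I" for u
    unfolding X1_def X2_def using has_real_derivative_lie_\<Phi>[OF that]
    by (auto intro!: derivative_eq_intros)
  have cX: "continuous_on I (\<lambda>u. lie (\<Phi>1 u) s)" for s
    using bounded_linear.continuous_on[OF lie.bounded_linear_left d\<Phi>(2)] .
  have reg: "lie (\<Phi>1 u) e \<noteq> 0 \<or> lie (\<Phi>1 u) w \<noteq> 0" if "u \<in> I" for u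
    using comb[OF \<Phi>1_in_W[OF that]] \<Phi>1[OF that] by (auto simp: lie_simps)
  \<comment> \<open>the component of \<open>a(v0)\<close> orthogonal to \<open>W\<close>; as \<open>a + \<Phi>\<close> is null, it determines the radius\<close>
  define a' where "a' = a v0 - lie (a v0) e *\<^sub>R e - lie (a v0) w *\<^sub>R w"
  have a': "lie a' e = 0" "lie a' w = 0" "lie e a' = 0" "lie w a' = 0"
    by (simp_all add: a'_def lie_simps ew we lie_commute)
  have circle: "(X1 u)\<^sup>2 + (X2 u)\<^sup>2 = - lie a' a'" if u: "u \<in> I" for u
  proof -
    have "R u v0 = X1 u *\<^sub>R e + X2 u *\<^sub>R w + a'"
      using comb[OF \<Phi>_in_W[OF u]] by (simp add: a'_def X1_def X2_def algebra_simps)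
    then show ?thesis
      using null[OF u v0] by (simp add: lie_simps ew we a' power2_eq_square)
  qed
  define \<rho> where "\<rho> = sqrt (- lie a' a')"
  have ge: "0 \<le> - lie a' a'" using circle[OF u1] by (metis sum_power2_ge_zero)
  have \<rho>0: "\<rho> > 0"
  proof (rule ccontr)
    assume "\<not> \<rho> > 0"
    then have "lie a' a' = 0" using ge by (simp add: \<rho>_def)
    then have X0: "X1 u = 0" "X2 u = 0" if "u \<in> I" for u
      using circle[OF that] by (simp_all add: sum_power2_eq_zero_iff)
    then have "lie (\<Phi>1 u1) e = 0" "lie (\<Phi>1 u1) w = 0"
      using dX[OF u1, unfolded has_real_derivative_iff_has_vector_derivative]
        has_vector_derivative_const_on_open[OF _ I(1) u1] by blast+
    then show False using reg[OF u1] by simp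
  qed
  have \<rho>2: "(X1 u)\<^sup>2 + (X2 u)\<^sup>2 = \<rho>\<^sup>2" if "u \<in> I" for u
    using circle[OF that] ge by (simp add: \<rho>_def)
  obtain \<theta> where \<theta>: "\<And>u. u \<in> I \<Longrightarrow> regular_at \<theta> u"
    "\<And>u. u \<in> I \<Longrightarrow> X1 u = \<rho> * cos (\<theta> u)" "\<And>u. u \<in> I \<Longrightarrow> X2 u = \<rho> * sin (\<theta> u)"
    using angle_function[OF I(1,2) \<rho>0 dX(1) cX dX(2) cX \<rho>2 reg] by metis
  have \<sigma>e: "lie (\<sigma> v) e = 0" "lie (\<sigma> v) w = 0" if "v \<in> J" for v
    using W_perp_\<sigma>[OF that] eW by (simp_all add: lie_commute)
  define \<Delta> where "\<Delta> v = lie (a v) p * lie (\<sigma> v) q - lie (\<sigma> v) p * lie (a v) q" for v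
  have Rpq: "lie (R u v) p = lie (a v) p" "lie (R u v) q = lie (a v) q" if "u \<in> I" for u v
    using W_perp'[OF \<Phi>_in_W[OF that]] by (simp_all add: lie.add_left)
  have \<Delta>0: "\<Delta> v \<noteq> 0" if v: "v \<in> J" for v
  proof
    assume 0: "\<Delta> v = 0"
    \<comment> \<open>a kernel vector of the singular system, i.e. a sphere of \<open>\<Lambda>\<close> orthogonal to \<open>p\<close> and \<open>q\<close>\<close>
    obtain x y where xy: "x \<noteq> 0 \<or> y \<noteq> 0" "x * lie (a v) p + y * lie (\<sigma> v) p = 0"
      "x * lie (a v) q + y * lie (\<sigma> v) q = 0"
    proof (cases "lie (a v) p = 0 \<and> lie (\<sigma> v) p = 0")
      case True
      show ?thesis
      proof (cases "lie (a v) q = 0 \<and> lie (\<sigma> v) q = 0")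
        case False
        then show ?thesis using True that[of "lie (\<sigma> v) q" "- lie (a v) q"] by auto
      qed (use True that[of 1 0] in auto)
    next
      case False
      then show ?thesis
        using 0 that[of "lie (\<sigma> v) p" "- lie (a v) p"] by (auto simp: \<Delta>_def)
    qed
    define f where "f = x *\<^sub>R (R u1 v) + y *\<^sub>R \<sigma> v"
    have "lie f p = 0" "lie f q = 0"
      using xy by (simp_all only: f_def lie.add_left[of "x *\<^sub>R _"] lie.scaleR_left Rpq[OF u1]) simp_all
    moreover have "lie f f = 0"
      unfolding f_def lie.add_left[of "x *\<^sub>R (R u1 v)"] lie.add_right[of _ "x *\<^sub>R (R u1 v)"]
      using null[OF u1 v] perp(1)[OF u1 v] \<sigma>(1)[OF v]
      by (simp only: lie.scaleR_left lie.scaleR_right lie_commute[of "\<sigma> v" "R u1 v"]) simp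
    ultimately have fq: "f = - lie f b *\<^sub>R q"
      using null_perp_eq_scale_q[OF sub frame] by blast
    have "lie f e = 0" "lie f w = 0"
      by (subst fq, simp add: lie_simps qew)+
    moreover have "lie f e = x * X1 u1" "lie f w = x * X2 u1"
      by (simp_all only: f_def lie.add_left[of "x *\<^sub>R _"] lie.scaleR_left RX[OF v] \<sigma>e[OF v]) simp_all
    ultimately have x0: "x = 0" using \<rho>2[OF u1] \<rho>0 by auto
    then have "y \<noteq> 0" using xy by auto
    have "\<sigma> v = (1 / y) *\<^sub>R f" using x0 \<open>y \<noteq> 0\<close> by (simp add: f_def)
    also have "\<dots> = ((1 / y) * - lie f b) *\<^sub>R q" by (subst fq) simp
    finally show False using off[OF v] by blast
  qed
  \<comment> \<open>Cramer's rule for \<open>(f, p) = 0\<close>, \<open>(f, q) = - 1\<close>\<close>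
  define x y where "x v = lie (\<sigma> v) p / \<Delta> v" and "y v = - lie (a v) p / \<Delta> v" for v
  define f where "f u v = x v *\<^sub>R (R u v) + y v *\<^sub>R \<sigma> v" for u v
  have f: "f u v \<in> span {\<sigma> v, R u v}" "f u v \<in> space_form p q" if uv: "u \<in> I" "v \<in> J" for u v
  proof -
    have "lie (f u v) p = x v * lie (a v) p + y v * lie (\<sigma> v) p"
      "lie (f u v) q = x v * lie (a v) q + y v * lie (\<sigma> v) q"
      by (simp_all only: f_def lie.add_left[of "x v *\<^sub>R _"] lie.scaleR_left Rpq[OF uv(1)]
          real_scaleR_def)
    moreover have "x v * lie (a v) p + y v * lie (\<sigma> v) p = 0"
      by (simp add: x_def y_def)
    moreover have "x v * lie (a v) q + y v * lie (\<sigma> v) q = -1"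
      using \<Delta>0[OF uv(2)] unfolding x_def y_def by (simp add: field_simps) (simp add: \<Delta>_def algebra_simps)
    ultimately show "f u v \<in> span {\<sigma> v, R u v}" "f u v \<in> space_form p q"
      using combination_in_space_form[OF uv f_def] by simp_all
  qed
  have coord: "lie (f u v) e = \<rho> * x v * cos (\<theta> u)" "lie (f u v) w = \<rho> * x v * sin (\<theta> u)"
    "lie (f u v) z = x v * lie (a v) z + y v * lie (\<sigma> v) z" if uv: "u \<in> I" "v \<in> J" for u v
  proof -
    have "lie (f u v) s = x v * lie (R u v) s + y v * lie (\<sigma> v) s" for s
      by (simp only: f_def lie.add_left[of "x v *\<^sub>R _"] lie.scaleR_left real_scaleR_def)
    then show "lie (f u v) e = \<rho> * x v * cos (\<theta> u)" "lie (f u v) w = \<rho> * x v * sin (\<theta> u)"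
      "lie (f u v) z = x v * lie (a v) z + y v * lie (\<sigma> v) z"
      using RX[OF uv(2)] \<sigma>e[OF uv(2)] \<theta>(2,3)[OF uv(1)] W_perp'(3)[OF \<Phi>_in_W[OF uv(1)]]
      by (simp_all add: lie.add_left)
  qed
  have "is_revolution (I \<times> J) (\<lambda>(u, v). \<chi> i. lie (f u v) (E i))"
    unfolding is_revolution_def
  proof (intro exI conjI)
    show "\<forall>(u, v)\<in>I \<times> J. regular_at \<theta> u \<and>
        (case (u, v) of (u, v) \<Rightarrow> \<chi> i. lie (f u v) (E i)) =
        0 + (\<lambda>v. \<rho> * x v) v *\<^sub>R (cos (\<theta> u) *\<^sub>R axis 1 1 + sin (\<theta> u) *\<^sub>R axis 2 1)
          + (\<lambda>v. x v * lie (a v) z + y v * lie (\<sigma> v) z) v *\<^sub>R axis 3 1"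
      using \<theta>(1) by (auto simp: vec_eq_iff forall_3 E_def coord axis_def)
  qed (auto simp: inner_axis_axis)
  then show ?thesis using net_represents_R[OF sub frame f] by blast
qed

end

section \<open>Partial derivatives\<close>

definition pu :: "(real \<times> real \<Rightarrow> 'b::real_normed_vector) \<Rightarrow> real \<times> real \<Rightarrow> 'b" where
  "pu f z = frechet_derivative f (at z) (1, 0)"

definition pv :: "(real \<times> real \<Rightarrow> 'b::real_normed_vector) \<Rightarrow> real \<times> real \<Rightarrow> 'b" where
  "pv f z = frechet_derivative f (at z) (0, 1)"

lemma smooth_on_differentiable:
  assumes "smooth_on f U" "z \<in> U"
  shows "f differentiable (at z)"
proof -
  have "Ck_on (Suc 0) f U" using assms(1) unfolding smooth_on_def by blast
  then show ?thesis using assms(2) by simp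
qed

lemma smooth_on_frechet:
  assumes "smooth_on f U" "b \<in> Basis"
  shows "smooth_on (\<lambda>x. frechet_derivative f (at x) b) U"
  unfolding smooth_on_def
proof
  fix k
  have "Ck_on (Suc k) f U" using assms(1) unfolding smooth_on_def by blast
  then show "Ck_on k (\<lambda>x. frechet_derivative f (at x) b) U" using assms(2) by simp
qed

lemma smooth_on_pu: "smooth_on f U \<Longrightarrow> smooth_on (pu f) U"
  and smooth_on_pv: "smooth_on f U \<Longrightarrow> smooth_on (pv f) U"
  using smooth_on_frechet[of f U "(1, 0)"] smooth_on_frechet[of f U "(0, 1)"]
  unfolding pu_def[abs_def] pv_def[abs_def] by (simp_all add: Basis_prod_def)

lemma smooth_on_continuous: "smooth_on f U \<Longrightarrow> continuous_on U f"
  unfolding smooth_on_def using Ck_on.simps(1) by blast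

lemma has_vector_derivative_pu:
  assumes "f differentiable (at (u, v))"
  shows "((\<lambda>x. f (x, v)) has_vector_derivative pu f (u, v)) (at u)"
proof -
  have "(f has_derivative frechet_derivative f (at (u, v))) (at (u, v))"
    using assms by (simp add: frechet_derivative_works)
  moreover have "((\<lambda>x. (x, v)) has_derivative (\<lambda>h. (h, 0))) (at u)"
    by (auto intro!: derivative_eq_intros)
  ultimately have "((\<lambda>x. f (x, v)) has_derivative (\<lambda>h. frechet_derivative f (at (u, v)) (h, 0))) (at u)"
    using has_derivative_compose by fastforce
  moreover have "frechet_derivative f (at (u, v)) (h, 0) = h *\<^sub>R pu f (u, v)" for h
    using linear_cmul[OF linear_frechet_derivative[OF assms], of h "(1, 0)"] by (simp add: pu_def)
  ultimately show ?thesis by (simp add: has_vector_derivative_def)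
qed

lemma has_vector_derivative_pv:
  assumes "f differentiable (at (u, v))"
  shows "((\<lambda>y. f (u, y)) has_vector_derivative pv f (u, v)) (at v)"
proof -
  have "(f has_derivative frechet_derivative f (at (u, v))) (at (u, v))"
    using assms by (simp add: frechet_derivative_works)
  moreover have "((\<lambda>y. (u, y)) has_derivative (\<lambda>h. (0, h))) (at v)"
    by (auto intro!: derivative_eq_intros)
  ultimately have "((\<lambda>y. f (u, y)) has_derivative (\<lambda>h. frechet_derivative f (at (u, v)) (0, h))) (at v)"
    using has_derivative_compose by fastforce
  moreover have "frechet_derivative f (at (u, v)) (0, h) = h *\<^sub>R pv f (u, v)" for h
    using linear_cmul[OF linear_frechet_derivative[OF assms], of h "(0, 1)"] by (simp add: pv_def)
  ultimately show ?thesis by (simp add: has_vector_derivative_def)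
qed

lemma second_difference_mvt:
  fixes F Fx Fxy :: "real \<Rightarrow> real \<Rightarrow> real"
  assumes h: "h > 0"
    and Fx: "\<And>x y. x \<in> {u..u+h} \<Longrightarrow> y \<in> {v..v+h} \<Longrightarrow> ((\<lambda>x. F x y) has_real_derivative Fx x y) (at x)"
    and Fxy: "\<And>x y. x \<in> {u..u+h} \<Longrightarrow> y \<in> {v..v+h} \<Longrightarrow> ((\<lambda>y. Fx x y) has_real_derivative Fxy x y) (at y)"
  obtains x y where "x \<in> {u..u+h}" "y \<in> {v..v+h}"
    "F (u+h) (v+h) - F u (v+h) - F (u+h) v + F u v = h * h * Fxy x y"
proof -
  have "\<exists>x. u < x \<and> x < u + h \<and>
      (F (u+h) (v+h) - F (u+h) v) - (F u (v+h) - F u v) = (u + h - u) * (Fx x (v+h) - Fx x v)"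
    using h by (intro MVT2) (auto intro!: derivative_intros Fx)
  then obtain x where x: "u < x" "x < u + h"
    "(F (u+h) (v+h) - F (u+h) v) - (F u (v+h) - F u v) = h * (Fx x (v+h) - Fx x v)" by auto
  have "\<exists>y. v < y \<and> y < v + h \<and> Fx x (v+h) - Fx x v = (v + h - v) * Fxy x y"
    using h x by (intro MVT2) (auto intro!: Fxy)
  then obtain y where y: "v < y" "y < v + h" "Fx x (v+h) - Fx x v = h * Fxy x y" by auto
  then show ?thesis using x that[of x y] by (simp add: algebra_simps)
qed

text \<open>The second difference of \<open>F\<close> over a small square is, up to the area, a value of either mixed
  derivative at some point of the square.\<close>

lemma mixed_partials_real:
  fixes F Fx Fy Fxy Fyx :: "real \<times> real \<Rightarrow> real"
  assumes U: "open U" "(u, v) \<in> U"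
    and d: "\<And>x y. (x, y) \<in> U \<Longrightarrow> ((\<lambda>x. F (x, y)) has_real_derivative Fx (x, y)) (at x)"
      "\<And>x y. (x, y) \<in> U \<Longrightarrow> ((\<lambda>y. F (x, y)) has_real_derivative Fy (x, y)) (at y)"
      "\<And>x y. (x, y) \<in> U \<Longrightarrow> ((\<lambda>y. Fx (x, y)) has_real_derivative Fxy (x, y)) (at y)"
      "\<And>x y. (x, y) \<in> U \<Longrightarrow> ((\<lambda>x. Fy (x, y)) has_real_derivative Fyx (x, y)) (at x)"
    and cont: "continuous_on U Fxy" "continuous_on U Fyx"
  shows "Fxy (u, v) = Fyx (u, v)"
proof (rule ccontr)
  assume ne: "Fxy (u, v) \<noteq> Fyx (u, v)"
  define \<epsilon> where "\<epsilon> = \<bar>Fxy (u, v) - Fyx (u, v)\<bar> / 2"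
  have \<epsilon>: "\<epsilon> > 0" using ne by (simp add: \<epsilon>_def)
  have "isCont Fxy (u, v)" "isCont Fyx (u, v)"
    using cont U by (simp_all add: continuous_on_eq_continuous_at)
  then obtain d1 d2 where d12: "d1 > 0" "d2 > 0"
    "\<And>z. dist z (u, v) < d1 \<Longrightarrow> \<bar>Fxy z - Fxy (u, v)\<bar> < \<epsilon>"
    "\<And>z. dist z (u, v) < d2 \<Longrightarrow> \<bar>Fyx z - Fyx (u, v)\<bar> < \<epsilon>"
    using \<epsilon> unfolding continuous_at_eps_delta dist_real_def by metis
  obtain d3 where d3: "d3 > 0" "\<And>z. dist z (u, v) < d3 \<Longrightarrow> z \<in> U"
    using U unfolding open_dist by blast
  define h where "h = min d1 (min d2 d3) / 3"
  have h: "h > 0" using d12 d3 by (simp add: h_def)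
  have near: "dist (x, y) (u, v) < min d1 (min d2 d3)" if "x \<in> {u..u+h}" "y \<in> {v..v+h}" for x y
  proof -
    have "dist (x, y) (u, v) \<le> \<bar>x - u\<bar> + \<bar>y - v\<bar>"
      by (simp add: dist_Pair_Pair dist_real_def sqrt_sum_squares_le_sum_abs)
    also have "\<dots> \<le> 2 * h" using that by auto
    also have "\<dots> < 3 * h" using h by simp
    finally show ?thesis by (simp add: h_def)
  qed
  have inU: "(x, y) \<in> U" if "x \<in> {u..u+h}" "y \<in> {v..v+h}" for x y
    using near[OF that] d3 by simp
  obtain x y where xy: "x \<in> {u..u+h}" "y \<in> {v..v+h}"
    "F (u+h, v+h) - F (u, v+h) - F (u+h, v) + F (u, v) = h * h * Fxy (x, y)"
    using second_difference_mvt[of h u v "\<lambda>x y. F (x, y)" "\<lambda>x y. Fx (x, y)" "\<lambda>x y. Fxy (x, y)"]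
      h d(1,3)[OF inU] by blast
  obtain y' x' where xy': "y' \<in> {v..v+h}" "x' \<in> {u..u+h}"
    "F (u+h, v+h) - F (u+h, v) - F (u, v+h) + F (u, v) = h * h * Fyx (x', y')"
    using second_difference_mvt[of h v u "\<lambda>y x. F (x, y)" "\<lambda>y x. Fy (x, y)" "\<lambda>y x. Fyx (x, y)"]
      h d(2,4)[OF inU] by blast
  have "h * h * Fxy (x, y) = h * h * Fyx (x', y')" using xy(3) xy'(3) by linarith
  then have eq: "Fxy (x, y) = Fyx (x', y')" using h by simp
  have "\<bar>Fxy (x, y) - Fxy (u, v)\<bar> < \<epsilon>" "\<bar>Fyx (x', y') - Fyx (u, v)\<bar> < \<epsilon>"
    using near[OF xy(1,2)] near[OF xy'(2,1)] d12(3,4) by auto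
  then have "\<bar>Fxy (u, v) - Fyx (u, v)\<bar> < 2 * \<epsilon>" using eq by simp
  then show False by (simp add: \<epsilon>_def)
qed

lemma mixed_partials:
  fixes f :: "real \<times> real \<Rightarrow> 'b::real_inner"
  assumes f: "smooth_on f U" and U: "open U" "z \<in> U"
  shows "pu (pv f) z = pv (pu f) z"
proof -
  obtain u v where z: "z = (u, v)" by (cases z)
  have inner: "((\<lambda>t. g t \<bullet> w) has_real_derivative g' \<bullet> w) F" if "(g has_vector_derivative g') F"
    for g :: "real \<Rightarrow> 'b" and g' w F
    unfolding has_real_derivative_iff_has_vector_derivative
    using bounded_linear.has_vector_derivative[OF bounded_linear_inner_left that] .
  note sm = smooth_on_pu[OF f] smooth_on_pv[OF f]
  note D = has_vector_derivative_pu[OF smooth_on_differentiable] has_vector_derivative_pv[OF smooth_on_differentiable]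
  have "pv (pu f) (u, v) \<bullet> w = pu (pv f) (u, v) \<bullet> w" for w
  proof (rule mixed_partials_real[OF U[unfolded z], of "\<lambda>z. f z \<bullet> w" "\<lambda>z. pu f z \<bullet> w" "\<lambda>z. pv f z \<bullet> w"
        "\<lambda>z. pv (pu f) z \<bullet> w" "\<lambda>z. pu (pv f) z \<bullet> w"])
    show "continuous_on U (\<lambda>z. pv (pu f) z \<bullet> w)" "continuous_on U (\<lambda>z. pu (pv f) z \<bullet> w)"
      by (intro continuous_intros smooth_on_continuous smooth_on_pu smooth_on_pv f)+
  qed (intro inner D[OF f] D[OF sm(1)] D[OF sm(2)], assumption)+
  then have "(pv (pu f) z - pu (pv f) z) \<bullet> (pv (pu f) z - pu (pv f) z) = 0"
    unfolding z inner_diff_left by (metis right_minus_eq)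
  then show ?thesis by simp
qed

section \<open>Pairs of Moutard lifts on a channel surface\<close>

text \<open>Moutard lifts may be complex, but they are only paired with real vectors, so the form need be
  complex linear in its first argument only.\<close>

definition lieC :: "complex^6 \<Rightarrow> real^6 \<Rightarrow> complex" where
  "lieC x y = - x$1 * y$1 + x$2 * y$2 + x$3 * y$3 + x$4 * y$4 + x$5 * y$5 - x$6 * y$6"

interpretation lieC: bounded_bilinear lieC
proof -
  have "bilinear lieC"
    unfolding bilinear_def
    by (auto intro!: linearI simp: lieC_def algebra_simps scaleR_conv_of_real[where 'a = complex])
  then show "bounded_bilinear lieC" by (simp add: bilinear_conv_bounded_bilinear)
qed

lemma lieC_scale: "lieC (k *s x) y = k * lieC x y"
  by (simp add: lieC_def algebra_simps)

lemma lieC_cplx: "lieC (cplx x) y = of_real (lie x y)"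
  by (simp add: lieC_def cplx_def lie_def)

lemma lieC_cnjv: "lieC (cnjv x) y = cnj (lieC x y)"
  by (simp add: lieC_def cnjv_def)

lemma lie_Re_lieC: "lie (\<chi> i. Re (x$i)) y = Re (lieC x y)"
  and lie_Im_lieC: "lie (\<chi> i. Im (x$i)) y = Im (lieC x y)"
  by (simp_all add: lieC_def lie_def)

lemma has_vector_derivative_vector_scalar_mult:
  fixes f :: "real \<Rightarrow> complex^6"
  assumes "(f has_vector_derivative f') F"
  shows "((\<lambda>x. c *s f x) has_vector_derivative c *s f') F"
proof -
  have "linear ((*s) c :: complex^6 \<Rightarrow> complex^6)"
    by (rule linearI) (simp_all add: vec_eq_iff algebra_simps)
  then show ?thesis
    using assms by (simp add: linear_conv_bounded_linear bounded_linear.has_vector_derivative)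
qed

text \<open>The first curvature sphere congruence has the lift \<open>\<sigma>(v)\<close> with derivatives \<open>\<sigma>1\<close>, \<open>\<sigma>2\<close>, the second
  one the lift \<open>S(u, v)\<close>. The orthogonality of \<open>S\<close> to \<open>\<sigma>2\<close> encodes that \<open>S\<^sub>v\<close> lies in \<open>\<Lambda>\<close>.\<close>

locale moutard_pair =
  fixes I J :: "real set" and \<sigma> \<sigma>1 \<sigma>2 :: "real \<Rightarrow> real^6" and S :: "real \<times> real \<Rightarrow> real^6"
    and Sp Sm :: "real \<times> real \<Rightarrow> complex^6" and \<alpha> \<beta> \<gamma> k l :: "real \<times> real \<Rightarrow> complex"
  assumes I: "open I" "connected I" "I \<noteq> {}" and J: "open J" "connected J" "J \<noteq> {}"
    and d\<sigma>: "v \<in> J \<Longrightarrow> (\<sigma> has_vector_derivative \<sigma>1 v) (at v)"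
      "v \<in> J \<Longrightarrow> (\<sigma>1 has_vector_derivative \<sigma>2 v) (at v)"
    and \<sigma>: "v \<in> J \<Longrightarrow> lie (\<sigma> v) (\<sigma> v) = 0" "v \<in> J \<Longrightarrow> lie (\<sigma> v) (\<sigma>1 v) = 0"
      "v \<in> J \<Longrightarrow> lie (\<sigma>1 v) (\<sigma>1 v) > 0" "v \<in> J \<Longrightarrow> lie (\<sigma> v) (\<sigma>2 v) = - lie (\<sigma>1 v) (\<sigma>1 v)"
    and S_smooth: "smooth_on S (I \<times> J)"
    and S_null: "u \<in> I \<Longrightarrow> v \<in> J \<Longrightarrow> lie (S (u, v)) (S (u, v)) = 0"
    and S_u: "u \<in> I \<Longrightarrow> v \<in> J \<Longrightarrow> lie (pu S (u, v)) (pu S (u, v)) > 0"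
    and S_perp: "u \<in> I \<Longrightarrow> v \<in> J \<Longrightarrow> lie (S (u, v)) (\<sigma> v) = 0"
      "u \<in> I \<Longrightarrow> v \<in> J \<Longrightarrow> lie (S (u, v)) (\<sigma>1 v) = 0"
      "u \<in> I \<Longrightarrow> v \<in> J \<Longrightarrow> lie (S (u, v)) (\<sigma>2 v) = 0"
    and Sp_smooth: "smooth_on Sp (I \<times> J)" and Sm_smooth: "smooth_on Sm (I \<times> J)"
    and Sp_uv: "u \<in> I \<Longrightarrow> v \<in> J \<Longrightarrow> pv (pu Sp) (u, v) = k (u, v) *s Sp (u, v)"
    and Sm_uv: "u \<in> I \<Longrightarrow> v \<in> J \<Longrightarrow> pv (pu Sm) (u, v) = l (u, v) *s Sm (u, v)"
    and Sp: "u \<in> I \<Longrightarrow> v \<in> J \<Longrightarrow> Sp (u, v) = \<alpha> (u, v) *s cplx (\<sigma> v) + \<beta> (u, v) *s cplx (S (u, v))"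
    and Sm: "u \<in> I \<Longrightarrow> v \<in> J \<Longrightarrow>
        Sm (u, v) = \<gamma> (u, v) *s (\<alpha> (u, v) *s cplx (\<sigma> v) - \<beta> (u, v) *s cplx (S (u, v)))"
    and nz: "u \<in> I \<Longrightarrow> v \<in> J \<Longrightarrow> \<alpha> (u, v) \<noteq> 0" "u \<in> I \<Longrightarrow> v \<in> J \<Longrightarrow> \<beta> (u, v) \<noteq> 0"
      "u \<in> I \<Longrightarrow> v \<in> J \<Longrightarrow> \<gamma> (u, v) \<noteq> 0"
    and real: "(\<forall>z\<in>I \<times> J. cnjv (Sp z) = Sp z) \<or> (\<forall>z\<in>I \<times> J. Sm z = cnjv (Sp z))"
begin

lemma D_u: "smooth_on F (I \<times> J) \<Longrightarrow> u \<in> I \<Longrightarrow> v \<in> J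
    \<Longrightarrow> ((\<lambda>x. F (x, v)) has_vector_derivative pu F (u, v)) (at u)"
  by (intro has_vector_derivative_pu smooth_on_differentiable) auto

lemma D_v: "smooth_on F (I \<times> J) \<Longrightarrow> u \<in> I \<Longrightarrow> v \<in> J
    \<Longrightarrow> ((\<lambda>y. F (u, y)) has_vector_derivative pv F (u, v)) (at v)"
  by (intro has_vector_derivative_pv smooth_on_differentiable) auto

lemma Su_perp:
  assumes uv: "u \<in> I" "v \<in> J"
  shows "lie (pu S (u, v)) (\<sigma> v) = 0"
    "lie (pu S (u, v)) (S (u, v)) = 0"
    "lie (pu (pu S) (u, v)) (\<sigma> v) = 0"
    "lie (S (u, v)) (pu (pu S) (u, v)) = - lie (pu S (u, v)) (pu S (u, v))"
proof -
  have *: "lie (pu S (u, v)) (\<sigma> v) = 0" if "u \<in> I" for u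
    by (rule has_vector_derivative_const_on_open[OF bounded_linear.has_vector_derivative[OF
            lie.bounded_linear_left D_u[OF S_smooth that uv(2)]] I(1) that])
      (use S_perp uv(2) in blast)
  from *[OF uv(1)] show "lie (pu S (u, v)) (\<sigma> v) = 0" .
  have **: "lie (pu S (u, v)) (S (u, v)) = 0" if u: "u \<in> I" for u
  proof -
    have "lie (S (u, v)) (pu S (u, v)) + lie (pu S (u, v)) (S (u, v)) = 0"
      by (rule has_vector_derivative_const_on_open[OF lie.has_vector_derivative[OF
              D_u[OF S_smooth u uv(2)] D_u[OF S_smooth u uv(2)]] I(1) u])
        (use S_null uv(2) in blast)
    then show ?thesis by (simp add: lie_commute[of "S (u, v)"])
  qed
  from **[OF uv(1)] show "lie (pu S (u, v)) (S (u, v)) = 0" .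
  show "lie (pu (pu S) (u, v)) (\<sigma> v) = 0"
    by (rule has_vector_derivative_const_on_open[OF bounded_linear.has_vector_derivative[OF
            lie.bounded_linear_left D_u[OF smooth_on_pu[OF S_smooth] uv]] I(1) uv(1)])
      (use * in blast)
  have "lie (pu S (u, v)) (pu S (u, v)) + lie (pu (pu S) (u, v)) (S (u, v)) = 0"
    by (rule has_vector_derivative_const_on_open[OF lie.has_vector_derivative[OF
            D_u[OF smooth_on_pu[OF S_smooth] uv] D_u[OF S_smooth uv]] I(1) uv(1)])
      (use ** in blast)
  then show "lie (S (u, v)) (pu (pu S) (u, v)) = - lie (pu S (u, v)) (pu S (u, v))"
    by (simp add: lie_commute[of "S (u, v)"])
qed

definition moutard_combination :: "(real \<times> real \<Rightarrow> complex^6) \<Rightarrow> (real \<times> real \<Rightarrow> complex)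
    \<Rightarrow> (real \<times> real \<Rightarrow> complex) \<Rightarrow> (real \<times> real \<Rightarrow> complex) \<Rightarrow> bool" where
  "moutard_combination F m x y \<longleftrightarrow> smooth_on F (I \<times> J) \<and>
     (\<forall>u\<in>I. \<forall>v\<in>J. pv (pu F) (u, v) = m (u, v) *s F (u, v) \<and>
        F (u, v) = x (u, v) *s cplx (\<sigma> v) + y (u, v) *s cplx (S (u, v)))"

text \<open>The relation \<open>(F, \<sigma>') = 0\<close> yields \<open>(F\<^sub>u, \<sigma>') = 0\<close>. As \<open>F\<^sub>u\<^sub>v\<close> is a multiple of \<open>F\<close>, differentiating
  in \<open>v\<close> yields \<open>(F\<^sub>u, \<sigma>'') = 0\<close>. Hence \<open>(F, \<sigma>'') = - x (\<sigma>', \<sigma>')\<close> does not depend on \<open>u\<close>, and neither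
  does \<open>x\<close>.\<close>

lemma moutard_lift_pairings:
  assumes comb: "moutard_combination F m x y"
    and uv: "u \<in> I" "v \<in> J"
  shows "u' \<in> I \<Longrightarrow> x (u, v) = x (u', v)"
    and "lieC (pu F (u, v)) (\<sigma> v) = 0" "lieC (pu F (u, v)) (S (u, v)) = 0"
    and "lieC (pu F (u, v)) (pu S (u, v)) = y (u, v) * lie (pu S (u, v)) (pu S (u, v))"
    and "lieC (F (u, v)) (\<sigma>2 v) = - x (u, v) * lie (\<sigma>1 v) (\<sigma>1 v)"
    and "lieC (F (u, v)) (pu S (u, v)) = 0"
    and "lieC (F (u, v)) (pu (pu S) (u, v)) = - y (u, v) * lie (pu S (u, v)) (pu S (u, v))"
proof -
  have F: "smooth_on F (I \<times> J)"
    and Fuv: "\<And>u v. u \<in> I \<Longrightarrow> v \<in> J \<Longrightarrow> pv (pu F) (u, v) = m (u, v) *s F (u, v)"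
    and F_eq: "\<And>u v. u \<in> I \<Longrightarrow> v \<in> J \<Longrightarrow>
        F (u, v) = x (u, v) *s cplx (\<sigma> v) + y (u, v) *s cplx (S (u, v))"
    using comb by (auto simp: moutard_combination_def)
  have pair: "lieC (F (u, v)) w = x (u, v) * lie (\<sigma> v) w + y (u, v) * lie (S (u, v)) w"
    if "u \<in> I" "v \<in> J" for u v w
    by (simp add: F_eq[OF that] lieC.add_left lieC_scale lieC_cplx)
  have F0: "lieC (F (u, v)) (\<sigma> v) = 0" "lieC (F (u, v)) (\<sigma>1 v) = 0"
    "lieC (F (u, v)) (\<sigma>2 v) = - x (u, v) * lie (\<sigma>1 v) (\<sigma>1 v)" "lieC (F (u, v)) (S (u, v)) = 0"
    "lieC (F (u, v)) (pu S (u, v)) = 0"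
    "lieC (F (u, v)) (pu (pu S) (u, v)) = - y (u, v) * lie (pu S (u, v)) (pu S (u, v))"
    if "u \<in> I" "v \<in> J" for u v
    using \<sigma>[OF that(2)] S_perp[OF that] S_null[OF that] Su_perp[OF that]
    by (simp_all add: pair[OF that] lie_commute[of "\<sigma> v" "S (u, v)"] lie_commute[of "\<sigma> v" "pu S (u, v)"]
        lie_commute[of "\<sigma> v" "pu (pu S) (u, v)"] lie_commute[of "S (u, v)" "pu S (u, v)"])
  from F0[OF uv] show "lieC (F (u, v)) (\<sigma>2 v) = - x (u, v) * lie (\<sigma>1 v) (\<sigma>1 v)"
    "lieC (F (u, v)) (pu S (u, v)) = 0"
    "lieC (F (u, v)) (pu (pu S) (u, v)) = - y (u, v) * lie (pu S (u, v)) (pu S (u, v))" by blast+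
  have dF: "((\<lambda>x. lieC (F (x, v)) w) has_vector_derivative lieC (pu F (u, v)) w) (at u)"
    if "u \<in> I" "v \<in> J" for u v w
    using bounded_linear.has_vector_derivative[OF lieC.bounded_linear_left D_u[OF F that]] .
  have Fu0: "lieC (pu F (u, v)) (\<sigma> v) = 0" "lieC (pu F (u, v)) (\<sigma>1 v) = 0" if "u \<in> I" "v \<in> J" for u v
    by (rule has_vector_derivative_const_on_open[OF dF[OF that] I(1) that(1)]; simp add: F0 that)+
  from Fu0(1)[OF uv] show "lieC (pu F (u, v)) (\<sigma> v) = 0" .
  have Fu2: "lieC (pu F (u, v)) (\<sigma>2 v) = 0" if uv: "u \<in> I" "v \<in> J" for u v
  proof -
    have "lieC (pu F (u, v)) (\<sigma>2 v) + lieC (pv (pu F) (u, v)) (\<sigma>1 v) = 0"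
      by (rule has_vector_derivative_const_on_open[OF lieC.has_vector_derivative[OF
              D_v[OF smooth_on_pu[OF F] uv] d\<sigma>(2)[OF uv(2)]] J(1) uv(2)])
        (simp add: Fu0 uv)
    then show ?thesis using F0(2)[OF uv] by (simp add: Fuv[OF uv] lieC_scale)
  qed
  show "x (u, v) = x (u', v)" if "u' \<in> I"
  proof -
    have "lieC (F (u, v)) (\<sigma>2 v) = lieC (F (u', v)) (\<sigma>2 v)"
      by (rule constant_on_if_zero_derivative[OF I(2) _ uv(1) that])
        (use dF[OF _ uv(2), of _ "\<sigma>2 v"] Fu2 uv(2) in force)
    then show ?thesis using F0(3) uv that \<sigma>(3)[OF uv(2)] by simp
  qed
  have "lieC (F (u, v)) (pu S (u, v)) + lieC (pu F (u, v)) (S (u, v)) = 0"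
    by (rule has_vector_derivative_const_on_open[OF lieC.has_vector_derivative[OF
            D_u[OF F uv] D_u[OF S_smooth uv]] I(1) uv(1)])
      (simp add: F0 uv)
  then show "lieC (pu F (u, v)) (S (u, v)) = 0" using F0(5)[OF uv] by simp
  have "lieC (F (u, v)) (pu (pu S) (u, v)) + lieC (pu F (u, v)) (pu S (u, v)) = 0"
    by (rule has_vector_derivative_const_on_open[OF lieC.has_vector_derivative[OF
            D_u[OF F uv] D_u[OF smooth_on_pu[OF S_smooth] uv]] I(1) uv(1)])
      (simp add: F0 uv)
  then show "lieC (pu F (u, v)) (pu S (u, v)) = y (u, v) * lie (pu S (u, v)) (pu S (u, v))"
    using F0(6)[OF uv] by simp
qed

lemma Sp_moutard_combination: "moutard_combination Sp k \<alpha> \<beta>"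
  using Sp_smooth Sp_uv Sp by (simp add: moutard_combination_def)

lemma Sm_moutard_combination: "moutard_combination Sm l (\<lambda>z. \<gamma> z * \<alpha> z) (\<lambda>z. - \<gamma> z * \<beta> z)"
  using Sm_smooth Sm_uv by (simp add: moutard_combination_def) (simp add: Sm vec_eq_iff algebra_simps)

lemmas Sp_pairings = moutard_lift_pairings[OF Sp_moutard_combination]
lemmas Sm_pairings = moutard_lift_pairings[OF Sm_moutard_combination]

lemma \<gamma>_constant_u:
  assumes "u \<in> I" "u' \<in> I" "v \<in> J"
  shows "\<gamma> (u, v) = \<gamma> (u', v)"
  using Sm_pairings(1)[OF assms(1,3,2)] Sp_pairings(1)[OF assms(1,3,2)] nz(1)[OF assms(1,3)] by auto

text \<open>The \<open>S\<close>-components cancel in \<open>Sm + \<gamma> Sp\<close>, and the \<open>\<sigma>\<close>-component depends on \<open>v\<close> only.\<close>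

lemma Sm_u:
  assumes uv: "u \<in> I" "v \<in> J"
  shows "pu Sm (u, v) + \<gamma> (u, v) *s pu Sp (u, v) = 0"
proof (rule has_vector_derivative_const_on_open[OF _ I(1) uv(1)])
  show "((\<lambda>x. Sm (x, v) + \<gamma> (u, v) *s Sp (x, v)) has_vector_derivative
      pu Sm (u, v) + \<gamma> (u, v) *s pu Sp (u, v)) (at u)"
    by (intro has_vector_derivative_add has_vector_derivative_vector_scalar_mult D_u Sm_smooth Sp_smooth uv)
  fix x assume x: "x \<in> I"
  have "Sm (x, v) + \<gamma> (u, v) *s Sp (x, v) = (2 * \<gamma> (x, v) * \<alpha> (x, v)) *s cplx (\<sigma> v)"
    unfolding \<gamma>_constant_u[OF uv(1) x uv(2)]
    by (simp add: Sm[OF x uv(2)] Sp[OF x uv(2)] vec_eq_iff algebra_simps)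
  then show "Sm (x, v) + \<gamma> (u, v) *s Sp (x, v) = (2 * \<gamma> (u, v) * \<alpha> (u, v)) *s cplx (\<sigma> v)"
    using \<gamma>_constant_u[OF uv(1) x uv(2)] Sp_pairings(1)[OF uv x] by simp
qed

text \<open>By the previous lemma \<open>- \<gamma>\<close> is the quotient of \<open>(Sm\<^sub>u, S\<^sub>u)\<close> and \<open>(Sp\<^sub>u, S\<^sub>u)\<close>. In the derivatives of these
  pairings the terms with \<open>Sm\<^sub>u\<^sub>v\<close> and \<open>Sp\<^sub>u\<^sub>v\<close> vanish, because \<open>Sm\<close> and \<open>Sp\<close> are orthogonal to \<open>S\<^sub>u\<close>; the
  remaining terms cancel in the quotient rule.\<close>

lemma \<gamma>_constant:
  assumes "u \<in> I" "v \<in> J" "u' \<in> I" "v' \<in> J"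
  shows "\<gamma> (u, v) = \<gamma> (u', v')"
proof -
  define N M where "N y = lieC (pu Sm (u, y)) (pu S (u, y))" and "M y = lieC (pu Sp (u, y)) (pu S (u, y))" for y
  have M0: "M y \<noteq> 0" if y: "y \<in> J" for y
    using Sp_pairings(4)[OF assms(1) y] nz(2)[OF assms(1) y] S_u[OF assms(1) y] by (simp add: M_def)
  have Sm_eq: "pu Sm (u, y) = (- \<gamma> (u, y)) *s pu Sp (u, y)" if "y \<in> J" for y
    using Sm_u[OF assms(1) that] by (simp add: vec_eq_iff add_eq_0_iff)
  have NM: "N y = - \<gamma> (u, y) * M y" if "y \<in> J" for y
    by (simp only: N_def M_def Sm_eq[OF that] lieC_scale)
  have "((\<lambda>y. N y / M y) has_vector_derivative 0) (at y)" if y: "y \<in> J" for y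
  proof -
    let ?T = "lieC (pu Sp (u, y)) (pv (pu S) (u, y))"
    have "(M has_vector_derivative ?T + lieC (pv (pu Sp) (u, y)) (pu S (u, y))) (at y)"
      unfolding M_def[abs_def]
      by (intro lieC.has_vector_derivative D_v smooth_on_pu Sp_smooth S_smooth assms y)
    then have dM: "(M has_vector_derivative ?T) (at y)"
      using Sp_pairings(6)[OF assms(1) y] by (simp add: Sp_uv[OF assms(1) y] lieC_scale)
    have "(N has_vector_derivative lieC (pu Sm (u, y)) (pv (pu S) (u, y))
        + lieC (pv (pu Sm) (u, y)) (pu S (u, y))) (at y)"
      unfolding N_def[abs_def]
      by (intro lieC.has_vector_derivative D_v smooth_on_pu Sm_smooth S_smooth assms y)
    moreover have "lieC (pu Sm (u, y)) (pv (pu S) (u, y)) = - \<gamma> (u, y) * ?T"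
      by (simp only: Sm_eq[OF y] lieC_scale)
    ultimately have dN: "(N has_vector_derivative - \<gamma> (u, y) * ?T) (at y)"
      using Sm_pairings(6)[OF assms(1) y]
      by (simp add: Sm_uv[OF assms(1) y] lieC_scale)
    have "((\<lambda>y. N y / M y) has_derivative
        (\<lambda>h. ((h *\<^sub>R (- \<gamma> (u, y) * ?T)) * M y - N y * (h *\<^sub>R ?T)) / (M y * M y))) (at y)"
      using has_derivative_divide'[OF dN[unfolded has_vector_derivative_def]
          dM[unfolded has_vector_derivative_def] M0[OF y]] .
    then show ?thesis
      unfolding has_vector_derivative_def
      by (rule has_derivative_eq_rhs) (simp add: NM[OF y] fun_eq_iff scaleR_conv_of_real)
  qed
  then have "N v / M v = N v' / M v'"
    by (rule constant_on_if_zero_derivative[OF J(2) _ assms(2,4)])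
  then have "\<gamma> (u, v) = \<gamma> (u, v')"
    using NM[OF assms(2)] NM[OF assms(4)] M0[OF assms(2)] M0[OF assms(4)] by simp
  also have "\<dots> = \<gamma> (u', v')" using \<gamma>_constant_u[OF assms(1,3,4)] .
  finally show ?thesis .
qed

text \<open>Since \<open>\<gamma>\<close> is constant, differentiating \<open>Sm\<^sub>u + \<gamma> Sp\<^sub>u = 0\<close> gives \<open>l Sm + \<gamma> k Sp = 0\<close>. The components
  along \<open>\<sigma>\<close> and \<open>S\<close> of this equation say \<open>l = - k\<close> and \<open>l = k\<close>.\<close>

lemma Sp_uv_zero:
  assumes uv: "u \<in> I" "v \<in> J"
  shows "pv (pu Sp) (u, v) = 0"
proof -
  have "pv (pu Sm) (u, v) + \<gamma> (u, v) *s pv (pu Sp) (u, v) = 0"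
  proof (rule has_vector_derivative_const_on_open[OF _ J(1) uv(2)])
    show "((\<lambda>y. pu Sm (u, y) + \<gamma> (u, v) *s pu Sp (u, y)) has_vector_derivative
      pv (pu Sm) (u, v) + \<gamma> (u, v) *s pv (pu Sp) (u, v)) (at v)"
      by (intro has_vector_derivative_add has_vector_derivative_vector_scalar_mult D_v
          smooth_on_pu Sm_smooth Sp_smooth uv)
    show "pu Sm (u, y) + \<gamma> (u, v) *s pu Sp (u, y) = 0" if "y \<in> J" for y
      using Sm_u[OF uv(1) that] \<gamma>_constant[OF uv uv(1) that] by simp
  qed
  then have eq: "l (u, v) *s Sm (u, v) + (\<gamma> (u, v) * k (u, v)) *s Sp (u, v) = 0"
    by (simp add: Sp_uv[OF uv] Sm_uv[OF uv] vector_smult_assoc)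
  have pair: "l (u, v) * lieC (Sm (u, v)) w + \<gamma> (u, v) * k (u, v) * lieC (Sp (u, v)) w = 0" for w
    using arg_cong[OF eq, of "\<lambda>x. lieC x w"] by (simp add: lieC.add_left lieC_scale lieC.zero_left)
  have "(l (u, v) + k (u, v)) * (\<gamma> (u, v) * \<alpha> (u, v) * lie (\<sigma>1 v) (\<sigma>1 v))
      = - (l (u, v) * lieC (Sm (u, v)) (\<sigma>2 v) + \<gamma> (u, v) * k (u, v) * lieC (Sp (u, v)) (\<sigma>2 v))"
    by (simp add: Sp_pairings(5)[OF uv] Sm_pairings(5)[OF uv] algebra_simps)
  also have "\<dots> = 0" by (simp only: pair neg_0_equal_iff_equal minus_zero)
  finally have 1: "l (u, v) + k (u, v) = 0" using nz[OF uv] \<sigma>(3)[OF uv(2)] by simp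
  have "(l (u, v) - k (u, v)) * (\<gamma> (u, v) * \<beta> (u, v) * lie (pu S (u, v)) (pu S (u, v)))
      = l (u, v) * lieC (Sm (u, v)) (pu (pu S) (u, v)) + \<gamma> (u, v) * k (u, v) * lieC (Sp (u, v)) (pu (pu S) (u, v))"
    by (simp add: Sp_pairings(7)[OF uv] Sm_pairings(7)[OF uv] algebra_simps)
  also have "\<dots> = 0" by (rule pair)
  finally have 2: "l (u, v) - k (u, v) = 0" using nz[OF uv] S_u[OF uv] by simp
  from 1 2 have "k (u, v) = 0" by (simp add: eq_neg_iff_add_eq_0)
  then show ?thesis by (simp add: Sp_uv[OF uv])
qed

text \<open>For a complex conjugate pair, the conjugate of \<open>\<beta>\<close> is \<open>- \<gamma> \<beta>\<close> with \<open>\<gamma>\<close> constant: \<open>\<beta>\<close> is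
  imaginary everywhere if \<open>\<gamma> = 1\<close> and nowhere otherwise.\<close>

lemma \<beta>_Re_or_Im:
  "(\<forall>u\<in>I. \<forall>v\<in>J. Re (\<beta> (u, v)) \<noteq> 0) \<or> (\<forall>u\<in>I. \<forall>v\<in>J. Im (\<beta> (u, v)) \<noteq> 0)"
  using real
proof
  assume r: "\<forall>z\<in>I \<times> J. cnjv (Sp z) = Sp z"
  have "Re (\<beta> (u, v)) \<noteq> 0" if uv: "u \<in> I" "v \<in> J" for u v
  proof -
    have "cnj (lieC (Sp (u, v)) (pu (pu S) (u, v))) = lieC (Sp (u, v)) (pu (pu S) (u, v))"
      using r uv by (simp flip: lieC_cnjv)
    then have "cnj (\<beta> (u, v)) = \<beta> (u, v)" using S_u[OF uv] by (simp add: Sp_pairings(7)[OF uv])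
    then show ?thesis using nz(2)[OF uv] by (auto simp: complex_eq_iff)
  qed
  then show ?thesis by blast
next
  assume r: "\<forall>z\<in>I \<times> J. Sm z = cnjv (Sp z)"
  have conj: "cnj (\<beta> (u, v)) = - \<gamma> (u, v) * \<beta> (u, v)" if uv: "u \<in> I" "v \<in> J" for u v
  proof -
    have "cnj (lieC (Sp (u, v)) (pu (pu S) (u, v))) = lieC (Sm (u, v)) (pu (pu S) (u, v))"
      using r uv by (simp add: lieC_cnjv)
    then have "cnj (\<beta> (u, v)) * lie (pu S (u, v)) (pu S (u, v))
        = - \<gamma> (u, v) * \<beta> (u, v) * lie (pu S (u, v)) (pu S (u, v))"
      by (simp add: Sp_pairings(7)[OF uv] Sm_pairings(7)[OF uv]) (metis minus_minus)
    then show ?thesis using S_u[OF uv] by (subst (asm) mult_right_cancel) auto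
  qed
  obtain u0 v0 where uv0: "u0 \<in> I" "v0 \<in> J" using I(3) J(3) by auto
  show ?thesis
  proof (cases "\<gamma> (u0, v0) = 1")
    case True
    have "Im (\<beta> (u, v)) \<noteq> 0" if uv: "u \<in> I" "v \<in> J" for u v
      using conj[OF uv] nz(2)[OF uv] \<gamma>_constant[OF uv uv0] True by (auto simp: complex_eq_iff)
    then show ?thesis by blast
  next
    case False
    have "Re (\<beta> (u, v)) \<noteq> 0" if uv: "u \<in> I" "v \<in> J" for u v
    proof
      assume "Re (\<beta> (u, v)) = 0"
      then have "cnj (\<beta> (u, v)) = - \<beta> (u, v)" by (simp add: complex_eq_iff)
      then have "\<gamma> (u, v) * \<beta> (u, v) = \<beta> (u, v)" using conj[OF uv] by simp
      then show False using nz(2)[OF uv] \<gamma>_constant[OF uv uv0] False by simp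
    qed
    then show ?thesis by blast
  qed
qed

text \<open>As \<open>Sp\<^sub>u\<^sub>v = 0\<close>, the difference \<open>Sp(u, v) - Sp(u0, v)\<close> does not depend on \<open>v\<close>, and it is also the
  difference of the values of \<open>Sp - \<alpha> \<sigma> = \<beta> S\<close>. Its real or imaginary part is \<open>\<Phi>(u)\<close>.\<close>

lemma translation_net_exists:
  obtains a \<Phi> \<Phi>1 r where "translation_net I J \<sigma> \<sigma>1 \<sigma>2 a \<Phi> \<Phi>1"
    "\<And>u v. u \<in> I \<Longrightarrow> v \<in> J \<Longrightarrow> r (u, v) \<noteq> 0 \<and> a v + \<Phi> u = r (u, v) *\<^sub>R S (u, v)"
proof -
  obtain u0 v0 where uv0: "u0 \<in> I" "v0 \<in> J" using I(3) J(3) by auto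
  obtain \<rho> :: "complex \<Rightarrow> real" where \<rho>: "\<rho> = Re \<or> \<rho> = Im"
    and \<rho>\<beta>: "\<And>u v. u \<in> I \<Longrightarrow> v \<in> J \<Longrightarrow> \<rho> (\<beta> (u, v)) \<noteq> 0"
    using \<beta>_Re_or_Im by blast
  have \<rho>_lin: "\<rho> (x + y) = \<rho> x + \<rho> y" "\<rho> (x - y) = \<rho> x - \<rho> y" "\<rho> (c *\<^sub>R x) = c * \<rho> x"
    "\<rho> (x * of_real c) = \<rho> x * c" for x y c
    using \<rho> by auto
  define R :: "complex^6 \<Rightarrow> real^6" where "R x = (\<chi> i. \<rho> (x$i))" for x
  have "linear R" by (rule linearI) (simp_all add: R_def vec_eq_iff \<rho>_lin)
  then have R: "bounded_linear R" by (simp add: linear_conv_bounded_linear)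
  interpret R: bounded_linear R by (rule R)
  have lieR: "lie (R x) y = \<rho> (lieC x y)" for x y
    using \<rho> lie_Re_lieC lie_Im_lieC by (auto simp: R_def)
  have R_cplx: "R (c *s cplx x) = \<rho> c *\<^sub>R x" for c x
    by (simp add: R_def vec_eq_iff cplx_def \<rho>_lin)
  \<comment> \<open>\<open>a\<close> is the real or imaginary part of \<open>\<beta> S\<close> along the line \<open>u = u0\<close>\<close>
  define a where "a v = R (Sp (u0, v) - \<alpha> (u0, v) *s cplx (\<sigma> v))" for v
  define \<Phi> where "\<Phi> u = R (Sp (u, v0) - Sp (u0, v0))" for u
  define \<Phi>1 where "\<Phi>1 u = R (pu Sp (u, v0))" for u
  define r where "r z = \<rho> (\<beta> z)" for z
  have eq: "a v + \<Phi> u = r (u, v) *\<^sub>R S (u, v)" if uv: "u \<in> I" "v \<in> J" for u v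
  proof -
    have "pu Sp (x, v) = pu Sp (x, v0)" if x: "x \<in> I" for x
      by (rule constant_on_if_zero_derivative[OF J(2) _ uv(2) uv0(2)])
        (use D_v[OF smooth_on_pu[OF Sp_smooth] x] Sp_uv_zero[OF x] in force)
    then have "((\<lambda>x. Sp (x, v) - Sp (x, v0)) has_vector_derivative 0) (at x)" if x: "x \<in> I" for x
      using has_vector_derivative_diff[OF D_u[OF Sp_smooth x uv(2)] D_u[OF Sp_smooth x uv0(2)]] x by simp
    then have "Sp (u, v) - Sp (u, v0) = Sp (u0, v) - Sp (u0, v0)"
      by (rule constant_on_if_zero_derivative[OF I(2) _ uv(1) uv0(1)])
    then have *: "Sp (u, v) = Sp (u, v0) + (Sp (u0, v) - Sp (u0, v0))" by (simp add: algebra_simps)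
    have "a v + \<Phi> u = R (Sp (u, v) - \<alpha> (u, v) *s cplx (\<sigma> v))"
      unfolding a_def \<Phi>_def Sp_pairings(1)[OF uv uv0(1)] R.add[symmetric] *
      by (simp add: algebra_simps)
    then show ?thesis by (simp add: Sp[OF uv] R_cplx r_def)
  qed
  have "translation_net I J \<sigma> \<sigma>1 \<sigma>2 a \<Phi> \<Phi>1"
  proof
    show "(\<Phi> has_vector_derivative \<Phi>1 u) (at u)" if u: "u \<in> I" for u
    proof -
      have "((\<lambda>x. Sp (x, v0) - Sp (u0, v0)) has_vector_derivative pu Sp (u, v0) - 0) (at u)"
        by (intro has_vector_derivative_diff has_vector_derivative_const D_u Sp_smooth u uv0)
      then show ?thesis
        unfolding \<Phi>_def[abs_def] \<Phi>1_def using bounded_linear.has_vector_derivative[OF R] by fastforce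
    qed
    have "continuous_on I (\<lambda>u. pu Sp (u, v0))"
      by (rule continuous_on_compose2[OF smooth_on_continuous[OF smooth_on_pu[OF Sp_smooth]]])
        (use uv0 in \<open>auto intro!: continuous_intros\<close>)
    then show "continuous_on I \<Phi>1"
      unfolding \<Phi>1_def[abs_def] by (rule bounded_linear.continuous_on[OF R])
    show "lie (\<Phi>1 u) (\<Phi>1 u) > 0" if u: "u \<in> I" for u
    proof (rule lie_gt_0_if_perp_null_plane)
      let ?S = "S (u, v0)"
      have uv: "u \<in> I" "v0 \<in> J" using u uv0 by auto
      show "lie (\<sigma> v0) (\<sigma> v0) = 0" "lie (\<sigma> v0) ?S = 0" "lie ?S ?S = 0"
        using \<sigma>(1) S_perp(1)[OF uv] S_null[OF uv] uv by (simp_all add: lie_commute)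
      show "lie (\<Phi>1 u) (\<sigma> v0) = 0" "lie (\<Phi>1 u) ?S = 0"
        using Sp_pairings(2,3)[OF uv] \<rho> by (auto simp: \<Phi>1_def lieR)
      have nz_u: "lie (\<Phi>1 u) (pu S (u, v0)) \<noteq> 0"
        using S_u[OF uv] \<rho>\<beta>[OF uv] by (simp add: \<Phi>1_def lieR Sp_pairings(4)[OF uv] \<rho>_lin)
      show "\<Phi>1 u \<notin> span {\<sigma> v0, ?S}"
      proof
        assume sp: "\<Phi>1 u \<in> span {\<sigma> v0, ?S}"
        have "lie (\<Phi>1 u) (pu S (u, v0)) = 0"
          by (rule orthogonal_span[OF _ sp]) (use Su_perp[OF uv] in \<open>auto simp: lie_commute\<close>)
        then show False using nz_u by simp
      qed
      have s2: "lie (\<sigma> v0) (\<sigma>2 v0) \<noteq> 0" "lie ?S (\<sigma>2 v0) = 0"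
        using \<sigma>(3,4)[OF uv0(2)] S_perp(3)[OF uv] by auto
      then show "\<sigma> v0 \<noteq> ?S" by auto
      have "?S \<noteq> 0"
      proof
        assume "?S = 0"
        then show False using Su_perp(4)[OF uv] S_u[OF uv] by (simp add: lie_simps)
      qed
      moreover have "\<sigma> v0 \<notin> span {?S}" using s2 by (auto simp: span_singleton lie_simps)
      ultimately show "independent {\<sigma> v0, ?S}" by (simp add: independent_insertI)
    qed
    show "\<exists>u0\<in>I. \<Phi> u0 = 0" using uv0(1) by (intro bexI[of _ u0]) (simp_all add: \<Phi>_def R.zero)
  qed (use I J \<sigma> d\<sigma> S_perp S_null in \<open>auto simp: eq lie_simps\<close>)
  then show ?thesis using that[of a \<Phi> \<Phi>1 r] eq \<rho>\<beta> by (simp add: r_def)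
qed

end

section \<open>Exchanging the coordinates\<close>

lemma pu_swap:
  assumes "f differentiable (at (prod.swap z))"
  shows "pu (f \<circ> prod.swap) z = pv f (prod.swap z)" "pv (f \<circ> prod.swap) z = pu f (prod.swap z)"
    "(f \<circ> prod.swap) differentiable (at z)"
    "frechet_derivative (f \<circ> prod.swap) (at z) b = frechet_derivative f (at (prod.swap z)) (prod.swap b)"
proof -
  have "(prod.swap has_derivative prod.swap) (at z)"
    using bounded_linear_imp_has_derivative[of prod.swap]
    by (simp add: prod.swap_def[abs_def] bounded_linear_Pair bounded_linear_fst bounded_linear_snd)
  moreover have "(f has_derivative frechet_derivative f (at (prod.swap z))) (at (prod.swap z))"
    using assms by (simp add: frechet_derivative_works)
  ultimately have D: "((f \<circ> prod.swap) has_derivative frechet_derivative f (at (prod.swap z)) \<circ> prod.swap) (at z)"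
    using diff_chain_at by blast
  then have "frechet_derivative (f \<circ> prod.swap) (at z) = frechet_derivative f (at (prod.swap z)) \<circ> prod.swap"
    using frechet_derivative_at by metis
  then show "pu (f \<circ> prod.swap) z = pv f (prod.swap z)" "pv (f \<circ> prod.swap) z = pu f (prod.swap z)"
    "frechet_derivative (f \<circ> prod.swap) (at z) b = frechet_derivative f (at (prod.swap z)) (prod.swap b)"
    by (simp_all add: pu_def pv_def)
  show "(f \<circ> prod.swap) differentiable (at z)" using D by (auto simp: differentiable_def)
qed

lemma frechet_derivative_cong:
  assumes "open U" "x \<in> U" "\<And>y. y \<in> U \<Longrightarrow> f y = g y"
  shows "frechet_derivative f (at x) = frechet_derivative g (at x)"
    "f differentiable (at x) \<longleftrightarrow> g differentiable (at x)"
proof -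
  have "(f has_derivative D) (at x) \<longleftrightarrow> (g has_derivative D) (at x)" for D
    using has_derivative_transform_within_open[OF _ assms(1,2), of f D UNIV g]
      has_derivative_transform_within_open[OF _ assms(1,2), of g D UNIV f] assms(3) by auto
  then show "frechet_derivative f (at x) = frechet_derivative g (at x)"
    "f differentiable (at x) \<longleftrightarrow> g differentiable (at x)"
    by (simp_all add: frechet_derivative_def differentiable_def)
qed

lemma Ck_on_cong:
  assumes "open U" "\<And>x. x \<in> U \<Longrightarrow> f x = g x"
  shows "Ck_on k f U \<longleftrightarrow> Ck_on k g U"
  using assms(2)
proof (induction k arbitrary: f g)
  case 0
  then show ?case by (simp cong: continuous_on_cong)
next
  case (Suc k)
  have "Ck_on k (\<lambda>x. frechet_derivative f (at x) b) U \<longleftrightarrow> Ck_on k (\<lambda>x. frechet_derivative g (at x) b) U" for b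
    using frechet_derivative_cong(1)[OF assms(1) _ Suc.prems] by (intro Suc.IH) simp
  moreover have "f differentiable (at x) \<longleftrightarrow> g differentiable (at x)" if "x \<in> U" for x
    using frechet_derivative_cong(2)[OF assms(1) that Suc.prems] by simp
  ultimately show ?case by simp
qed

lemma smooth_on_cong:
  assumes "open U" "\<And>x. x \<in> U \<Longrightarrow> f x = g x"
  shows "smooth_on f U \<longleftrightarrow> smooth_on g U"
  using Ck_on_cong[OF assms] by (simp add: smooth_on_def)

lemma pu_pv_cong:
  assumes "open U" "z \<in> U" "\<And>y. y \<in> U \<Longrightarrow> f y = g y"
  shows "pu f z = pu g z" "pv f z = pv g z"
  using frechet_derivative_cong(1)[OF assms] by (simp_all add: pu_def pv_def)

lemma swap_Basis: "b \<in> (Basis :: (real \<times> real) set) \<Longrightarrow> prod.swap b \<in> Basis"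
  by (auto simp: Basis_prod_def)

lemma open_swap_image:
  fixes U :: "(real \<times> real) set"
  assumes "open U" shows "open (prod.swap ` U)"
proof -
  have "prod.swap ` U = prod.swap -` U" by (auto simp: image_iff) (metis swap_simp)
  moreover have "open (prod.swap -` U)" using assms by (rule open_vimage) (rule continuous_on_swap)
  ultimately show ?thesis by simp
qed

lemma Ck_on_swap:
  fixes f :: "real \<times> real \<Rightarrow> 'b::real_normed_vector"
  assumes "open U" "Ck_on k f U"
  shows "Ck_on k (f \<circ> prod.swap) (prod.swap ` U)"
  using assms(2)
proof (induction k arbitrary: f)
  case 0
  have "prod.swap ` prod.swap ` U = U" by (simp add: image_comp)
  then show ?case
    unfolding Ck_on.simps by (intro continuous_on_compose[OF continuous_on_swap]) (use 0 in simp)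
next
  case (Suc k)
  have d: "f differentiable (at (prod.swap x))" if "x \<in> prod.swap ` U" for x
    using Suc.prems that by auto
  have "Ck_on k (\<lambda>x. frechet_derivative (f \<circ> prod.swap) (at x) b) (prod.swap ` U)" if b: "b \<in> Basis" for b
  proof -
    have "Ck_on k ((\<lambda>x. frechet_derivative f (at x) (prod.swap b)) \<circ> prod.swap) (prod.swap ` U)"
      using Suc.prems swap_Basis[OF b] by (intro Suc.IH) auto
    then show ?thesis
      by (rule Ck_on_cong[OF open_swap_image[OF assms(1)], THEN iffD1, rotated])
        (simp add: pu_swap(4)[OF d])
  qed
  then show ?case unfolding Ck_on.simps using pu_swap(3)[OF d] by blast
qed

lemma smooth_on_swap:
  fixes f :: "real \<times> real \<Rightarrow> 'b::real_normed_vector"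
  assumes "open U" "smooth_on f U"
  shows "smooth_on (f \<circ> prod.swap) (prod.swap ` U)"
  unfolding smooth_on_def
  by (intro allI Ck_on_swap[OF assms(1)]) (use assms(2) in \<open>simp add: smooth_on_def\<close>)

lemma smooth_on_bounded_linear:
  assumes L: "bounded_linear L" and "smooth_on f U" "open U"
  shows "smooth_on (L \<circ> f) U"
proof -
  have "Ck_on k (L \<circ> f) U" if "Ck_on k f U" for k
    using that
  proof (induction k arbitrary: f)
    case 0
    then show ?case using bounded_linear.continuous_on[OF L] by (simp add: o_def)
  next
    case (Suc k)
    have D: "((L \<circ> f) has_derivative L \<circ> frechet_derivative f (at x)) (at x)" if "x \<in> U" for x
      using Suc.prems that bounded_linear.has_derivative[OF L, of f "frechet_derivative f (at x)" "at x"]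
      by (simp add: frechet_derivative_works o_def)
    then have fr: "frechet_derivative (L \<circ> f) (at x) = L \<circ> frechet_derivative f (at x)" if "x \<in> U" for x
      using frechet_derivative_at that by metis
    have "Ck_on k (\<lambda>x. frechet_derivative (L \<circ> f) (at x) b) U" if "b \<in> Basis" for b
    proof -
      have "Ck_on k (L \<circ> (\<lambda>x. frechet_derivative f (at x) b)) U"
        using Suc.prems that by (intro Suc.IH) auto
      then show ?thesis
        by (rule Ck_on_cong[OF assms(3), THEN iffD1, rotated]) (simp add: fr)
    qed
    moreover have "(L \<circ> f) differentiable (at x)" if "x \<in> U" for x
      unfolding differentiable_def using D[OF that] by blast
    ultimately show ?case unfolding Ck_on.simps by blast
  qed
  then show ?thesis using assms(2) by (simp add: smooth_on_def)
qed

section \<open>Curvature spheres over a coordinate rectangle\<close>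

text \<open>The data of an \<open>\<Omega>\<close>-surface written in curvature line coordinates: \<open>S1\<close>, \<open>S2\<close> are lifts of the
  curvature spheres and span \<open>\<Lambda>\<close>, and \<open>regular\<close> expresses the absence of umbilics.\<close>

locale omega_net =
  fixes I J :: "real set" and S1 S2 :: "real \<times> real \<Rightarrow> real^6" and Sp Sm :: "real \<times> real \<Rightarrow> complex^6"
  assumes I: "open I" "connected I" "I \<noteq> {}" and J: "open J" "connected J" "J \<noteq> {}"
    and S_smooth: "smooth_on S1 (I \<times> J)" "smooth_on S2 (I \<times> J)"
    and frame: "z \<in> I \<times> J \<Longrightarrow> S1 z \<noteq> S2 z" "z \<in> I \<times> J \<Longrightarrow> independent {S1 z, S2 z}"
    and null: "z \<in> I \<times> J \<Longrightarrow> lie (S1 z) (S1 z) = 0" "z \<in> I \<times> J \<Longrightarrow> lie (S1 z) (S2 z) = 0"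
      "z \<in> I \<times> J \<Longrightarrow> lie (S2 z) (S2 z) = 0"
    and contact: "z \<in> I \<times> J \<Longrightarrow> lie (pv S1 z) (S2 z) = 0" "z \<in> I \<times> J \<Longrightarrow> lie (pu S2 z) (S1 z) = 0"
    and curvature: "z \<in> I \<times> J \<Longrightarrow> pu S1 z \<in> span {S1 z, S2 z}" "z \<in> I \<times> J \<Longrightarrow> pv S2 z \<in> span {S1 z, S2 z}"
    and regular: "z \<in> I \<times> J \<Longrightarrow> pv S1 z \<notin> span {S1 z, S2 z}" "z \<in> I \<times> J \<Longrightarrow> pu S2 z \<notin> span {S1 z, S2 z}"
    and M_smooth: "smooth_on Sp (I \<times> J)" "smooth_on Sm (I \<times> J)"
    and moutard: "z \<in> I \<times> J \<Longrightarrow> \<exists>k. pv (pu Sp) z = k *s Sp z" "z \<in> I \<times> J \<Longrightarrow> \<exists>k. pv (pu Sm) z = k *s Sm z"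
    and real: "(\<forall>z\<in>I \<times> J. cnjv (Sp z) = Sp z) \<or> (\<forall>z\<in>I \<times> J. Sm z = cnjv (Sp z))"
    and harmonic: "z \<in> I \<times> J \<Longrightarrow> harmonic_separation (cplx (S1 z)) (cplx (S2 z)) (Sp z) (Sm z)"
begin

lemma open_rectangle: "open (I \<times> J)"
  using I(1) J(1) by (rule open_Times)

lemma omega_net_swap:
  "omega_net J I (S2 \<circ> prod.swap) (S1 \<circ> prod.swap) (Sp \<circ> prod.swap) (Sm \<circ> prod.swap)"
proof -
  have sw: "prod.swap ` (I \<times> J) = J \<times> I" by (rule product_swap)
  have mem: "prod.swap z \<in> I \<times> J" if "z \<in> J \<times> I" for z using that by auto
  have smooth: "smooth_on (F \<circ> prod.swap) (J \<times> I)" if "smooth_on F (I \<times> J)"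
    for F :: "real \<times> real \<Rightarrow> 'b::real_normed_vector"
    using smooth_on_swap[OF open_rectangle that] unfolding sw .
  have d: "pu (F \<circ> prod.swap) z = pv F (prod.swap z)" "pv (F \<circ> prod.swap) z = pu F (prod.swap z)"
    if "smooth_on F (I \<times> J)" "z \<in> J \<times> I" for F :: "real \<times> real \<Rightarrow> 'b::real_normed_vector" and z
    using pu_swap[OF smooth_on_differentiable[OF that(1) mem[OF that(2)]]] by simp_all
  have dd: "pv (pu (F \<circ> prod.swap)) z = pv (pu F) (prod.swap z)"
    if F: "smooth_on F (I \<times> J)" and z: "z \<in> J \<times> I" for F :: "real \<times> real \<Rightarrow> 'b::real_inner" and z
  proof -
    have "pv (pu (F \<circ> prod.swap)) z = pv (pv F \<circ> prod.swap) z"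
      using d(1)[OF F] by (intro pu_pv_cong(2)[OF open_Times[OF J(1) I(1)] z]) simp
    also have "\<dots> = pu (pv F) (prod.swap z)" using d(2)[OF smooth_on_pv[OF F] z] .
    also have "\<dots> = pv (pu F) (prod.swap z)" using mixed_partials[OF F open_rectangle mem[OF z]] .
    finally show ?thesis .
  qed
  show ?thesis
  proof
    fix z assume z: "z \<in> J \<times> I"
    note m = mem[OF z]
    show "harmonic_separation (cplx ((S2 \<circ> prod.swap) z)) (cplx ((S1 \<circ> prod.swap) z))
        ((Sp \<circ> prod.swap) z) ((Sm \<circ> prod.swap) z)"
    proof -
      from harmonic[OF m] obtain \<alpha> \<beta> \<gamma> where h: "\<alpha> \<noteq> 0" "\<beta> \<noteq> 0" "\<gamma> \<noteq> 0"
        "Sp (prod.swap z) = \<alpha> *s cplx (S1 (prod.swap z)) + \<beta> *s cplx (S2 (prod.swap z))"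
        "Sm (prod.swap z) = \<gamma> *s (\<alpha> *s cplx (S1 (prod.swap z)) - \<beta> *s cplx (S2 (prod.swap z)))"
        by (auto simp: harmonic_separation_def)
      show ?thesis unfolding harmonic_separation_def
        by (rule exI[of _ \<beta>], rule exI[of _ \<alpha>], rule exI[of _ "- \<gamma>"])
          (use h in \<open>simp add: vec_eq_iff algebra_simps\<close>)
    qed
    show "\<exists>k. pv (pu (Sp \<circ> prod.swap)) z = k *s (Sp \<circ> prod.swap) z"
      "\<exists>k. pv (pu (Sm \<circ> prod.swap)) z = k *s (Sm \<circ> prod.swap) z"
      using moutard[OF m] dd[OF M_smooth(1) z] dd[OF M_smooth(2) z] by simp_all
    show "pu (S2 \<circ> prod.swap) z \<in> span {(S2 \<circ> prod.swap) z, (S1 \<circ> prod.swap) z}"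
      "pv (S1 \<circ> prod.swap) z \<in> span {(S2 \<circ> prod.swap) z, (S1 \<circ> prod.swap) z}"
      "pv (S2 \<circ> prod.swap) z \<notin> span {(S2 \<circ> prod.swap) z, (S1 \<circ> prod.swap) z}"
      "pu (S1 \<circ> prod.swap) z \<notin> span {(S2 \<circ> prod.swap) z, (S1 \<circ> prod.swap) z}"
      using curvature[OF m] regular[OF m] d[OF S_smooth(1) z] d[OF S_smooth(2) z]
      by (simp_all add: insert_commute)
    show "lie (pv (S2 \<circ> prod.swap) z) ((S1 \<circ> prod.swap) z) = 0"
      "lie (pu (S1 \<circ> prod.swap) z) ((S2 \<circ> prod.swap) z) = 0"
      using contact[OF m] d[OF S_smooth(1) z] d[OF S_smooth(2) z] by simp_all
    show "independent {(S2 \<circ> prod.swap) z, (S1 \<circ> prod.swap) z}"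
      using frame(2)[OF m] by (simp add: insert_commute)
    show "lie ((S2 \<circ> prod.swap) z) ((S1 \<circ> prod.swap) z) = 0"
      using null(2)[OF m] by (simp add: lie_commute)
    show "(S2 \<circ> prod.swap) z \<noteq> (S1 \<circ> prod.swap) z" using frame(1)[OF m] by auto
    show "lie ((S2 \<circ> prod.swap) z) ((S2 \<circ> prod.swap) z) = 0"
      "lie ((S1 \<circ> prod.swap) z) ((S1 \<circ> prod.swap) z) = 0"
      using null[OF m] by simp_all
  next
    show "(\<forall>z\<in>J \<times> I. cnjv ((Sp \<circ> prod.swap) z) = (Sp \<circ> prod.swap) z) \<or>
        (\<forall>z\<in>J \<times> I. (Sm \<circ> prod.swap) z = cnjv ((Sp \<circ> prod.swap) z))"
      using real mem by auto
  qed (use I J smooth S_smooth M_smooth in auto)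
qed

lemma D_u: "smooth_on F (I \<times> J) \<Longrightarrow> (u, v) \<in> I \<times> J
    \<Longrightarrow> ((\<lambda>x. F (x, v)) has_vector_derivative pu F (u, v)) (at u)"
  by (intro has_vector_derivative_pu smooth_on_differentiable)

lemma D_v: "smooth_on F (I \<times> J) \<Longrightarrow> (u, v) \<in> I \<times> J
    \<Longrightarrow> ((\<lambda>y. F (u, y)) has_vector_derivative pv F (u, v)) (at v)"
  by (intro has_vector_derivative_pv smooth_on_differentiable)

lemma lie_constant_u:
  assumes "smooth_on F (I \<times> J)" "smooth_on G (I \<times> J)" "z \<in> I \<times> J"
    "\<And>z. z \<in> I \<times> J \<Longrightarrow> lie (F z) (G z) = 0"
  shows "lie (F z) (pu G z) = - lie (pu F z) (G z)"
proof -
  obtain u v where z: "z = (u, v)" "u \<in> I" "v \<in> J" using assms(3) by auto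
  have "lie (F (u, v)) (pu G (u, v)) + lie (pu F (u, v)) (G (u, v)) = 0"
    by (rule has_vector_derivative_const_on_open[OF lie.has_vector_derivative[OF
          D_u[OF assms(1)] D_u[OF assms(2)]] I(1) z(2)]) (use z assms(4) in auto)
  then show ?thesis by (simp add: z(1) eq_neg_iff_add_eq_0)
qed

lemma lie_constant_v:
  assumes "smooth_on F (I \<times> J)" "smooth_on G (I \<times> J)" "z \<in> I \<times> J"
    "\<And>z. z \<in> I \<times> J \<Longrightarrow> lie (F z) (G z) = 0"
  shows "lie (F z) (pv G z) = - lie (pv F z) (G z)"
proof -
  obtain u v where z: "z = (u, v)" "u \<in> I" "v \<in> J" using assms(3) by auto
  have "lie (F (u, v)) (pv G (u, v)) + lie (pv F (u, v)) (G (u, v)) = 0"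
    by (rule has_vector_derivative_const_on_open[OF lie.has_vector_derivative[OF
          D_v[OF assms(1)] D_v[OF assms(2)]] J(1) z(3)]) (use z assms(4) in auto)
  then show ?thesis by (simp add: z(1) eq_neg_iff_add_eq_0)
qed

lemma span_perp:
  assumes "x \<in> span {S1 z, S2 z}" "lie (S1 z) y = 0" "lie (S2 z) y = 0"
  shows "lie x y = 0"
  by (rule orthogonal_span[of "{S1 z, S2 z}"]) (use assms in auto)

text \<open>All relations follow from the contact conditions by differentiation. The orthogonality of
  \<open>(S1)\<^sub>v\<close> and \<open>(S2)\<^sub>u\<close>, that is, of the curvature directions, is the one for which the mixed
  derivatives of \<open>S1\<close> have to agree.\<close>

lemma derivative_pairings:
  assumes z: "z \<in> I \<times> J"
  shows "lie (S1 z) (pv S1 z) = 0" "lie (S2 z) (pv S1 z) = 0"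
    "lie (S2 z) (pu S2 z) = 0" "lie (S1 z) (pu S2 z) = 0"
    "lie (pv S1 z) (pu S2 z) = 0"
    "lie (pv S1 z) (pv S1 z) > 0" "lie (pu S2 z) (pu S2 z) > 0"
    "lie (S1 z) (pv (pv S1) z) = - lie (pv S1 z) (pv S1 z)" "lie (S2 z) (pv (pv S1) z) = 0"
    "lie (S1 z) (pu (pv S1) z) = 0" "lie (S2 z) (pu (pv S1) z) = 0"
    "lie (S2 z) (pu (pu S2) z) = - lie (pu S2 z) (pu S2 z)" "lie (S1 z) (pu (pu S2) z) = 0"
    "lie (S2 z) (pv (pu S2) z) = 0" "lie (S1 z) (pv (pu S2) z) = 0"
proof -
  have p: "lie (S1 z) (pv S1 z) = 0" "lie (S2 z) (pv S1 z) = 0"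
    "lie (S2 z) (pu S2 z) = 0" "lie (S1 z) (pu S2 z) = 0" if "z \<in> I \<times> J" for z
    using lie_constant_v[OF S_smooth(1,1) that null(1)] lie_constant_u[OF S_smooth(2,2) that null(3)]
      contact[OF that] by (simp_all add: lie_commute)
  from p[OF z] show p': "lie (S1 z) (pv S1 z) = 0" "lie (S2 z) (pv S1 z) = 0"
    "lie (S2 z) (pu S2 z) = 0" "lie (S1 z) (pu S2 z) = 0" by blast+
  have n21: "lie (S2 z) (S1 z) = 0" using null(2)[OF z] by (simp add: lie_commute)
  have L0: "lie x (S1 z) = 0" "lie x (S2 z) = 0" "lie x (pv S1 z) = 0" "lie x (pu S2 z) = 0"
    if "x \<in> span {S1 z, S2 z}" for x
    by (rule span_perp[OF that]; simp add: null[OF z] n21 p')+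
  have "lie (S2 z) (pv (pu S1) z) = - lie (pv S2 z) (pu S1 z)"
    by (rule lie_constant_v[OF S_smooth(2) smooth_on_pu[OF S_smooth(1)] z])
      (use span_perp[OF curvature(1)] null in \<open>simp add: lie_commute\<close>)
  also have "\<dots> = 0"
    using span_perp[OF curvature(2)[OF z], of "pu S1 z"] L0[OF curvature(1)[OF z]]
    by (simp add: lie_commute)
  finally have "lie (S2 z) (pu (pv S1) z) = 0"
    using mixed_partials[OF S_smooth(1) open_rectangle z] by simp
  moreover have "lie (S2 z) (pu (pv S1) z) = - lie (pu S2 z) (pv S1 z)"
    by (rule lie_constant_u[OF S_smooth(2) smooth_on_pv[OF S_smooth(1)] z p(2)])
  ultimately show orth: "lie (pv S1 z) (pu S2 z) = 0" and "lie (S2 z) (pu (pv S1) z) = 0"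
    by (simp_all add: lie_commute)
  show "lie (pv S1 z) (pv S1 z) > 0"
    by (rule lie_gt_0_if_perp_null_plane[OF frame[OF z] null[OF z]])
      (use p' regular[OF z] in \<open>simp_all add: lie_commute\<close>)
  show "lie (pu S2 z) (pu S2 z) > 0"
    by (rule lie_gt_0_if_perp_null_plane[OF frame[OF z] null[OF z]])
      (use p' regular[OF z] in \<open>simp_all add: lie_commute\<close>)
  show "lie (S1 z) (pv (pv S1) z) = - lie (pv S1 z) (pv S1 z)"
    by (rule lie_constant_v[OF S_smooth(1) smooth_on_pv[OF S_smooth(1)] z p(1)])
  show "lie (S2 z) (pv (pv S1) z) = 0"
    using lie_constant_v[OF S_smooth(2) smooth_on_pv[OF S_smooth(1)] z p(2)] L0[OF curvature(2)[OF z]]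
    by simp
  show "lie (S1 z) (pu (pv S1) z) = 0"
    using lie_constant_u[OF S_smooth(1) smooth_on_pv[OF S_smooth(1)] z p(1)] L0[OF curvature(1)[OF z]]
    by simp
  show "lie (S2 z) (pu (pu S2) z) = - lie (pu S2 z) (pu S2 z)"
    by (rule lie_constant_u[OF S_smooth(2) smooth_on_pu[OF S_smooth(2)] z p(3)])
  show "lie (S1 z) (pu (pu S2) z) = 0"
    using lie_constant_u[OF S_smooth(1) smooth_on_pu[OF S_smooth(2)] z p(4)] L0[OF curvature(1)[OF z]]
    by simp
  show "lie (S2 z) (pv (pu S2) z) = 0"
    using lie_constant_v[OF S_smooth(2) smooth_on_pu[OF S_smooth(2)] z p(3)] L0[OF curvature(2)[OF z]]
    by simp
  show "lie (S1 z) (pv (pu S2) z) = 0"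
    using lie_constant_v[OF S_smooth(1) smooth_on_pu[OF S_smooth(2)] z p(4)] orth by simp
qed

text \<open>Write \<open>c \<circ> t = a S1 + b S2\<close>. The derivatives \<open>t\<^sub>u c'\<close> and \<open>t\<^sub>v c'\<close> are parallel, whereas modulo \<open>\<Lambda>\<close> they
  are \<open>b (S2)\<^sub>u\<close> and \<open>a (S1)\<^sub>v\<close>, which are spacelike and orthogonal if \<open>a\<close> and \<open>b\<close> do not vanish. The
  coefficients are extracted by pairing with \<open>(S2)\<^sub>u\<close> and \<open>(S1)\<^sub>v\<close>, so that \<open>a\<close> and \<open>b\<close> need not
  be differentiated.\<close>

lemma one_parameter_congruence:
  fixes t :: "real \<times> real \<Rightarrow> real" and c :: "real \<Rightarrow> real^6"
  assumes N: "open N" "N \<subseteq> I \<times> J" "z \<in> N"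
    and t: "t differentiable (at z)" and c: "c differentiable (at (t z))"
    and w: "\<And>z. z \<in> N \<Longrightarrow> c (t z) \<in> span {S1 z, S2 z}" "c (t z) \<noteq> 0"
  shows "c (t z) \<in> span {S1 z} \<and> pu t z = 0 \<or> c (t z) \<in> span {S2 z} \<and> pv t z = 0"
proof -
  obtain u v where uv: "z = (u, v)" by (cases z)
  have z: "z \<in> I \<times> J" using N by auto
  note P = derivative_pairings[OF z]
  define c' where "c' = frechet_derivative c (at (t z)) 1"
  have "(c has_derivative frechet_derivative c (at (t z))) (at (t z))"
    using c by (simp add: frechet_derivative_works)
  moreover have "frechet_derivative c (at (t z)) = (\<lambda>h. h *\<^sub>R c')"
  proof
    show "frechet_derivative c (at (t z)) h = h *\<^sub>R c'" for h
      using linear_cmul[OF linear_frechet_derivative[OF c], of h 1] by (simp add: c'_def)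
  qed
  ultimately have dc: "(c has_vector_derivative c') (at (t z))"
    by (simp add: has_vector_derivative_def)
  have du: "((\<lambda>x. c (t (x, v))) has_vector_derivative pu t z *\<^sub>R c') (at u)"
    using vector_diff_chain_at[OF has_vector_derivative_pu[OF t[unfolded uv]], of c c'] dc
    by (simp add: uv o_def)
  have dv: "((\<lambda>y. c (t (u, y))) has_vector_derivative pv t z *\<^sub>R c') (at v)"
    using vector_diff_chain_at[OF has_vector_derivative_pv[OF t[unfolded uv]], of c c'] dc
    by (simp add: uv o_def)
  have slices: "open {x. (x, v) \<in> N}" "open {y. (u, y) \<in> N}"
  proof -
    have "continuous_on UNIV (\<lambda>x. (x, v))" "continuous_on UNIV (\<lambda>y. (u, y))"
      by (intro continuous_intros)+
    then show "open {x. (x, v) \<in> N}" "open {y. (u, y) \<in> N}"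
      using open_vimage[OF N(1)] by (auto simp: vimage_def)
  qed
  have diff: "lie (c (t z)) (pu F z) + pu t z * lie c' (F z) = 0"
    "lie (c (t z)) (pv F z) + pv t z * lie c' (F z) = 0"
    if F: "smooth_on F (I \<times> J)" "\<And>z. z \<in> I \<times> J \<Longrightarrow> lie (S1 z) (F z) = 0 \<and> lie (S2 z) (F z) = 0" for F
  proof -
    have 0: "lie (c (t z')) (F z') = 0" if "z' \<in> N" for z'
      using span_perp[OF w(1)[OF that]] F(2) that N(2) by blast
    have "lie (c (t (u, v))) (pu F (u, v)) + lie (pu t z *\<^sub>R c') (F (u, v)) = 0"
      by (rule has_vector_derivative_const_on_open[OF lie.has_vector_derivative[OF du D_u[OF F(1)]]
            slices(1)]) (use z N uv 0 in auto)
    then show "lie (c (t z)) (pu F z) + pu t z * lie c' (F z) = 0"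
      by (simp add: uv lie_simps)
    have "lie (c (t (u, v))) (pv F (u, v)) + lie (pv t z *\<^sub>R c') (F (u, v)) = 0"
      by (rule has_vector_derivative_const_on_open[OF lie.has_vector_derivative[OF dv D_v[OF F(1)]]
            slices(2)]) (use z N uv 0 in auto)
    then show "lie (c (t z)) (pv F z) + pv t z * lie c' (F z) = 0"
      by (simp add: uv lie_simps)
  qed
  obtain a b where ab: "c (t z) = a *\<^sub>R S1 z + b *\<^sub>R S2 z"
  proof -
    obtain a b where "c (t z) - a *\<^sub>R S1 z = b *\<^sub>R S2 z"
      using w(1)[OF N(3)] by (auto simp: span_insert span_singleton)
    then show ?thesis using that[of a b] by (simp add: algebra_simps)
  qed
  have E: "pu t z * lie c' (pv S1 z) = 0" "pv t z * lie c' (pv S1 z) = a * lie (pv S1 z) (pv S1 z)"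
    "pu t z * lie c' (pu S2 z) = b * lie (pu S2 z) (pu S2 z)" "pv t z * lie c' (pu S2 z) = 0"
    using diff[OF smooth_on_pv[OF S_smooth(1)]] diff[OF smooth_on_pu[OF S_smooth(2)]] derivative_pairings
    by (simp_all add: ab lie_simps P)
  show ?thesis
  proof (cases "a = 0")
    case True
    then have "b \<noteq> 0" using w(2) ab by auto
    then have "lie c' (pu S2 z) \<noteq> 0" using E(3) P(7) by auto
    then have "pv t z = 0" using E(4) by simp
    then show ?thesis using ab True by (simp add: span_scale span_base)
  next
    case False
    then have "lie c' (pv S1 z) \<noteq> 0" using E(2) P(6) by auto
    then have t0: "pu t z = 0" using E(1) by simp
    then have "b = 0" using E(3) P(7) by simp
    then show ?thesis using ab t0 by (simp add: span_scale span_base)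
  qed
qed

end

section \<open>Channel surfaces over a coordinate rectangle\<close>

lemma span_singleton_eq:
  assumes "x \<noteq> 0" "y \<noteq> 0" "x \<in> span {y}"
  shows "span {x} = span {y}"
proof -
  obtain c where c: "x = c *\<^sub>R y" using assms(3) by (auto simp: span_singleton)
  then have "c \<noteq> 0" using assms(1) by auto
  then have "y = (1 / c) *\<^sub>R x" using c by simp
  then have "y \<in> span {x}" by (metis span_scale span_base insertI1)
  then show ?thesis using assms(3) by (intro equalityI span_minimal) auto
qed

definition one_parameter_on :: "(real \<times> real \<Rightarrow> real^6) \<Rightarrow> (real \<times> real) set \<Rightarrow> (real \<times> real \<Rightarrow> real)
    \<Rightarrow> (real \<Rightarrow> real^6) \<Rightarrow> bool" where
  "one_parameter_on s N t c \<longleftrightarrow> open N \<and> (\<forall>z\<in>N. t differentiable (at z) \<and> c differentiable (at (t z)) \<and>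
     c (t z) \<noteq> 0 \<and> span {s z} = span {c (t z)})"

lemma one_parameter_onD:
  assumes "one_parameter_on s N t c"
  shows "open N" "z \<in> N \<Longrightarrow> t differentiable (at z) \<and> c differentiable (at (t z)) \<and>
    c (t z) \<noteq> 0 \<and> span {s z} = span {c (t z)}"
  using assms by (auto simp: one_parameter_on_def)

text \<open>The lift \<open>s\<close> is an arbitrary choice of representatives; all regularity is in \<open>t\<close> and \<open>c\<close>, with
  which only its spans are compared.\<close>

locale channel_net = omega_net +
  fixes s :: "real \<times> real \<Rightarrow> real^6"
  assumes s: "z \<in> I \<times> J \<Longrightarrow> s z \<noteq> 0" "z \<in> I \<times> J \<Longrightarrow> s z \<in> span {S1 z, S2 z}"
    and channel: "z \<in> I \<times> J \<Longrightarrow> \<exists>N\<subseteq>I \<times> J. z \<in> N \<and> (\<exists>t c. one_parameter_on s N t c)"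
begin

lemma channel_net_swap:
  "channel_net J I (S2 \<circ> prod.swap) (S1 \<circ> prod.swap) (Sp \<circ> prod.swap) (Sm \<circ> prod.swap) (s \<circ> prod.swap)"
proof -
  interpret sw: omega_net J I "S2 \<circ> prod.swap" "S1 \<circ> prod.swap" "Sp \<circ> prod.swap" "Sm \<circ> prod.swap"
    by (rule omega_net_swap)
  show ?thesis
  proof
    fix z assume z: "z \<in> J \<times> I"
    then have m: "prod.swap z \<in> I \<times> J" by auto
    show "(s \<circ> prod.swap) z \<noteq> 0" using s(1)[OF m] by simp
    show "(s \<circ> prod.swap) z \<in> span {(S2 \<circ> prod.swap) z, (S1 \<circ> prod.swap) z}"
      using s(2)[OF m] by (simp add: insert_commute)
    obtain N t c where N: "N \<subseteq> I \<times> J" "prod.swap z \<in> N" "one_parameter_on s N t c"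
      using channel[OF m] by blast
    have "z \<in> prod.swap ` N" using N(2) by (metis image_eqI swap_swap)
    moreover have "prod.swap ` N \<subseteq> J \<times> I" using N(1) by auto
    moreover have "one_parameter_on (s \<circ> prod.swap) (prod.swap ` N) (t \<circ> prod.swap) c"
      unfolding one_parameter_on_def
    proof (intro conjI ballI)
      show "open (prod.swap ` N)" by (rule open_swap_image[OF one_parameter_onD(1)[OF N(3)]])
      fix y assume "y \<in> prod.swap ` N"
      then have "prod.swap y \<in> N" by auto
      note D = one_parameter_onD(2)[OF N(3) this]
      show "(t \<circ> prod.swap) differentiable (at y)" using pu_swap(3)[of t y] D by simp
      show "c differentiable (at ((t \<circ> prod.swap) y))" "c ((t \<circ> prod.swap) y) \<noteq> 0"
        "span {(s \<circ> prod.swap) y} = span {c ((t \<circ> prod.swap) y)}" using D by simp_all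
    qed
    ultimately show "\<exists>N\<subseteq>J \<times> I. z \<in> N \<and> (\<exists>t c. one_parameter_on (s \<circ> prod.swap) N t c)" by blast
  qed
qed

lemma S_nonzero:
  assumes "z \<in> I \<times> J"
  shows "S1 z \<noteq> 0" "S2 z \<noteq> 0"
  using frame(2)[OF assms] dependent_zero[of "{S1 z, S2 z}"] by auto

lemma not_both:
  assumes "z \<in> I \<times> J" "x \<noteq> 0" "x \<in> span {S1 z}" "x \<in> span {S2 z}"
  shows False
proof -
  have "span {S1 z} = span {S2 z}"
    using span_singleton_eq[OF assms(2) _ assms(3)] span_singleton_eq[OF assms(2) _ assms(4)]
      S_nonzero[OF assms(1)] by simp
  then have "S1 z \<in> span {S2 z}" by (metis span_base insertI1)
  then have "dependent {S1 z, S2 z}"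
    using frame(1)[OF assms(1)] by (auto simp: dependent_def)
  then show False using frame(2)[OF assms(1)] by simp
qed

text \<open>Both alternatives of the pointwise dichotomy are open conditions, because a direction in \<open>\<Lambda>\<close>
  that is close to the first curvature sphere differs from the second one; and the rectangle is
  connected.\<close>

lemma channel_dichotomy:
  "(\<forall>z\<in>I \<times> J. s z \<in> span {S1 z}) \<or> (\<forall>z\<in>I \<times> J. s z \<in> span {S2 z})"
proof -
  define A B where "A = {z \<in> I \<times> J. s z \<in> span {S1 z}}" and "B = {z \<in> I \<times> J. s z \<in> span {S2 z}}"
  have loc: "(s z \<in> span {S1 z} \<longrightarrow> (\<exists>M. open M \<and> z \<in> M \<and> M \<subseteq> A)) \<and>
      (s z \<in> span {S2 z} \<longrightarrow> (\<exists>M. open M \<and> z \<in> M \<and> M \<subseteq> B)) \<and> (z \<in> A \<or> z \<in> B)"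
    if z: "z \<in> I \<times> J" for z
  proof -
    obtain N t c where N': "N \<subseteq> I \<times> J" "z \<in> N" "one_parameter_on s N t c"
      using channel[OF z] by blast
    note N = one_parameter_onD(1)[OF N'(3)] N'(1,2) one_parameter_onD(2)[OF N'(3)]
    define w where "w z = c (t z)" for z
    have w_iff: "s z \<in> span X \<longleftrightarrow> w z \<in> span X" if "z \<in> N" for z X
    proof -
      have "span {s z} = span {w z}" using N(4)[OF that] by (simp add: w_def)
      moreover have "x \<in> span X \<longleftrightarrow> span {x} \<subseteq> span X" for x
        by (meson empty_subsetI insert_subset span_base span_minimal subspace_span subset_iff insertI1)
      ultimately show ?thesis by metis
    qed
    have AB: "z \<in> A \<or> z \<in> B" if "z \<in> N" for z
    proof -
      have "w z \<in> span {S1 z} \<or> w z \<in> span {S2 z}"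
        using one_parameter_congruence[OF N(1,2) that, of t c] N(2,4) s(2) w_iff that
        unfolding w_def by blast
      then show ?thesis using w_iff[OF that] N(2) that by (auto simp: A_def B_def)
    qed
    have contw: "continuous_on N w"
    proof -
      have "isCont (\<lambda>x. c (t x)) x" if "x \<in> N" for x
        using differentiable_imp_continuous_within[of t x UNIV]
          differentiable_imp_continuous_within[of c "t x" UNIV] N(4)[OF that]
        by (intro isCont_o2[of x t c]) simp_all
      then show ?thesis by (auto simp: w_def[abs_def] continuous_at_imp_continuous_on)
    qed
    have away: "\<exists>M. open M \<and> z \<in> M \<and> M \<subseteq> N \<and> (\<forall>z\<in>M. w z \<notin> span {F z})"
      if F: "continuous_on N F" "\<And>z. z \<in> N \<Longrightarrow> F z \<noteq> 0" "w z \<notin> span {F z}" for F :: "real \<times> real \<Rightarrow> real^6"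
    proof -
      \<comment> \<open>the part of \<open>w\<close> that is Euclidean orthogonal to \<open>F\<close> depends continuously on the point\<close>
      define d where "d z = w z - ((w z \<bullet> F z) / (F z \<bullet> F z)) *\<^sub>R F z" for z
      have iff: "d z = 0 \<longleftrightarrow> w z \<in> span {F z}" if "z \<in> N" for z
      proof
        assume "w z \<in> span {F z}"
        then show "d z = 0" using F(2)[OF that] by (auto simp: d_def span_singleton)
      qed (auto simp: d_def span_singleton)
      have "continuous_on N d"
        unfolding d_def[abs_def] using F by (intro continuous_intros contw) auto
      then have "open (N \<inter> d -` (- {0}))"
        using N(1) by (simp add: continuous_open_preimage open_Compl)
      then show ?thesis using iff N(3) F(3)
        by (intro exI[of _ "N \<inter> d -` (- {0})"]) auto
    qed
    have cont: "continuous_on N S1" "continuous_on N S2"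
      using continuous_on_subset[OF smooth_on_continuous] S_smooth N(2) by blast+
    have S0: "S1 z \<noteq> 0" "S2 z \<noteq> 0" if "z \<in> N" for z using S_nonzero that N(2) by blast+
    have wz: "w z \<noteq> 0" using N(3,4) by (simp add: w_def)
    show ?thesis
    proof (intro conjI impI)
      assume "s z \<in> span {S1 z}"
      then have "w z \<notin> span {S2 z}" using not_both[OF z wz] w_iff[OF N(3)] by blast
      then obtain M where M: "open M" "z \<in> M" "M \<subseteq> N" "\<forall>z\<in>M. w z \<notin> span {S2 z}"
        using away[OF cont(2) S0(2)] by blast
      have "x \<in> A" if "x \<in> M" for x
      proof -
        have "x \<in> N" "w x \<notin> span {S2 x}" using M(3,4) that by auto
        then show ?thesis using AB[of x] w_iff[of x "{S2 x}"] by (auto simp: B_def)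
      qed
      then show "\<exists>M. open M \<and> z \<in> M \<and> M \<subseteq> A" using M(1,2) by blast
    next
      assume "s z \<in> span {S2 z}"
      then have "w z \<notin> span {S1 z}" using not_both[OF z wz] w_iff[OF N(3)] by blast
      then obtain M where M: "open M" "z \<in> M" "M \<subseteq> N" "\<forall>z\<in>M. w z \<notin> span {S1 z}"
        using away[OF cont(1) S0(1)] by blast
      have "x \<in> B" if "x \<in> M" for x
      proof -
        have "x \<in> N" "w x \<notin> span {S1 x}" using M(3,4) that by auto
        then show ?thesis using AB[of x] w_iff[of x "{S1 x}"] by (auto simp: A_def)
      qed
      then show "\<exists>M. open M \<and> z \<in> M \<and> M \<subseteq> B" using M(1,2) by blast
    qed (use AB N(3) in blast)
  qed
  have "open A" "open B" using loc by (subst open_subopen; auto simp: A_def B_def)+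
  moreover have "A \<inter> B = {}"
  proof -
    have False if "z \<in> A" "z \<in> B" for z
      using not_both[of z "s z"] s(1)[of z] that by (simp add: A_def B_def)
    then show ?thesis by blast
  qed
  moreover have "I \<times> J \<subseteq> A \<union> B" using loc by blast
  moreover have "connected (I \<times> J)" using I(2) J(2) by (rule connected_Times)
  ultimately have "A \<inter> (I \<times> J) = {} \<or> B \<inter> (I \<times> J) = {}"
    using connectedD[of "I \<times> J" A B] by auto
  moreover have "z \<in> A \<or> z \<in> B" if "z \<in> I \<times> J" for z using loc[OF that] by blast
  ultimately have "(\<forall>z\<in>I \<times> J. z \<in> A) \<or> (\<forall>z\<in>I \<times> J. z \<in> B)" by blast
  then show ?thesis by (simp add: A_def B_def)
qed

text \<open>The parameter \<open>t\<close> has vanishing \<open>u\<close>-derivative, so the direction is locally constant along the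
  \<open>u\<close>-lines of the rectangle.\<close>

lemma channel_constant:
  assumes E: "\<And>z. z \<in> I \<times> J \<Longrightarrow> s z \<in> span {S1 z}" and uv: "u \<in> I" "u' \<in> I" "v \<in> J"
  shows "span {S1 (u, v)} = span {S1 (u', v)}"
proof (rule connected_local_const[OF I(2) uv(1,2)])
  show "\<forall>a\<in>I. \<forall>\<^sub>F b in at a within I. span {S1 (a, v)} = span {S1 (b, v)}"
  proof
    fix a assume a: "a \<in> I"
    then have z: "(a, v) \<in> I \<times> J" using uv(3) by simp
    obtain N t c where N': "N \<subseteq> I \<times> J" "(a, v) \<in> N" "one_parameter_on s N t c"
      using channel[OF z] by blast
    note N = one_parameter_onD(1)[OF N'(3)] N'(1,2) one_parameter_onD(2)[OF N'(3)]
    have s_span: "span {c (t z)} = span {S1 z}" if "z \<in> N" for z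
      using span_singleton_eq[OF s(1) S_nonzero(1) E, of z] N(2,4) that by auto
    have pu0: "pu t z = 0" if zN: "z \<in> N" for z
    proof -
      have sub: "c (t z) \<in> span {S1 z}" if "z \<in> N" for z
        using s_span[OF that] span_base[of "c (t z)" "{c (t z)}"] by simp
      have "c (t z') \<in> span {S1 z', S2 z'}" if "z' \<in> N" for z'
        using sub[OF that] span_mono[of "{S1 z'}" "{S1 z', S2 z'}"] by blast
      then have "c (t z) \<in> span {S1 z} \<and> pu t z = 0 \<or> c (t z) \<in> span {S2 z} \<and> pv t z = 0"
        using N(4) by (intro one_parameter_congruence[OF N(1,2) zN]) (use zN in auto)
      moreover have "c (t z) \<notin> span {S2 z}"
        using not_both[of z "c (t z)"] sub[OF zN] N(2,4) zN by blast
      ultimately show ?thesis by blast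
    qed
    obtain \<epsilon> where \<epsilon>: "\<epsilon> > 0" "ball (a, v) \<epsilon> \<subseteq> N" using N(1,3) by (meson open_contains_ball)
    have inN: "(b, v) \<in> N" if "b \<in> ball a \<epsilon>" for b
    proof -
      have "dist (a, v) (b, v) = dist a b" by (simp add: dist_Pair_Pair)
      then show ?thesis using that \<epsilon>(2) by auto
    qed
    have "((\<lambda>x. t (x, v)) has_vector_derivative 0) (at b)" if "b \<in> ball a \<epsilon>" for b
      using has_vector_derivative_pu[of t b v] N(4)[OF inN[OF that]] pu0[OF inN[OF that]] by simp
    then have "t (b, v) = t (a, v)" if "b \<in> ball a \<epsilon>" for b
      using \<epsilon>(1) that by (intro constant_on_if_zero_derivative[of "ball a \<epsilon>" "\<lambda>x. t (x, v)"]) auto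
    then have "span {S1 (a, v)} = span {S1 (b, v)}" if "b \<in> ball a \<epsilon>" for b
      using s_span[OF inN[OF that]] s_span[OF N(3)] that by simp
    then show "\<forall>\<^sub>F b in at a within I. span {S1 (a, v)} = span {S1 (b, v)}"
      unfolding eventually_at using \<epsilon>(1) by (intro exI[of _ \<epsilon>]) (auto simp: dist_commute)
  qed
qed

text \<open>The relations that \<open>moutard_pair\<close> requires hold for the lift \<open>\<sigma>(v) = S1(u0, v)\<close> at every \<open>u\<close>, as
  \<open>S1(u, v)\<close> is a multiple of \<open>\<sigma>(v)\<close>. The signature of \<open>W\<close> then distinguishes the types.\<close>

lemma classification:
  assumes E: "\<And>z. z \<in> I \<times> J \<Longrightarrow> s z \<in> span {S1 z}"
  shows "net_dupin (I \<times> J) S1 S2 \<or> net_represents is_cone (I \<times> J) S1 S2 \<or>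
    net_represents is_cylinder (I \<times> J) S1 S2 \<or> net_represents is_revolution (I \<times> J) S1 S2"
proof -
  obtain u0 where u0: "u0 \<in> I" using I(3) by auto
  define \<sigma> \<sigma>1 \<sigma>2 where "\<sigma> v = S1 (u0, v)" and "\<sigma>1 v = pv S1 (u0, v)" and "\<sigma>2 v = pv (pv S1) (u0, v)" for v
  have z0: "(u0, v) \<in> I \<times> J" if "v \<in> J" for v using u0 that by simp
  have d\<sigma>: "(\<sigma> has_vector_derivative \<sigma>1 v) (at v)" "(\<sigma>1 has_vector_derivative \<sigma>2 v) (at v)"
    if "v \<in> J" for v
    unfolding \<sigma>_def[abs_def] \<sigma>1_def[abs_def] \<sigma>2_def
    using D_v[OF S_smooth(1) z0[OF that]] D_v[OF smooth_on_pv[OF S_smooth(1)] z0[OF that]] .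
  have "\<forall>z\<in>I \<times> J. \<exists>c. c \<noteq> 0 \<and> S1 z = c *\<^sub>R \<sigma> (snd z)"
  proof
    fix z assume z: "z \<in> I \<times> J"
    obtain u v where uv: "z = (u, v)" "u \<in> I" "v \<in> J" using z by auto
    have "S1 z \<in> span {\<sigma> v}"
      using channel_constant[OF E uv(2) u0 uv(3)] span_base[of "S1 z" "{S1 z}"] by (simp add: uv \<sigma>_def)
    then obtain c where "S1 z = c *\<^sub>R \<sigma> v" by (auto simp: span_singleton)
    then show "\<exists>c. c \<noteq> 0 \<and> S1 z = c *\<^sub>R \<sigma> (snd z)" using S_nonzero(1)[OF z] uv by auto
  qed
  from bchoice[OF this] obtain g where g0: "\<forall>z\<in>I \<times> J. g z \<noteq> 0 \<and> S1 z = g z *\<^sub>R \<sigma> (snd z)" by blast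
  have g: "\<And>z. z \<in> I \<times> J \<Longrightarrow> g z \<noteq> 0" "\<And>u v. u \<in> I \<Longrightarrow> v \<in> J \<Longrightarrow> S1 (u, v) = g (u, v) *\<^sub>R \<sigma> v"
    using g0 by auto
  have \<sigma>: "lie (\<sigma> v) (\<sigma> v) = 0" "lie (\<sigma> v) (\<sigma>1 v) = 0" "lie (\<sigma>1 v) (\<sigma>1 v) > 0"
    "lie (\<sigma> v) (\<sigma>2 v) = - lie (\<sigma>1 v) (\<sigma>1 v)" if "v \<in> J" for v
    using null(1)[OF z0[OF that]] derivative_pairings(1,6,8)[OF z0[OF that]]
    by (simp_all add: \<sigma>_def \<sigma>1_def \<sigma>2_def)
  have S\<sigma>: "lie (S2 (u, v)) (\<sigma> v) = 0" if "u \<in> I" "v \<in> J" for u v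
    using null(2)[of "(u, v)"] g(1)[of "(u, v)"] that by (simp add: g(2) lie_simps lie_commute)
  have L\<sigma>: "lie x (\<sigma> v) = 0" if "u \<in> I" "v \<in> J" "x \<in> span {S1 (u, v), S2 (u, v)}" for u v x
    by (rule span_perp[OF that(3)]) (use \<sigma> S\<sigma> that in \<open>simp_all add: g(2) lie_simps\<close>)
  have S\<sigma>1: "lie (S2 (u, v)) (\<sigma>1 v) = 0" if uv: "u \<in> I" "v \<in> J" for u v
  proof -
    have "lie (S2 (u, v)) (\<sigma>1 v) + lie (pv S2 (u, v)) (\<sigma> v) = 0"
      by (rule has_vector_derivative_const_on_open[OF lie.has_vector_derivative[OF
              D_v[OF S_smooth(2)] d\<sigma>(1)] J(1) uv(2)]) (use uv S\<sigma> in auto)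
    then show ?thesis using L\<sigma>[OF uv curvature(2)] uv by simp
  qed
  have S\<sigma>2: "lie (S2 (u, v)) (\<sigma>2 v) = 0" if uv: "u \<in> I" "v \<in> J" for u v
  proof -
    have "lie (S2 (u, v)) (\<sigma>2 v) + lie (pv S2 (u, v)) (\<sigma>1 v) = 0"
      by (rule has_vector_derivative_const_on_open[OF lie.has_vector_derivative[OF
              D_v[OF S_smooth(2)] d\<sigma>(2)] J(1) uv(2)]) (use uv S\<sigma>1 in auto)
    moreover have "lie (pv S2 (u, v)) (\<sigma>1 v) = 0"
      by (rule span_perp[OF curvature(2)]) (use uv \<sigma> S\<sigma>1 in \<open>simp_all add: g(2) lie_simps\<close>)
    ultimately show ?thesis by simp
  qed
  obtain \<alpha> \<beta> \<gamma> where h: "\<forall>z\<in>I \<times> J. \<alpha> z \<noteq> 0 \<and> \<beta> z \<noteq> 0 \<and> \<gamma> z \<noteq> 0 \<and>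
      Sp z = \<alpha> z *s cplx (S1 z) + \<beta> z *s cplx (S2 z) \<and>
      Sm z = \<gamma> z *s (\<alpha> z *s cplx (S1 z) - \<beta> z *s cplx (S2 z))"
    using harmonic unfolding harmonic_separation_def by metis
  obtain k l where kl: "\<forall>z\<in>I \<times> J. pv (pu Sp) z = k z *s Sp z" "\<forall>z\<in>I \<times> J. pv (pu Sm) z = l z *s Sm z"
    using moutard by metis
  have cplx_g: "\<alpha> (u, v) *s cplx (S1 (u, v)) = (\<alpha> (u, v) * of_real (g (u, v))) *s cplx (\<sigma> v)"
    if "u \<in> I" "v \<in> J" for u v
    by (simp add: g(2)[OF that] cplx_def vec_eq_iff)
  interpret mp: moutard_pair I J \<sigma> \<sigma>1 \<sigma>2 S2 Sp Sm "\<lambda>z. \<alpha> z * of_real (g z)" \<beta> \<gamma> k l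
  proof
    show "lie (pu S2 (u, v)) (pu S2 (u, v)) > 0" if "u \<in> I" "v \<in> J" for u v
      using derivative_pairings(7)[of "(u, v)"] that by simp
  qed (use I J d\<sigma> \<sigma> S\<sigma> S\<sigma>1 S\<sigma>2 S_smooth M_smooth null real h kl g in \<open>auto simp flip: cplx_g\<close>)
  obtain a \<Phi> \<Phi>1 r where tn: "translation_net I J \<sigma> \<sigma>1 \<sigma>2 a \<Phi> \<Phi>1"
    and r: "\<And>u v. u \<in> I \<Longrightarrow> v \<in> J \<Longrightarrow> r (u, v) \<noteq> 0 \<and> a v + \<Phi> u = r (u, v) *\<^sub>R S2 (u, v)"
    using mp.translation_net_exists by metis
  interpret tn: translation_net I J \<sigma> \<sigma>1 \<sigma>2 a \<Phi> \<Phi>1 by (rule tn)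
  have span_eq: "span {\<sigma> v, a v + \<Phi> u} \<subseteq> span {S1 (u, v), S2 (u, v)}" if uv: "u \<in> I" "v \<in> J" for u v
  proof (rule span_minimal)
    have "\<sigma> v = (1 / g (u, v)) *\<^sub>R S1 (u, v)" using g(1)[of "(u, v)"] uv by (simp add: g(2)[OF uv])
    moreover have "a v + \<Phi> u = r (u, v) *\<^sub>R S2 (u, v)" using r[OF uv] by simp
    ultimately show "{\<sigma> v, a v + \<Phi> u} \<subseteq> span {S1 (u, v), S2 (u, v)}"
      by (auto intro: span_scale span_base)
  qed simp
  have rep: "net_represents P (I \<times> J) S1 S2"
    if "net_represents P (I \<times> J) (\<lambda>(u, v). \<sigma> v) (\<lambda>(u, v). a v + \<Phi> u)" for P
  proof -
    have "\<forall>z\<in>I \<times> J. span {case z of (u, v) \<Rightarrow> \<sigma> v, case z of (u, v) \<Rightarrow> a v + \<Phi> u} \<subseteq> span {S1 z, S2 z}"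
      using span_eq by auto
    then show ?thesis using that unfolding net_represents_def by (meson subsetD)
  qed
  show ?thesis
  proof (cases "dim tn.W \<ge> 3")
    case True
    obtain V1 V2 where V: "signature_2_1 V1" "signature_2_1 V2" "\<forall>x\<in>V1. \<forall>y\<in>V2. lie x y = 0"
      "\<forall>z. \<exists>x\<in>V1. \<exists>y\<in>V2. z = x + y"
      "\<And>v. v \<in> J \<Longrightarrow> \<sigma> v \<in> V1" "\<And>u v. u \<in> I \<Longrightarrow> v \<in> J \<Longrightarrow> a v + \<Phi> u \<in> V2"
      using tn.dupin_splitting[OF True] by metis
    have sub: "subspace V1" "subspace V2" using V(1,2) by (auto simp: signature_2_1_def)
    have "S1 (u, v) \<in> V1" "S2 (u, v) \<in> V2" if uv: "u \<in> I" "v \<in> J" for u v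
    proof -
      show "S1 (u, v) \<in> V1" using g(2)[OF uv] V(5)[OF uv(2)] sub(1) by (simp add: subspace_scale)
      have "S2 (u, v) = (1 / r (u, v)) *\<^sub>R (a v + \<Phi> u)" using r[OF uv] by simp
      then show "S2 (u, v) \<in> V2" using V(6)[OF uv] sub(2) by (simp add: subspace_scale)
    qed
    then have "net_dupin (I \<times> J) S1 S2" unfolding net_dupin_def using V(1-4) by blast
    then show ?thesis by blast
  next
    case False
    then obtain e w where ew: "lie e e = 1" "lie e w = 0" "w \<noteq> 0"
      "lie w w = 0 \<or> lie w w = 1 \<or> lie w w = -1" "tn.W = span {e, w}"
      using tn.plane_basis by (metis not_le)
    from ew(4) show ?thesis
    proof (elim disjE)
      assume "lie w w = 0"
      then show ?thesis using rep tn.cylinder[OF ew(5,1,2) _ ew(3)] by blast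
    next
      assume "lie w w = 1"
      then show ?thesis using rep tn.revolution[OF ew(5,1,2)] by blast
    next
      assume "lie w w = -1"
      then show ?thesis using rep tn.cone[OF ew(5,1,2)] by blast
    qed
  qed
qed

end

section \<open>Surfaces and their charts\<close>

lemma frechet_derivative_pu_pv:
  assumes "F differentiable (at z)"
  shows "frechet_derivative F (at z) X = fst X *\<^sub>R pu F z + snd X *\<^sub>R pv F z"
proof -
  have lin: "linear (frechet_derivative F (at z))" using assms by (rule linear_frechet_derivative)
  have "X = fst X *\<^sub>R (1, 0) + snd X *\<^sub>R (0, 1)" by (simp add: prod_eq_iff)
  then have "frechet_derivative F (at z) X
      = frechet_derivative F (at z) (fst X *\<^sub>R (1, 0) + snd X *\<^sub>R (0, 1))" by simp
  also have "\<dots> = fst X *\<^sub>R pu F z + snd X *\<^sub>R pv F z"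
    unfolding linear_add[OF lin] linear_cmul[OF lin] pu_def pv_def ..
  finally show ?thesis .
qed

lemma chart:
  assumes "smooth_surface \<Sigma> A" "(E, \<phi>) \<in> A"
  shows "openin \<Sigma> E" "open (\<phi> ` E)" "inj_on \<phi> E" "E \<subseteq> topspace \<Sigma>"
    "homeomorphic_map (subtopology \<Sigma> E) (top_of_set (\<phi> ` E)) \<phi>"
proof -
  have c: "is_chart \<Sigma> (E, \<phi>)" using assms unfolding smooth_surface_def by blast
  then show "openin \<Sigma> E" "open (\<phi> ` E)"
    and h: "homeomorphic_map (subtopology \<Sigma> E) (top_of_set (\<phi> ` E)) \<phi>"
    by (simp_all add: is_chart_def)
  then show sub: "E \<subseteq> topspace \<Sigma>" by (simp add: openin_subset)
  have "inj_on \<phi> (topspace (subtopology \<Sigma> E))"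
    using homeomorphic_imp_injective_map[OF h] .
  then show "inj_on \<phi> E" using sub by (simp add: inf.absorb2)
qed

lemma chart_image_open:
  assumes "smooth_surface \<Sigma> A" "(E, \<phi>) \<in> A" "openin \<Sigma> N"
  shows "open (\<phi> ` (E \<inter> N))"
proof -
  note c = chart[OF assms(1,2)]
  have "openin (subtopology \<Sigma> E) (E \<inter> N)" using assms(3) by (metis inf_commute openin_subtopology_Int)
  then have "openin (top_of_set (\<phi> ` E)) (\<phi> ` (E \<inter> N))"
    using homeomorphic_imp_open_map[OF c(5)] by (simp add: open_map_def)
  then show ?thesis using c(2) by (metis openin_open_trans)
qed

lemma chart_transition:
  assumes "smooth_surface \<Sigma> A" "C \<in> A" "C' \<in> A"
  shows "smooth_transition C C'"
  using assms unfolding smooth_surface_def by blast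

lemma smooth_map_chart:
  assumes "smooth_map A N f" "(E, \<phi>) \<in> A"
  shows "smooth_on (f \<circ> inv_into E \<phi>) (\<phi> ` (E \<inter> N))"
  using assms by (auto simp: smooth_map_def)

lemma chart_change:
  assumes \<Sigma>: "smooth_surface \<Sigma> A" and E: "(E, \<psi>) \<in> A" and D: "(D, \<phi>) \<in> A" and p: "p \<in> E" "p \<in> D"
    and f: "(f \<circ> inv_into D \<phi>) differentiable (at (\<phi> p))"
  shows "\<exists>Y. dmap E \<psi> f p X = frechet_derivative (f \<circ> inv_into D \<phi>) (at (\<phi> p)) Y"
proof -
  define T where "T = \<phi> \<circ> inv_into E \<psi>"
  note cE = chart[OF \<Sigma> E] and cD = chart[OF \<Sigma> D]
  have V: "open (\<psi> ` (E \<inter> D))" using chart_image_open[OF \<Sigma> E cD(1)] .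
  have pV: "\<psi> p \<in> \<psi> ` (E \<inter> D)" using p by auto
  have Tp: "T (\<psi> p) = \<phi> p" using p cE(3) by (simp add: T_def)
  have "smooth_on T (\<psi> ` (E \<inter> D))"
    using chart_transition[OF \<Sigma> E D] by (simp add: smooth_transition_def T_def)
  then have "T differentiable (at (\<psi> p))" using pV by (rule smooth_on_differentiable)
  then have "(T has_derivative frechet_derivative T (at (\<psi> p))) (at (\<psi> p))"
    by (simp add: frechet_derivative_works)
  moreover have "((f \<circ> inv_into D \<phi>) has_derivative frechet_derivative (f \<circ> inv_into D \<phi>) (at (\<phi> p)))
      (at (T (\<psi> p)))"
    using f by (simp add: frechet_derivative_works Tp)
  ultimately have "((f \<circ> inv_into D \<phi>) \<circ> T has_derivative
      frechet_derivative (f \<circ> inv_into D \<phi>) (at (\<phi> p)) \<circ> frechet_derivative T (at (\<psi> p))) (at (\<psi> p))"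
    by (rule diff_chain_at)
  then have "frechet_derivative ((f \<circ> inv_into D \<phi>) \<circ> T) (at (\<psi> p))
      = frechet_derivative (f \<circ> inv_into D \<phi>) (at (\<phi> p)) \<circ> frechet_derivative T (at (\<psi> p))"
    by (metis frechet_derivative_at)
  moreover have "frechet_derivative (f \<circ> inv_into E \<psi>) (at (\<psi> p))
      = frechet_derivative ((f \<circ> inv_into D \<phi>) \<circ> T) (at (\<psi> p))"
  proof (rule frechet_derivative_cong(1)[OF V pV])
    fix y assume "y \<in> \<psi> ` (E \<inter> D)"
    then obtain x where "x \<in> E" "x \<in> D" "y = \<psi> x" by auto
    then show "(f \<circ> inv_into E \<psi>) y = ((f \<circ> inv_into D \<phi>) \<circ> T) y"
      using cE(3) cD(3) by (simp add: T_def)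
  qed
  ultimately show ?thesis
    by (intro exI[of _ "frechet_derivative T (at (\<psi> p)) X"]) (simp add: dmap_def)
qed

text \<open>The atlas is maximal, and composing with the linear map \<open>prod.swap\<close> preserves smoothness of the
  transition maps in both directions.\<close>

lemma swap_chart:
  assumes \<Sigma>: "smooth_surface \<Sigma> A" and D: "(D, \<phi>) \<in> A"
  shows "(D, prod.swap \<circ> \<phi>) \<in> A"
proof -
  note c = chart[OF \<Sigma> D]
  have lin: "bounded_linear (prod.swap :: real \<times> real \<Rightarrow> real \<times> real)"
    by (simp add: prod.swap_def[abs_def] bounded_linear_Pair bounded_linear_fst bounded_linear_snd)
  have "inj_on (prod.swap \<circ> \<phi>) D"
    by (rule inj_onI) (metis comp_apply swap_swap inj_onD[OF c(3)])
  then have inv: "inv_into D (prod.swap \<circ> \<phi>) (prod.swap (\<phi> x)) = x" if "x \<in> D" for x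
    using inv_into_f_f[of "prod.swap \<circ> \<phi>" D x] that by simp
  have swapped: "is_chart \<Sigma> (D, prod.swap \<circ> \<phi>)"
  proof -
    have "homeomorphic_map (top_of_set (\<phi> ` D)) (top_of_set (prod.swap ` \<phi> ` D)) prod.swap"
      unfolding homeomorphic_map_maps
    proof (intro exI[of _ prod.swap])
      show "homeomorphic_maps (top_of_set (\<phi> ` D)) (top_of_set (prod.swap ` \<phi> ` D)) prod.swap prod.swap"
        unfolding homeomorphic_maps_def
        by (auto intro!: continuous_on_swap simp: image_iff)
    qed
    then have "homeomorphic_map (subtopology \<Sigma> D) (top_of_set (prod.swap ` \<phi> ` D)) (prod.swap \<circ> \<phi>)"
      using c(5) homeomorphic_map_compose by blast
    then show ?thesis
      using c(1) open_swap_image[OF c(2)] by (simp add: is_chart_def image_comp)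
  qed
  moreover have "smooth_transition (D, prod.swap \<circ> \<phi>) C' \<and> smooth_transition C' (D, prod.swap \<circ> \<phi>)"
    if C': "C' \<in> A" for C'
  proof -
    obtain F \<psi> where F: "C' = (F, \<psi>)" by (cases C')
    note cF = chart[OF \<Sigma> C'[unfolded F]]
    have op: "open (\<phi> ` (D \<inter> F))" "open (\<psi> ` (F \<inter> D))"
      using chart_image_open[OF \<Sigma> D cF(1)] chart_image_open[OF \<Sigma> C'[unfolded F] c(1)] by simp_all
    have sm: "smooth_on (\<psi> \<circ> inv_into D \<phi>) (\<phi> ` (D \<inter> F))" "smooth_on (\<phi> \<circ> inv_into F \<psi>) (\<psi> ` (F \<inter> D))"
      using chart_transition[OF \<Sigma> D C'] chart_transition[OF \<Sigma> C' D] by (simp_all add: F smooth_transition_def)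
    have "smooth_on ((\<psi> \<circ> inv_into D \<phi>) \<circ> prod.swap) (prod.swap ` \<phi> ` (D \<inter> F))"
      by (rule smooth_on_swap[OF op(1) sm(1)])
    then have "smooth_on (\<psi> \<circ> inv_into D (prod.swap \<circ> \<phi>)) (prod.swap ` \<phi> ` (D \<inter> F))"
      by (rule smooth_on_cong[OF open_swap_image[OF op(1)], THEN iffD1, rotated])
        (use c(3) in \<open>auto simp del: swap_simp simp: inv\<close>)
    moreover have "smooth_on (prod.swap \<circ> (\<phi> \<circ> inv_into F \<psi>)) (\<psi> ` (F \<inter> D))"
      by (rule smooth_on_bounded_linear[OF lin sm(2) op(2)])
    ultimately show ?thesis by (simp add: F smooth_transition_def image_comp comp_assoc)
  qed
  ultimately show ?thesis using \<Sigma> unfolding smooth_surface_def by blast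
qed

text \<open>If the coordinate derivatives of a section lie in \<open>\<Lambda>\<close> at \<open>p\<close>, then so do its derivatives in all
  directions and all charts, and \<open>p\<close> is an umbilic.\<close>

lemma umbilic_free_regular:
  assumes \<Sigma>: "smooth_surface \<Sigma> A" and D: "(D, \<phi>) \<in> A" and free: "umbilic_free \<Sigma> A \<Lambda>"
    and s: "smooth_map A D s" "\<And>p. p \<in> D \<Longrightarrow> s p \<in> \<Lambda> p" and p: "p \<in> D" "s p \<noteq> 0" and sub: "subspace (\<Lambda> p)"
    and d: "pu (s \<circ> inv_into D \<phi>) (\<phi> p) \<in> \<Lambda> p" "pv (s \<circ> inv_into D \<phi>) (\<phi> p) \<in> \<Lambda> p"
  shows False
proof -
  note c = chart[OF \<Sigma> D]
  have "smooth_on (s \<circ> inv_into D \<phi>) (\<phi> ` (D \<inter> D))" using smooth_map_chart[OF s(1) D] .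
  then have diff: "(s \<circ> inv_into D \<phi>) differentiable (at (\<phi> p))"
    by (rule smooth_on_differentiable) (use p in auto)
  have "dmap E \<psi> s p X \<in> \<Lambda> p" if E: "(E, \<psi>) \<in> A" "p \<in> E" for E \<psi> X
  proof -
    obtain Y where "dmap E \<psi> s p X = frechet_derivative (s \<circ> inv_into D \<phi>) (at (\<phi> p)) Y"
      using chart_change[OF \<Sigma> E(1) D E(2) p(1) diff] by blast
    then show ?thesis
      using d sub by (simp add: frechet_derivative_pu_pv[OF diff] subspace_add subspace_scale)
  qed
  moreover have "local_section \<Sigma> A \<Lambda> D s" using c(1) s by (simp add: local_section_def)
  ultimately have "umbilic \<Sigma> A \<Lambda> p" using p unfolding umbilic_def by blast
  then show False using free p(1) c(4) by (auto simp: umbilic_free_def)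
qed

lemma channel_net_of_chart:
  assumes \<Sigma>: "smooth_surface \<Sigma> A" and leg: "legendre_immersion \<Sigma> A \<Lambda>" and free: "umbilic_free \<Sigma> A \<Lambda>"
    and IJ: "open I" "open J" "connected I" "connected J" "I \<noteq> {}" "J \<noteq> {}" "\<phi> ` D = I \<times> J"
    and curv: "curvature_spheres A \<Lambda> D \<phi> s1 s2"
    and M: "moutard_lift A D \<phi> sp" "moutard_lift A D \<phi> sm"
    and real: "(\<forall>p\<in>D. cnjv (sp p) = sp p \<and> cnjv (sm p) = sm p) \<or> (\<forall>p\<in>D. sm p = cnjv (sp p))"
    and harm: "\<forall>p\<in>D. harmonic_separation (cplx (s1 p)) (cplx (s2 p)) (sp p) (sm p)"
    and channel: "\<forall>p\<in>topspace \<Sigma>. s p \<noteq> 0 \<and> s p \<in> \<Lambda> p \<and>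
        (\<exists>N T (t :: 'a \<Rightarrow> real) (c :: real \<Rightarrow> real^6).
           openin \<Sigma> N \<and> p \<in> N \<and> smooth_map A N t \<and> open T \<and> t ` N \<subseteq> T \<and> smooth_on c T \<and>
           (\<forall>x\<in>N. c (t x) \<noteq> 0 \<and> span {s x} = span {c (t x)}))"
  shows "channel_net I J (s1 \<circ> inv_into D \<phi>) (s2 \<circ> inv_into D \<phi>)
    (sp \<circ> inv_into D \<phi>) (sm \<circ> inv_into D \<phi>) (s \<circ> inv_into D \<phi>)"
proof -
  have D: "(D, \<phi>) \<in> A" and s_smooth: "smooth_map A D s1" "smooth_map A D s2"
    and fr: "\<And>p. p \<in> D \<Longrightarrow> frame_of (s1 p) (s2 p) (\<Lambda> p)"
    and dd: "\<And>p. p \<in> D \<Longrightarrow> d_u D \<phi> s1 p \<in> \<Lambda> p" "\<And>p. p \<in> D \<Longrightarrow> d_v D \<phi> s2 p \<in> \<Lambda> p"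
    using curv by (auto simp: curvature_spheres_def)
  note c = chart[OF \<Sigma> D]
  let ?i = "inv_into D \<phi>"
  have i: "?i z \<in> D" "\<phi> (?i z) = z" if "z \<in> I \<times> J" for z
    using that IJ(7) by (auto intro: inv_into_into f_inv_into_f)
  have smooth: "smooth_on (f \<circ> ?i) (I \<times> J)" if "smooth_map A D f" for f :: "'a \<Rightarrow> 'b::real_normed_vector"
    using smooth_map_chart[OF that D] IJ(7) by simp
  have fr': "s1 p \<noteq> s2 p" "independent {s1 p, s2 p}" "\<Lambda> p = span {s1 p, s2 p}" if "p \<in> D" for p
    using fr[OF that] by (auto simp: frame_of_def)
  have \<Lambda>: "s1 p \<in> \<Lambda> p" "s2 p \<in> \<Lambda> p" "subspace (\<Lambda> p)" if "p \<in> D" for p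
    using fr'(3)[OF that] by (auto simp: span_base)
  have s0: "s1 p \<noteq> 0" "s2 p \<noteq> 0" if "p \<in> D" for p
    using fr'(2)[OF that] dependent_zero[of "{s1 p, s2 p}"] by auto
  have sec: "local_section \<Sigma> A \<Lambda> D s1" "local_section \<Sigma> A \<Lambda> D s2"
    using c(1) s_smooth \<Lambda> by (auto simp: local_section_def)
  have leg': "lie (a p) (b p) = 0" "lie (dmap D \<phi> a p X) (b p) = 0"
    if "local_section \<Sigma> A \<Lambda> D a" "local_section \<Sigma> A \<Lambda> D b" "p \<in> D" for a b p X
  proof -
    have "lie (a p) (b p) = 0 \<and> (\<forall>(E, \<phi>)\<in>A. p \<in> E \<longrightarrow> (\<forall>X. lie (dmap E \<phi> a p X) (b p) = 0))"
      using leg that unfolding legendre_immersion_def by blast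
    then show "lie (a p) (b p) = 0" "lie (dmap D \<phi> a p X) (b p) = 0" using D that(3) by blast+
  qed
  have dmap_pu: "dmap D \<phi> f (?i z) (1, 0) = pu (f \<circ> ?i) z" "dmap D \<phi> f (?i z) (0, 1) = pv (f \<circ> ?i) z"
    if "z \<in> I \<times> J" for f :: "'a \<Rightarrow> 'b::real_normed_vector" and z
    using i(2)[OF that] by (simp_all add: dmap_def pu_def pv_def)
  have op: "open (I \<times> J)" using IJ(1,2) by (rule open_Times)
  have mout: "\<exists>k. pv (pu (f \<circ> ?i)) z = k *s (f \<circ> ?i) z" if f: "moutard_lift A D \<phi> f" and z: "z \<in> I \<times> J" for f z
  proof -
    obtain k where "d_v D \<phi> (d_u D \<phi> f) (?i z) = k *s f (?i z)"
      using f i(1)[OF z] by (auto simp: moutard_lift_def)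
    moreover have "d_v D \<phi> (d_u D \<phi> f) (?i z) = pv (d_u D \<phi> f \<circ> ?i) z"
      using dmap_pu(2)[OF z] by (simp add: d_v_def)
    moreover have "\<dots> = pv (pu (f \<circ> ?i)) z"
      by (rule pu_pv_cong(2)[OF op z]) (simp add: d_u_def dmap_pu)
    ultimately show ?thesis by auto
  qed
  show ?thesis
  proof
    show "smooth_on (s1 \<circ> ?i) (I \<times> J)" "smooth_on (s2 \<circ> ?i) (I \<times> J)"
      "smooth_on (sp \<circ> ?i) (I \<times> J)" "smooth_on (sm \<circ> ?i) (I \<times> J)"
      using s_smooth M by (auto intro!: smooth simp: moutard_lift_def)
    show "(\<forall>z\<in>I \<times> J. cnjv ((sp \<circ> ?i) z) = (sp \<circ> ?i) z) \<or> (\<forall>z\<in>I \<times> J. (sm \<circ> ?i) z = cnjv ((sp \<circ> ?i) z))"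
      using real i(1) by auto
  next
    fix z assume z: "z \<in> I \<times> J"
    note p = i(1)[OF z]
    show "(s1 \<circ> ?i) z \<noteq> (s2 \<circ> ?i) z" "independent {(s1 \<circ> ?i) z, (s2 \<circ> ?i) z}"
      using fr'[OF p] by simp_all
    show "lie ((s1 \<circ> ?i) z) ((s1 \<circ> ?i) z) = 0" "lie ((s1 \<circ> ?i) z) ((s2 \<circ> ?i) z) = 0"
      "lie ((s2 \<circ> ?i) z) ((s2 \<circ> ?i) z) = 0"
      using leg'(1) sec p by simp_all
    show "lie (pv (s1 \<circ> ?i) z) ((s2 \<circ> ?i) z) = 0" "lie (pu (s2 \<circ> ?i) z) ((s1 \<circ> ?i) z) = 0"
      using leg'(2)[OF sec(1,2) p, of "(0, 1)"] leg'(2)[OF sec(2,1) p, of "(1, 0)"]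
      by (simp_all add: dmap_pu[OF z])
    show cu: "pu (s1 \<circ> ?i) z \<in> span {(s1 \<circ> ?i) z, (s2 \<circ> ?i) z}"
      "pv (s2 \<circ> ?i) z \<in> span {(s1 \<circ> ?i) z, (s2 \<circ> ?i) z}"
      using dd[OF p] fr'(3)[OF p] by (simp_all add: d_u_def d_v_def dmap_pu[OF z])
    show "pv (s1 \<circ> ?i) z \<notin> span {(s1 \<circ> ?i) z, (s2 \<circ> ?i) z}"
      using umbilic_free_regular[OF \<Sigma> D free s_smooth(1) \<Lambda>(1) p s0(1)[OF p] \<Lambda>(3)[OF p]] cu(1)
      by (auto simp: i(2)[OF z] fr'(3)[OF p])
    show "pu (s2 \<circ> ?i) z \<notin> span {(s1 \<circ> ?i) z, (s2 \<circ> ?i) z}"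
      using umbilic_free_regular[OF \<Sigma> D free s_smooth(2) \<Lambda>(2) p s0(2)[OF p] \<Lambda>(3)[OF p]] cu(2)
      by (auto simp: i(2)[OF z] fr'(3)[OF p])
    show "\<exists>k. pv (pu (sp \<circ> ?i)) z = k *s (sp \<circ> ?i) z" "\<exists>k. pv (pu (sm \<circ> ?i)) z = k *s (sm \<circ> ?i) z"
      using mout M z by blast+
    show "harmonic_separation (cplx ((s1 \<circ> ?i) z)) (cplx ((s2 \<circ> ?i) z)) ((sp \<circ> ?i) z) ((sm \<circ> ?i) z)"
      using harm p by simp
    have pS: "?i z \<in> topspace \<Sigma>" using p c(4) by blast
    show "(s \<circ> ?i) z \<noteq> 0" "(s \<circ> ?i) z \<in> span {(s1 \<circ> ?i) z, (s2 \<circ> ?i) z}"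
      using channel pS fr'(3)[OF p] by auto
    obtain N T and t :: "'a \<Rightarrow> real" and c :: "real \<Rightarrow> real^6" where N: "openin \<Sigma> N" "?i z \<in> N"
      "smooth_map A N t" "open T" "t ` N \<subseteq> T" "smooth_on c T"
      "\<forall>x\<in>N. c (t x) \<noteq> 0 \<and> span {s x} = span {c (t x)}"
      using conjunct2[OF conjunct2[OF bspec[OF channel pS]]]
      by (elim exE conjE) (rule that, assumption+)
    have "z \<in> \<phi> ` (D \<inter> N)" using N(2) p i(2)[OF z] by (metis IntI image_eqI)
    moreover have "\<phi> ` (D \<inter> N) \<subseteq> I \<times> J" using IJ(7) by blast
    moreover have "one_parameter_on (s \<circ> ?i) (\<phi> ` (D \<inter> N)) (t \<circ> ?i) c"
      unfolding one_parameter_on_def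
    proof (intro conjI ballI)
      show "open (\<phi> ` (D \<inter> N))" by (rule chart_image_open[OF \<Sigma> D N(1)])
      fix y assume y: "y \<in> \<phi> ` (D \<inter> N)"
      then obtain x where x: "x \<in> D" "x \<in> N" "y = \<phi> x" by auto
      then have iy: "?i y = x" using \<open>inj_on \<phi> D\<close> by simp
      show "(t \<circ> ?i) differentiable (at y)"
        using smooth_map_chart[OF N(3) D] y by (rule smooth_on_differentiable)
      show "c differentiable (at ((t \<circ> ?i) y))"
        using N(5,6) x(2) by (auto simp: iy intro!: smooth_on_differentiable)
      show "c ((t \<circ> ?i) y) \<noteq> 0" "span {(s \<circ> ?i) y} = span {c ((t \<circ> ?i) y)}"
        using N(7) x(2) by (simp_all add: iy)
    qed
    ultimately show "\<exists>N\<subseteq>I \<times> J. z \<in> N \<and> (\<exists>t c. one_parameter_on (s \<circ> ?i) N t c)" by blast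
  qed (use IJ in auto)
qed

lemma special_surface_cong:
  assumes "P \<in> {is_cone, is_cylinder, is_revolution}" "\<And>z. z \<in> U \<Longrightarrow> X z = Y z" "P U X"
  shows "P U Y"
proof -
  have eq: "Y (u, v) = X (u, v)" if "(u, v) \<in> U" for u v using assms(2)[OF that] by simp
  consider "P = is_cone" | "P = is_cylinder" | "P = is_revolution" using assms(1) by blast
  then show ?thesis
  proof cases
    case 1
    then obtain a t \<gamma> where h: "\<forall>(u, v)\<in>U. regular_at t u \<and> \<gamma> v \<noteq> 0 \<and> X (u, v) = a + t u *\<^sub>R \<gamma> v"
      using assms(3) unfolding is_cone_def by blast
    have "is_cone U Y"
      unfolding is_cone_def
      by (rule exI[of _ a], rule exI[of _ t], rule exI[of _ \<gamma>]) (use h in \<open>auto simp: eq\<close>)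
    then show ?thesis using 1 by simp
  next
    case 2
    then obtain d t \<gamma> where h: "d \<noteq> 0" "\<forall>(u, v)\<in>U. regular_at t u \<and> X (u, v) = \<gamma> v + t u *\<^sub>R d"
      using assms(3) unfolding is_cylinder_def by blast
    have "is_cylinder U Y"
      unfolding is_cylinder_def
      by (rule exI[of _ d], rule exI[of _ t], rule exI[of _ \<gamma>]) (use h in \<open>auto simp: eq\<close>)
    then show ?thesis using 2 by simp
  next
    case 3
    then obtain a e1 e2 e3 r h \<theta> where H: "norm e1 = 1" "norm e2 = 1" "norm e3 = 1"
      "e1 \<bullet> e2 = 0" "e1 \<bullet> e3 = 0" "e2 \<bullet> e3 = 0" "\<forall>(u, v)\<in>U. regular_at \<theta> u \<and>
        X (u, v) = a + r v *\<^sub>R (cos (\<theta> u) *\<^sub>R e1 + sin (\<theta> u) *\<^sub>R e2) + h v *\<^sub>R e3"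
      using assms(3) unfolding is_revolution_def by blast
    have "is_revolution U Y"
      unfolding is_revolution_def
      by (rule exI[of _ a], rule exI[of _ e1], rule exI[of _ e2], rule exI[of _ e3],
          rule exI[of _ r], rule exI[of _ h], rule exI[of _ \<theta>]) (use H in \<open>auto simp: eq\<close>)
    then show ?thesis using 3 by simp
  qed
qed

lemma represents_in_of_net:
  assumes \<Sigma>: "smooth_surface \<Sigma> A" and \<psi>: "(D, \<psi>) \<in> A" "\<psi> ` D = U"
    and P: "P \<in> {is_cone, is_cylinder, is_revolution}" and net: "net_represents P U F1 F2"
    and F: "\<And>p. p \<in> D \<Longrightarrow> span {F1 (\<psi> p), F2 (\<psi> p)} \<subseteq> \<Lambda> p"
  shows "\<exists>\<pp> \<qq>. euclidean_subgeometry \<pp> \<qq> \<and> represents_in P A \<Lambda> D \<pp> \<qq>"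
proof -
  obtain p q b E f where pq: "euclidean_subgeometry p q" "euclidean_frame p q b E"
    and f: "\<forall>z\<in>U. f z \<in> span {F1 z, F2 z} \<and> f z \<in> space_form p q"
    and Pf: "P U (\<lambda>z. \<chi> i. lie (f z) (E i))"
    using net unfolding net_represents_def by blast
  define x where "x y = (\<chi> i. lie (f (\<psi> y)) (E i))" for y
  have "represents_in P A \<Lambda> D p q"
    unfolding represents_in_def
  proof (intro exI conjI)
    show "\<forall>y\<in>D. (f \<circ> \<psi>) y \<in> \<Lambda> y \<and> (f \<circ> \<psi>) y \<in> space_form p q \<and>
        (f \<circ> \<psi>) y = euclidean_point q b E (x y)"
    proof
      fix y assume y: "y \<in> D"
      then have "\<psi> y \<in> U" using \<psi>(2) by blast
      then have "f (\<psi> y) \<in> \<Lambda> y" "f (\<psi> y) \<in> space_form p q" using f F[OF y] by blast+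
      then show "(f \<circ> \<psi>) y \<in> \<Lambda> y \<and> (f \<circ> \<psi>) y \<in> space_form p q \<and>
        (f \<circ> \<psi>) y = euclidean_point q b E (x y)"
        using euclidean_point_coordinates[OF pq, of "f (\<psi> y)"] unfolding x_def comp_def by blast
    qed
    show "P (\<psi> ` D) (x \<circ> inv_into D \<psi>)"
      unfolding \<psi>(2)
    proof (rule special_surface_cong[OF P _ Pf])
      fix z assume "z \<in> U"
      then have "\<psi> (inv_into D \<psi> z) = z" using \<psi>(2) by (metis f_inv_into_f)
      then show "(\<chi> i. lie (f z) (E i)) = (x \<circ> inv_into D \<psi>) z" by (simp add: x_def)
    qed
  qed (use \<psi>(1) pq(2) in auto)
  then show ?thesis using pq(1) by blast
qed

text \<open>The chart \<open>\<psi>\<close> may be the given one or the one with exchanged coordinates; accordingly the net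
  consists of the curvature spheres in either order.\<close>

lemma conclusion_of_net:
  assumes \<Sigma>: "smooth_surface \<Sigma> A" and curv: "curvature_spheres A \<Lambda> D \<phi> s1 s2"
    and \<psi>: "(D, \<psi>) \<in> A" "\<psi> ` D = U"
    and F: "(\<forall>p\<in>D. F1 (\<psi> p) = s1 p \<and> F2 (\<psi> p) = s2 p) \<or> (\<forall>p\<in>D. F1 (\<psi> p) = s2 p \<and> F2 (\<psi> p) = s1 p)"
    and net: "net_dupin U F1 F2 \<or> net_represents is_cone U F1 F2 \<or>
      net_represents is_cylinder U F1 F2 \<or> net_represents is_revolution U F1 F2"
  shows "dupin_cyclide A \<Lambda> D \<or>
     (\<exists>\<pp> \<qq>. euclidean_subgeometry \<pp> \<qq> \<and>
        (represents_in is_cone A \<Lambda> D \<pp> \<qq> \<or>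
         represents_in is_cylinder A \<Lambda> D \<pp> \<qq> \<or>
         represents_in is_revolution A \<Lambda> D \<pp> \<qq>))"
proof -
  have "span {F1 (\<psi> p), F2 (\<psi> p)} \<subseteq> \<Lambda> p" if "p \<in> D" for p
    using F curv that by (auto simp: curvature_spheres_def frame_of_def insert_commute)
  then have rep: "\<exists>\<pp> \<qq>. euclidean_subgeometry \<pp> \<qq> \<and> represents_in P A \<Lambda> D \<pp> \<qq>"
    if "P \<in> {is_cone, is_cylinder, is_revolution}" "net_represents P U F1 F2" for P
    using represents_in_of_net[OF \<Sigma> \<psi> that] by blast
  have "dupin_cyclide A \<Lambda> D" if dup: "net_dupin U F1 F2"
  proof -
    obtain V1 V2 where V: "signature_2_1 V1" "signature_2_1 V2" "\<forall>x\<in>V1. \<forall>y\<in>V2. lie x y = 0"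
      "\<forall>z. \<exists>x\<in>V1. \<exists>y\<in>V2. z = x + y" "\<forall>z\<in>U. F1 z \<in> V1 \<and> F2 z \<in> V2"
      using dup unfolding net_dupin_def by blast
    have FV: "F1 (\<psi> p) \<in> V1" "F2 (\<psi> p) \<in> V2" if "p \<in> D" for p using V(5) \<psi>(2) that by auto
    have V': "\<forall>x\<in>V2. \<forall>y\<in>V1. lie x y = 0" "\<forall>z. \<exists>x\<in>V2. \<exists>y\<in>V1. z = x + y"
      using V(3,4) by (metis lie_commute) (metis V(4) add.commute)
    from F show ?thesis
    proof
      assume "\<forall>p\<in>D. F1 (\<psi> p) = s1 p \<and> F2 (\<psi> p) = s2 p"
      then have "\<forall>p\<in>D. s1 p \<in> V1 \<and> s2 p \<in> V2" using FV by metis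
      then show ?thesis unfolding dupin_cyclide_def using curv V(1-4) by blast
    next
      assume "\<forall>p\<in>D. F1 (\<psi> p) = s2 p \<and> F2 (\<psi> p) = s1 p"
      then have "\<forall>p\<in>D. s1 p \<in> V2 \<and> s2 p \<in> V1" using FV by metis
      then show ?thesis unfolding dupin_cyclide_def using curv V(1,2) V' by blast
    qed
  qed
  then show ?thesis
    using net rep[of is_cone] rep[of is_cylinder] rep[of is_revolution] by blast
qed

theorem theorem4p3:
  fixes \<Sigma> :: "'a topology" and A :: "'a chart set" and \<Lambda> :: "'a \<Rightarrow> (real^6) set"
  assumes "smooth_surface \<Sigma> A"
    and "legendre_immersion \<Sigma> A \<Lambda>"
    and "umbilic_free \<Sigma> A \<Lambda>"
    and "omega_surface \<Sigma> A \<Lambda>"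
    and "channel_surface \<Sigma> A \<Lambda>"
  shows "\<forall>D \<phi>. omega_rectangle A \<Lambda> D \<phi> \<longrightarrow>
     dupin_cyclide A \<Lambda> D \<or>
     (\<exists>\<pp> \<qq>. euclidean_subgeometry \<pp> \<qq> \<and>
        (represents_in is_cone A \<Lambda> D \<pp> \<qq> \<or>
         represents_in is_cylinder A \<Lambda> D \<pp> \<qq> \<or>
         represents_in is_revolution A \<Lambda> D \<pp> \<qq>))"
proof (intro allI impI)
  fix D \<phi> assume "omega_rectangle A \<Lambda> D \<phi>"
  then obtain I J s1 s2 sp sm where IJ: "open I" "open J" "connected I" "connected J" "I \<noteq> {}" "J \<noteq> {}"
      "\<phi> ` D = I \<times> J"
    and curv: "curvature_spheres A \<Lambda> D \<phi> s1 s2"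
    and M: "moutard_lift A D \<phi> sp" "moutard_lift A D \<phi> sm"
      "(\<forall>p\<in>D. cnjv (sp p) = sp p \<and> cnjv (sm p) = sm p) \<or> (\<forall>p\<in>D. sm p = cnjv (sp p))"
      "\<forall>p\<in>D. harmonic_separation (cplx (s1 p)) (cplx (s2 p)) (sp p) (sm p)"
    unfolding omega_rectangle_def by blast
  obtain s where s: "\<forall>p\<in>topspace \<Sigma>. s p \<noteq> 0 \<and> s p \<in> \<Lambda> p \<and>
        (\<exists>N T (t :: 'a \<Rightarrow> real) (c :: real \<Rightarrow> real^6).
           openin \<Sigma> N \<and> p \<in> N \<and> smooth_map A N t \<and> open T \<and> t ` N \<subseteq> T \<and> smooth_on c T \<and>
           (\<forall>x\<in>N. c (t x) \<noteq> 0 \<and> span {s x} = span {c (t x)}))"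
    using assms(5) unfolding channel_surface_def by blast
  let ?i = "inv_into D \<phi>"
  have net: "channel_net I J (s1 \<circ> ?i) (s2 \<circ> ?i) (sp \<circ> ?i) (sm \<circ> ?i) (s \<circ> ?i)"
    by (rule channel_net_of_chart[OF assms(1-3) IJ curv M s])
  have D: "(D, \<phi>) \<in> A" using curv by (simp add: curvature_spheres_def)
  have i: "?i (\<phi> p) = p" if "p \<in> D" for p using chart(3)[OF assms(1) D] that by simp
  from channel_net.channel_dichotomy[OF net]
  show "dupin_cyclide A \<Lambda> D \<or>
     (\<exists>\<pp> \<qq>. euclidean_subgeometry \<pp> \<qq> \<and>
        (represents_in is_cone A \<Lambda> D \<pp> \<qq> \<or>
         represents_in is_cylinder A \<Lambda> D \<pp> \<qq> \<or>
         represents_in is_revolution A \<Lambda> D \<pp> \<qq>))"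
  proof
    assume "\<forall>z\<in>I \<times> J. (s \<circ> ?i) z \<in> span {(s1 \<circ> ?i) z}"
    then have "net_dupin (I \<times> J) (s1 \<circ> ?i) (s2 \<circ> ?i) \<or> net_represents is_cone (I \<times> J) (s1 \<circ> ?i) (s2 \<circ> ?i) \<or>
      net_represents is_cylinder (I \<times> J) (s1 \<circ> ?i) (s2 \<circ> ?i) \<or>
      net_represents is_revolution (I \<times> J) (s1 \<circ> ?i) (s2 \<circ> ?i)"
      using channel_net.classification[OF net] by blast
    then show ?thesis by (rule conclusion_of_net[OF assms(1) curv D IJ(7), rotated]) (simp add: i)
  next
    assume 2: "\<forall>z\<in>I \<times> J. (s \<circ> ?i) z \<in> span {(s2 \<circ> ?i) z}"
    let ?F1 = "s2 \<circ> ?i \<circ> prod.swap" and ?F2 = "s1 \<circ> ?i \<circ> prod.swap"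
    have cl: "net_dupin (J \<times> I) ?F1 ?F2 \<or> net_represents is_cone (J \<times> I) ?F1 ?F2 \<or>
      net_represents is_cylinder (J \<times> I) ?F1 ?F2 \<or> net_represents is_revolution (J \<times> I) ?F1 ?F2"
      using channel_net.classification[OF channel_net.channel_net_swap[OF net]] 2 by auto
    have "(prod.swap \<circ> \<phi>) ` D = J \<times> I"
      unfolding image_comp[symmetric] IJ(7) by (rule product_swap)
    from conclusion_of_net[OF assms(1) curv swap_chart[OF assms(1) D] this _ cl]
    show ?thesis by (simp add: i)
  qed
qed

end
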